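(* Let $\delta\ge 2$ be an integer and let $G$ be a connected graph of order $n$ with minimum degree $\delta(G)\ge\delta$. Assume that $n\ge 8$ if $\delta\in\{2,3\}$, and that $n\ge 2\delta+2$ if $\delta\ge4$. If $\rho(G)\ge\rho(\mathcal C_{n,\delta})$, then $G$ has a connected even factor unless $G\cong\mathcal C_{n,\delta}$.
   Context: All graphs are finite, simple and undirected. $\rho(G)$ denotes the spectral radius, i.e. the largest eigenvalue of the adjacency matrix of $G$. A connected even factor of a graph is a spanning connected subgraph in which every vertex has even degree. For $\delta\ge2$ and $n\ge2\delta+2$, $\mathcal C_{n,\delta}$ is the graph of order $n$ obtained from two disjoint cliques $K_{\delta+1}$ and $K_{n-\delta-1}$ by choosing one vertex in each clique and joining the two chosen vertices by exactly one edge. *)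

theory Defs
  imports "Graph_Theory.Graph_Theory" "Jordan_Normal_Form.Spectral_Radius"
begin

text \<open>
  Finite simple undirected graphs are the \<^locale>\<open>pair_graph\<close>s: finite loop-free
  digraphs without parallel arcs whose arc relation is symmetric, so that an edge
  \<open>{u, v}\<close> is the pair of arcs \<open>(u, v)\<close>, \<open>(v, u)\<close>. In particular the degree of
  a vertex is its \<^const>\<open>out_degree\<close>.
\<close>

definition min_degree :: "'a pair_pre_digraph \<Rightarrow> nat" where
  "min_degree G = Min (out_degree (with_proj G) ` pverts G)"

definition adjacency_matrix :: "'a list \<Rightarrow> 'a pair_pre_digraph \<Rightarrow> real mat" where
  "adjacency_matrix vs G =
     mat (length vs) (length vs) (\<lambda>(i, j). if (vs ! i, vs ! j) \<in> parcs G then 1 else 0)"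

text \<open>
  Vertices are not numbered, so the adjacency matrix is taken with respect to some
  enumeration of them; lemma \<open>graph_spectral_radius_eq\<close> below shows that every
  enumeration gives the same value. Only real eigenvalues enter the maximum, which
  loses nothing as the matrix is real symmetric.
\<close>

definition graph_spectral_radius :: "'a pair_pre_digraph \<Rightarrow> real" where
  "graph_spectral_radius G =
     Max (spectrum (adjacency_matrix (SOME vs. distinct vs \<and> set vs = pverts G) G))"

definition connected_even_factor :: "'a pair_pre_digraph \<Rightarrow> 'a pair_pre_digraph \<Rightarrow> bool" where
  "connected_even_factor H G \<longleftrightarrow>
     pair_graph H \<and> spanning (with_proj H) (with_proj G) \<and>
     Digraph_Component.connected (with_proj H) \<and>
     (\<forall>v\<in>pverts H. even (out_degree (with_proj H) v))"

definition clique_arcs :: "'a set \<Rightarrow> 'a rel" where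
  "clique_arcs S = {(u, v). u \<in> S \<and> v \<in> S \<and> u \<noteq> v}"

text \<open>
  The graph $\mathcal C_{n,\delta}$, with \<open>K\<^bsub>d+1\<^esub>\<close> on \<open>{0..d}\<close>,
  \<open>K\<^bsub>n-d-1\<^esub>\<close> on \<open>{d+1..<n}\<close> and the joining edge between \<open>d\<close> and \<open>d + 1\<close>.
\<close>

definition bridged_cliques :: "nat \<Rightarrow> nat \<Rightarrow> nat pair_pre_digraph" where
  "bridged_cliques n d =
     \<lparr> pverts = {0..<n},
       parcs = clique_arcs {0..d} \<union> clique_arcs {d + 1..<n} \<union> {(d, d + 1), (d + 1, d)} \<rparr>"

lemma pair_graph_bridged_cliques:
  assumes "d + 2 \<le> n"
  shows "pair_graph (bridged_cliques n d)"
proof -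
  have "parcs (bridged_cliques n d) \<subseteq> {0..<n} \<times> {0..<n}"
    using assms by (auto simp: bridged_cliques_def clique_arcs_def)
  then have "finite (parcs (bridged_cliques n d))"
    by (rule finite_subset) auto
  then show ?thesis
    using assms
    by unfold_locales
      (auto simp: bridged_cliques_def clique_arcs_def symmetric_def arcs_ends_conv intro!: symI)
qed

lemma eigenvalue_adjacency_matrix:
  assumes vs: "distinct vs" and V: "set vs = V"
  shows "eigenvalue (adjacency_matrix vs G) k \<longleftrightarrow>
    (\<exists>f. (\<exists>v\<in>V. f v \<noteq> 0) \<and>
       (\<forall>v\<in>V. (\<Sum>w\<in>V. if (v, w) \<in> parcs G then f w else 0) = k * f v))"
    (is "?L \<longleftrightarrow> ?R")
proof -
  let ?n = "length vs" and ?A = "adjacency_matrix vs G"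
  have dim: "dim_row ?A = ?n" "dim_col ?A = ?n"
    by (simp_all add: adjacency_matrix_def)
  have sum_eq: "(\<Sum>w\<in>V. g w) = (\<Sum>j = 0..<?n. g (vs ! j))" for g :: "'a \<Rightarrow> real"
  proof -
    have "bij_betw (\<lambda>j. vs ! j) {0..<?n} V"
      using vs V bij_betw_nth[of vs "{0..<?n}" V] by (auto simp: atLeast0LessThan)
    from sum.reindex_bij_betw[OF this, of g] show ?thesis by simp
  qed
  have mul: "(?A *\<^sub>v x) $ i = (\<Sum>j = 0..<?n. if (vs ! i, vs ! j) \<in> parcs G then x $ j else 0)"
    if "i < ?n" "x \<in> carrier_vec ?n" for x i
    using that by (auto simp: adjacency_matrix_def scalar_prod_def intro!: sum.cong)
  show ?thesis
  proof
    assume ?L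
    then obtain x where x: "x \<in> carrier_vec ?n" "x \<noteq> 0\<^sub>v ?n" "?A *\<^sub>v x = k \<cdot>\<^sub>v x"
      by (auto simp: eigenvalue_def eigenvector_def dim)
    define f where "f v = x $ (THE j. j < ?n \<and> vs ! j = v)" for v
    have f: "f (vs ! j) = x $ j" if "j < ?n" for j
    proof -
      have "(THE i. i < ?n \<and> vs ! i = vs ! j) = j"
        using that vs by (auto simp: nth_eq_iff_index_eq)
      then show ?thesis by (simp add: f_def)
    qed
    obtain i where i: "i < ?n" "x $ i \<noteq> 0"
    proof -
      have "\<exists>i<?n. x $ i \<noteq> 0"
      proof (rule ccontr)
        assume "\<not> ?thesis"
        then have "x = 0\<^sub>v ?n" using x(1) by (intro eq_vecI) auto
        with x(2) show False by simp
      qed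
      then show ?thesis using that by blast
    qed
    have "(\<Sum>w\<in>V. if (v, w) \<in> parcs G then f w else 0) = k * f v" if v: "v \<in> V" for v
    proof -
      obtain j where j: "j < ?n" "v = vs ! j" using v V by (auto simp: in_set_conv_nth)
      have "(\<Sum>w\<in>V. if (v, w) \<in> parcs G then f w else 0) = (?A *\<^sub>v x) $ j"
        unfolding sum_eq mul[OF j(1) x(1)] by (rule sum.cong) (auto simp: f j)
      also have "\<dots> = k * f v" using x j f by simp
      finally show ?thesis .
    qed
    moreover have "vs ! i \<in> V" "f (vs ! i) \<noteq> 0" using i V f by auto
    ultimately show ?R by blast
  next
    assume ?R
    then obtain f v where f: "v \<in> V" "f v \<noteq> 0"
      "\<And>v. v \<in> V \<Longrightarrow> (\<Sum>w\<in>V. if (v, w) \<in> parcs G then f w else 0) = k * f v"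
      by blast
    define x where "x = vec ?n (\<lambda>j. f (vs ! j))"
    have x: "x \<in> carrier_vec ?n" by (simp add: x_def)
    obtain i where i: "i < ?n" "v = vs ! i" using f(1) V by (auto simp: in_set_conv_nth)
    have "x $ i \<noteq> 0" using i f(2) by (simp add: x_def)
    then have "x \<noteq> 0\<^sub>v ?n" using i by auto
    moreover have "?A *\<^sub>v x = k \<cdot>\<^sub>v x"
    proof (rule eq_vecI)
      fix j assume "j < dim_vec (k \<cdot>\<^sub>v x)"
      then have j: "j < ?n" by (simp add: x_def)
      have "(?A *\<^sub>v x) $ j = (\<Sum>w\<in>V. if (vs ! j, w) \<in> parcs G then f w else 0)"
        unfolding sum_eq mul[OF j x] by (rule sum.cong) (auto simp: x_def)
      also have "\<dots> = k * f (vs ! j)" using j V by (intro f(3)) auto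
      finally show "(?A *\<^sub>v x) $ j = (k \<cdot>\<^sub>v x) $ j" using j by (simp add: x_def)
    qed (simp add: x_def dim)
    ultimately show ?L using x by (auto simp: eigenvalue_def eigenvector_def dim)
  qed
qed

lemma graph_spectral_radius_eq:
  assumes "distinct vs" and "set vs = pverts G"
  shows "graph_spectral_radius G = Max (spectrum (adjacency_matrix vs G))"
proof -
  let ?us = "SOME vs. distinct vs \<and> set vs = pverts G"
  have us: "distinct ?us \<and> set ?us = pverts G"
    by (rule someI[of _ vs]) (use assms in simp)
  have "spectrum (adjacency_matrix ?us G) = spectrum (adjacency_matrix vs G)"
    unfolding spectrum_def
    using eigenvalue_adjacency_matrix[of ?us "pverts G" G] eigenvalue_adjacency_matrix[OF assms, of G] us
    by blast
  then show ?thesis by (simp add: graph_spectral_radius_def)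
qed

end

theory Submission
  imports Defs "HOL-Analysis.Function_Topology" "HOL-Library.Disjoint_Sets"
begin

text \<open>
  Write \<open>d\<close> for the minimum degree bound and \<open>m\<close> for the number of edges of \<open>G\<close>.  The spectral radius
  enters only through an edge count.  The graph \<open>C\<^bsub>n,d\<^esub>\<close> contains a clique on \<open>n - d - 1\<close> vertices
  with one further edge attached, so a Rayleigh quotient gives \<open>\<rho>(C\<^bsub>n,d\<^esub>) > n - d - 2\<close>
  (\<open>spectral_radius_bridged_cliques\<close>).  Conversely, weighting \<open>A\<^sup>2 - (d - 1) A\<close> with a nonnegative
  eigenvector shows \<open>\<rho>\<^sup>2 - (d - 1) \<rho> \<le> 2 m - d (n - 1)\<close> for a graph of minimum degree at least \<open>d\<close>
  (\<open>perron_edge_bound\<close>).  Together these say that \<open>G\<close> has at least as many edges as \<open>C\<^bsub>n,d\<^esub>\<close>.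

  If \<open>G\<close> has a cut edge, the degree condition puts at least \<open>d + 1\<close> vertices on either side of it, and
  the convexity of the binomial coefficient leaves \<open>C\<^bsub>n,d\<^esub>\<close> as the only graph with that many edges
  (\<open>dense_cut_edge_structure\<close>).

  If \<open>G\<close> has no cut edge, Catlin's reduction method produces a spanning closed trail
  (\<open>dense_supereulerian\<close>).  A vertex set is collapsible if, for each prescribed even set of odd vertices,
  it has a spanning connected subgraph realizing it.  In a partition of the vertices into as few
  collapsible sets as possible the blocks can be contracted, and a closed trail through all blocks of
  the quotient lifts to \<open>G\<close>.  The quotient is sparse: two edge-disjoint spanning trees on some of its
  blocks would make their union collapsible, since one tree connects and the other repairs parities.
  By a theorem of Nash-Williams and Tutte, proved here for the tight case only
  (\<open>tight_packs_two_trees\<close>), a quotient with \<open>k\<close> blocks therefore has at most \<open>2 k - 3\<close> edges; it is also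
  triangle-free.  Thus most edges of \<open>G\<close> lie inside the blocks, and as blocks of small quotient degree
  have at least \<open>d + 1\<close> vertices, \<open>m\<close> is too small unless there is a single block, or the quotient is a
  4-cycle, or \<open>d = 3\<close> and \<open>G\<close> is a triangle-free graph with 8 vertices and 13 edges.  In these cases a
  spanning closed trail is at hand; in the last it is a Hamiltonian cycle
  (\<open>eight_vertices_supereulerian\<close>).
\<close>

section \<open>Joins in connected multigraphs\<close>

text \<open>
  Edges are labels carrying a set of two ends, so that parallel edges are possible and that contracting
  or splitting vertices changes the function \<open>ends\<close> but not the edges themselves.
\<close>

definition multigraph :: "'b set \<Rightarrow> 'e set \<Rightarrow> ('e \<Rightarrow> 'b set) \<Rightarrow> bool" where
  "multigraph S E ends \<longleftrightarrow> finite S \<and> finite E \<and> (\<forall>e\<in>E. ends e \<subseteq> S \<and> card (ends e) = 2)"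

definition edge_degree :: "('e \<Rightarrow> 'b set) \<Rightarrow> 'e set \<Rightarrow> 'b \<Rightarrow> nat" where
  "edge_degree ends E v = card {e \<in> E. v \<in> ends e}"

definition edges_within :: "('e \<Rightarrow> 'b set) \<Rightarrow> 'e set \<Rightarrow> 'b set \<Rightarrow> 'e set" where
  "edges_within ends E X = {e \<in> E. ends e \<subseteq> X}"

definition edge_cut :: "('e \<Rightarrow> 'b set) \<Rightarrow> 'e set \<Rightarrow> 'b set \<Rightarrow> 'e set" where
  "edge_cut ends E X = {e \<in> E. ends e \<inter> X \<noteq> {} \<and> \<not> ends e \<subseteq> X}"

text \<open>
  Connectivity is expressed by cuts instead of walks: it then passes directly to unions of subgraphs
  and to and from contractions, the only operations needed.
\<close>

definition cut_connected :: "('e \<Rightarrow> 'b set) \<Rightarrow> 'e set \<Rightarrow> 'b set \<Rightarrow> bool" where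
  "cut_connected ends E S \<longleftrightarrow> (\<forall>X. X \<subset> S \<longrightarrow> X \<noteq> {} \<longrightarrow> edge_cut ends E X \<noteq> {})"

text \<open>
  Known as an \<open>R\<close>-join (or \<open>T\<close>-join): \<open>R\<close> is exactly the set of odd vertices of \<open>F\<close>.
\<close>

definition is_join :: "('e \<Rightarrow> 'b set) \<Rightarrow> 'e set \<Rightarrow> 'b set \<Rightarrow> 'b set \<Rightarrow> bool" where
  "is_join ends F S R \<longleftrightarrow> (\<forall>v\<in>S. odd (edge_degree ends F v) \<longleftrightarrow> v \<in> R)"

lemma multigraph_subset: "multigraph S E ends \<Longrightarrow> F \<subseteq> E \<Longrightarrow> multigraph S F ends"
  by (auto simp: multigraph_def dest: finite_subset)

lemma edge_cut_mono: "E \<subseteq> F \<Longrightarrow> edge_cut ends E X \<subseteq> edge_cut ends F X"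
  by (auto simp: edge_cut_def)

lemma cut_connected_mono: "cut_connected ends E S \<Longrightarrow> E \<subseteq> F \<Longrightarrow> cut_connected ends F S"
  unfolding cut_connected_def using edge_cut_mono by (metis subset_empty)

lemma sum_edge_degree:
  assumes "finite A" "finite F"
  shows "(\<Sum>v\<in>A. edge_degree ends F v) = (\<Sum>e\<in>F. card (ends e \<inter> A))"
  unfolding edge_degree_def
  by (rule sum_multicount_gen) (use assms in \<open>auto simp: Int_def conj_commute\<close>)

lemma handshake:
  assumes "multigraph S E ends"
  shows "(\<Sum>v\<in>S. edge_degree ends E v) = 2 * card E"
proof -
  have "(\<Sum>v\<in>S. edge_degree ends E v) = (\<Sum>e\<in>E. card (ends e \<inter> S))"
    using assms by (intro sum_edge_degree) (auto simp: multigraph_def)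
  also have "\<dots> = (\<Sum>e\<in>E. 2)"
    using assms by (intro sum.cong) (auto simp: multigraph_def Int_absorb2)
  finally show ?thesis by simp
qed

lemma odd_card_sym_diff:
  assumes "finite A" "finite B"
  shows "odd (card (sym_diff A B)) \<longleftrightarrow> (odd (card A) \<noteq> odd (card B))"
proof -
  have "card A = card (A - B) + card (A \<inter> B)" "card B = card (B - A) + card (A \<inter> B)"
    using assms by (metis card_Diff_subset_Int card_mono Int_lower1 Int_lower2 Int_commute finite_Int le_add_diff_inverse2)+
  moreover have "card (sym_diff A B) = card (A - B) + card (B - A)"
    using assms by (intro card_Un_disjoint) auto
  ultimately show ?thesis by auto
qed

lemma edge_degree_Un_disjoint:
  assumes "finite E" "finite F" "E \<inter> F = {}"
  shows "edge_degree ends (E \<union> F) v = edge_degree ends E v + edge_degree ends F v"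
proof -
  have "{e \<in> E \<union> F. v \<in> ends e} = {e \<in> E. v \<in> ends e} \<union> {e \<in> F. v \<in> ends e}" by auto
  then show ?thesis
    unfolding edge_degree_def using assms by (simp add: card_Un_disjoint disjoint_iff)
qed

text \<open>
  Modulo 2, degrees are additive under symmetric differences.
\<close>

lemma is_join_sym_diff:
  assumes "finite J" "finite K" "is_join ends J S P" "is_join ends K S Q"
  shows "is_join ends (sym_diff J K) S (sym_diff P Q)"
  unfolding is_join_def
proof
  fix v assume v: "v \<in> S"
  have "{e \<in> sym_diff J K. v \<in> ends e}
      = ({e \<in> J. v \<in> ends e} - {e \<in> K. v \<in> ends e}) \<union> ({e \<in> K. v \<in> ends e} - {e \<in> J. v \<in> ends e})"
    by auto
  then have "odd (edge_degree ends (sym_diff J K) v)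
      \<longleftrightarrow> (odd (edge_degree ends J v) \<noteq> odd (edge_degree ends K v))"
    unfolding edge_degree_def using assms(1,2)
    by (simp only:) (rule odd_card_sym_diff, auto)
  then show "odd (edge_degree ends (sym_diff J K) v) \<longleftrightarrow> v \<in> sym_diff P Q"
    using assms(3,4) v by (auto simp: is_join_def)
qed

text \<open>
  The edges of a path from \<open>u\<close> to \<open>v\<close> would do.  Without paths: the set of vertices \<open>w\<close> for which
  \<open>u\<close> and \<open>w\<close> can be joined cannot be left by an edge \<open>e\<close>, as toggling \<open>e\<close> moves the end of the join.
\<close>

lemma is_join_pair_exists:
  assumes mg: "multigraph S T ends" and conn: "cut_connected ends T S"
    and u: "u \<in> S" and v: "v \<in> S"
  shows "\<exists>J\<subseteq>T. is_join ends J S (sym_diff {u} {v})"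
proof -
  define X where "X = {w \<in> S. \<exists>J\<subseteq>T. is_join ends J S (sym_diff {u} {w})}"
  have fin: "finite T" using mg by (simp add: multigraph_def)
  have "is_join ends {} S {}" by (simp add: is_join_def edge_degree_def)
  then have uX: "u \<in> X" using u unfolding X_def by auto
  have "X = S"
  proof (rule ccontr)
    assume "X \<noteq> S"
    then have "X \<subset> S" unfolding X_def by auto
    then obtain e where e: "e \<in> T" "ends e \<inter> X \<noteq> {}" "\<not> ends e \<subseteq> X"
      using conn uX unfolding cut_connected_def edge_cut_def by blast
    then obtain a b where ab: "a \<in> ends e" "a \<in> X" "b \<in> ends e" "b \<notin> X" by auto
    have "card (ends e) = 2" "ends e \<subseteq> S" using mg e(1) by (auto simp: multigraph_def)
    then have ends: "ends e = {a, b}" and bS: "b \<in> S" and "a \<noteq> b"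
      using ab by (auto simp: card_2_iff)
    obtain J where J: "J \<subseteq> T" "is_join ends J S (sym_diff {u} {a})"
      using ab(2) unfolding X_def by auto
    have "edge_degree ends {e} v = (if v \<in> ends e then 1 else 0)" for v
    proof -
      have "{f \<in> {e}. v \<in> ends f} = (if v \<in> ends e then {e} else {})" by auto
      then show ?thesis by (simp add: edge_degree_def)
    qed
    then have "is_join ends {e} S {a, b}" by (auto simp: is_join_def ends)
    moreover have "finite J" "finite {e}" using J(1) fin finite_subset by auto
    ultimately have "is_join ends (sym_diff J {e}) S (sym_diff (sym_diff {u} {a}) {a, b})"
      using is_join_sym_diff J(2) by metis
    moreover have "sym_diff (sym_diff {u} {a}) {a, b} = sym_diff {u} {b}"
      using \<open>a \<noteq> b\<close> by auto
    moreover have "sym_diff J {e} \<subseteq> T" using J(1) e(1) by auto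
    ultimately have "\<exists>J\<subseteq>T. is_join ends J S (sym_diff {u} {b})" by metis
    then have "b \<in> X" unfolding X_def using bS by blast
    then show False using ab by simp
  qed
  then show ?thesis using v unfolding X_def by auto
qed

lemma is_join_exists:
  assumes mg: "multigraph S T ends" and conn: "cut_connected ends T S"
    and "R \<subseteq> S" "even (card R)"
  shows "\<exists>J\<subseteq>T. is_join ends J S R"
  using assms(3,4)
proof (induction "card R" arbitrary: R rule: less_induct)
  case less
  have fin: "finite T" "finite R"
    using mg less.prems by (auto simp: multigraph_def intro: finite_subset)
  show ?case
  proof (cases "R = {}")
    case True
    have "is_join ends {} S {}" by (simp add: is_join_def edge_degree_def)
    then show ?thesis using True by blast
  next
    case False
    then obtain u where u: "u \<in> R" by auto
    have "R \<noteq> {u}" using less.prems by auto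
    then obtain v where v: "v \<in> R" "v \<noteq> u" using u by auto
    have card: "card (R - {u, v}) = card R - 2" using u v fin by (simp add: card_Diff_subset)
    have "card {u, v} \<le> card R" using u v fin by (intro card_mono) auto
    then have ge: "card R \<ge> 2" using v by simp
    obtain J where J: "J \<subseteq> T" "is_join ends J S (R - {u, v})"
      using less.hyps[of "R - {u, v}"] less.prems card ge by auto
    obtain K where K: "K \<subseteq> T" "is_join ends K S (sym_diff {u} {v})"
      using is_join_pair_exists[OF mg conn] u v less.prems by blast
    have "finite J" "finite K" using J(1) K(1) fin finite_subset by auto
    then have "is_join ends (sym_diff J K) S (sym_diff (R - {u, v}) (sym_diff {u} {v}))"
      using is_join_sym_diff J(2) K(2) by metis
    moreover have "sym_diff (R - {u, v}) (sym_diff {u} {v}) = R" using u v by auto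
    moreover have "sym_diff J K \<subseteq> T" using J K by auto
    ultimately show ?thesis by metis
  qed
qed

text \<open>
  The first connected set keeps the subgraph connected; a join inside the second one repairs the
  parities of the first without touching it.
\<close>

lemma spanning_join_exists:
  assumes mg: "multigraph S E ends" and T: "T1 \<subseteq> E" "T2 \<subseteq> E" "T1 \<inter> T2 = {}"
    and conn: "cut_connected ends T1 S" "cut_connected ends T2 S"
    and R: "R \<subseteq> S" "even (card R)"
  shows "\<exists>F\<subseteq>E. cut_connected ends F S \<and> is_join ends F S R"
proof -
  have fin: "finite S" "finite T1" "finite T2"
    using mg T by (auto simp: multigraph_def intro: finite_subset)
  define O1 where "O1 = {v \<in> S. odd (edge_degree ends T1 v)}"
  have "even (\<Sum>v\<in>S. edge_degree ends T1 v)"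
    using handshake[OF multigraph_subset[OF mg T(1)]] by simp
  then have "even (card O1)" unfolding O1_def using fin(1) by (simp add: even_sum_iff)
  moreover have "finite O1" "finite R" using fin R(1) finite_subset by (auto simp: O1_def)
  ultimately have "even (card (sym_diff R O1))" using R(2) odd_card_sym_diff[of R O1] by simp
  moreover have "sym_diff R O1 \<subseteq> S" using R by (auto simp: O1_def)
  ultimately obtain J where J: "J \<subseteq> T2" "is_join ends J S (sym_diff R O1)"
    using is_join_exists[OF multigraph_subset[OF mg T(2)] conn(2)] by blast
  have "is_join ends (T1 \<union> J) S R"
    unfolding is_join_def
  proof
    fix v assume v: "v \<in> S"
    have "edge_degree ends (T1 \<union> J) v = edge_degree ends T1 v + edge_degree ends J v"
      using J(1) T fin finite_subset[of J T2] by (intro edge_degree_Un_disjoint) auto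
    then show "odd (edge_degree ends (T1 \<union> J) v) \<longleftrightarrow> v \<in> R"
      using J(2) v by (auto simp: is_join_def O1_def)
  qed
  moreover have "cut_connected ends (T1 \<union> J) S" using cut_connected_mono[OF conn(1)] by auto
  moreover have "T1 \<union> J \<subseteq> E" using T J by auto
  ultimately show ?thesis by (intro exI[of _ "T1 \<union> J"] conjI)
qed

section \<open>Two disjoint spanning trees in tight multigraphs\<close>

text \<open>
  The edge counts of a union of two edge-disjoint spanning trees.
\<close>

definition tight :: "('e \<Rightarrow> 'b set) \<Rightarrow> 'e set \<Rightarrow> 'b set \<Rightarrow> bool" where
  "tight ends E S \<longleftrightarrow> multigraph S E ends \<and> card E + 2 = 2 * card S \<and>
     (\<forall>X\<subseteq>S. X \<noteq> {} \<longrightarrow> card (edges_within ends E X) + 2 \<le> 2 * card X)"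

text \<open>
  Spanning trees are represented by connected spanning edge sets, which is the property that the parity
  argument for \<open>spanning_join_exists\<close> works with.
\<close>

definition packs_two_trees :: "('e \<Rightarrow> 'b set) \<Rightarrow> 'e set \<Rightarrow> 'b set \<Rightarrow> bool" where
  "packs_two_trees ends E S \<longleftrightarrow> (\<exists>T1 T2. T1 \<subseteq> E \<and> T2 \<subseteq> E \<and> T1 \<inter> T2 = {} \<and>
     cut_connected ends T1 S \<and> cut_connected ends T2 S)"

lemma edge_cutI: "e \<in> E \<Longrightarrow> a \<in> ends e \<Longrightarrow> a \<in> X \<Longrightarrow> b \<in> ends e \<Longrightarrow> b \<notin> X \<Longrightarrow> edge_cut ends E X \<noteq> {}"
  by (auto simp: edge_cut_def)

lemma edge_cutE:
  assumes "edge_cut ends E X \<noteq> {}"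
  obtains e a b where "e \<in> E" "a \<in> ends e" "a \<in> X" "b \<in> ends e" "b \<notin> X"
  using assms by (auto simp: edge_cut_def)

lemma cut_connectedD:
  assumes "cut_connected ends E S" "X \<subset> S" "X \<noteq> {}"
  obtains e a b where "e \<in> E" "a \<in> ends e" "a \<in> X" "b \<in> ends e" "b \<notin> X"
  using assms unfolding cut_connected_def by (metis edge_cutE)

text \<open>
  The form in which concrete small graphs are shown to be connected.
\<close>

lemma cut_connectedI:
  assumes "\<And>X. X \<subseteq> S \<Longrightarrow> X \<noteq> {} \<Longrightarrow>
    (\<And>e a b. e \<in> E \<Longrightarrow> a \<in> ends e \<Longrightarrow> b \<in> ends e \<Longrightarrow> a \<in> X \<Longrightarrow> b \<in> X) \<Longrightarrow> S \<subseteq> X"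
  shows "cut_connected ends E S"
  unfolding cut_connected_def
proof (intro allI impI notI)
  fix X assume X: "X \<subset> S" "X \<noteq> {}" and no_cut: "edge_cut ends E X = {}"
  have "S \<subseteq> X"
  proof (rule assms)
    show "b \<in> X" if "e \<in> E" "a \<in> ends e" "b \<in> ends e" "a \<in> X" for e a b
      using no_cut edge_cutI[of e E a ends X b] that by metis
  qed (use X in auto)
  then show False using X by auto
qed

text \<open>
  The inductive step at a vertex \<open>v\<close> of degree three replaces its edge \<open>f\<close> to \<open>x\<close> by an edge from \<open>x\<close> to
  \<open>y\<close>, keeping the label \<open>f\<close>.  When this is undone, \<open>f\<close> and \<open>e\<close> form a path from \<open>x\<close> through \<open>v\<close> to \<open>y\<close>
  that separates no vertices joined before; if \<open>f\<close> is not in \<open>T\<close>, the edge \<open>e\<close> still attaches \<open>v\<close>.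
\<close>

lemma cut_connected_unsplit:
  assumes conn: "cut_connected (ends(f := {x, y})) T S" and v: "v \<notin> S"
    and T: "\<And>g. g \<in> T - {f} \<Longrightarrow> ends g \<subseteq> S"
    and xy: "x \<in> S" "y \<in> S" and f: "ends f = {v, x}" and e: "ends e = {v, y}"
  shows "cut_connected ends (insert e T) (insert v S)"
  unfolding cut_connected_def
proof (intro allI impI)
  fix X assume X: "X \<subset> insert v S" "X \<noteq> {}"
  show "edge_cut ends (insert e T) X \<noteq> {}"
  proof (cases "X \<inter> S \<noteq> {} \<and> X \<inter> S \<noteq> S")
    case True
    then have "X \<inter> S \<subset> S" "X \<inter> S \<noteq> {}" by auto
    from cut_connectedD[OF conn this] obtain g a b where g: "g \<in> T" "a \<in> (ends(f := {x, y})) g" "a \<in> X \<inter> S"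
      "b \<in> (ends(f := {x, y})) g" "b \<notin> X \<inter> S" .
    show ?thesis
    proof (cases "g = f")
      case False
      then have "a \<in> ends g" "b \<in> ends g" "b \<in> S" using g T[of g] by auto
      then show ?thesis using g by (intro edge_cutI[of g _ a _ X b]) auto
    next
      case True
      then have ab: "(a = x \<and> b = y) \<or> (a = y \<and> b = x)" using g by auto
      have "b \<notin> X" "a \<in> X" using ab g xy by auto
      have "f \<in> insert e T" "e \<in> insert e T" using True g by auto
      then show ?thesis
        using ab \<open>b \<notin> X\<close> \<open>a \<in> X\<close> f e by (cases "v \<in> X") (auto simp: edge_cut_def)
    qed
  next
    case False
    then consider "X \<inter> S = {}" | "X \<inter> S = S" by auto
    then show ?thesis
    proof cases
      case 1
      then have "v \<in> X" "y \<notin> X" using X xy by auto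
      then show ?thesis using e by (intro edge_cutI[of e _ v _ X y]) auto
    next
      case 2
      then have "v \<notin> X" "y \<in> X" using X xy by auto
      then show ?thesis using e by (intro edge_cutI[of e _ y _ X v]) auto
    qed
  qed
qed

lemma cut_connected_insert_vertex:
  assumes conn: "cut_connected ends T S" and v: "v \<notin> S"
    and T: "\<And>g. g \<in> T \<Longrightarrow> ends g \<subseteq> S"
    and y: "y \<in> S" and e: "ends e = {v, y}"
  shows "cut_connected ends (insert e T) (insert v S)"
  unfolding cut_connected_def
proof (intro allI impI)
  fix X assume X: "X \<subset> insert v S" "X \<noteq> {}"
  show "edge_cut ends (insert e T) X \<noteq> {}"
  proof (cases "X \<inter> S \<noteq> {} \<and> X \<inter> S \<noteq> S")
    case True
    then have "X \<inter> S \<subset> S" "X \<inter> S \<noteq> {}" by auto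
    from cut_connectedD[OF conn this] obtain g a b where g: "g \<in> T" "a \<in> ends g" "a \<in> X \<inter> S"
      "b \<in> ends g" "b \<notin> X \<inter> S" .
    then show ?thesis using T[of g] by (intro edge_cutI[of g _ a _ X b]) auto
  next
    case False
    then consider "X \<inter> S = {}" | "X \<inter> S = S" by auto
    then show ?thesis
    proof cases
      case 1
      then have "v \<in> X" "y \<notin> X" using X y by auto
      then show ?thesis using e by (intro edge_cutI[of e _ v _ X y]) auto
    next
      case 2
      then have "v \<notin> X" "y \<in> X" using X y by auto
      then show ?thesis using e by (intro edge_cutI[of e _ y _ X v]) auto
    qed
  qed
qed

text \<open>
  Edge counts are supermodular: an edge within \<open>X\<close> or within \<open>Y\<close> lies within the union, and within the
  intersection if it lies within both.
\<close>

lemma tight_union: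
  assumes fin: "finite S" "finite E" and "X \<subseteq> S" "Y \<subseteq> S" and ne: "X \<inter> Y \<noteq> {}"
    and sparse: "\<And>X. X \<subseteq> S \<Longrightarrow> X \<noteq> {} \<Longrightarrow> card (edges_within ends E X) + 2 \<le> 2 * card X"
    and X: "2 * card X \<le> card (edges_within ends E X) + 2"
    and Y: "2 * card Y \<le> card (edges_within ends E Y) + 2"
  shows "2 * card (X \<union> Y) \<le> card (edges_within ends E (X \<union> Y)) + 2"
proof -
  let ?W = "edges_within ends E"
  have finW: "finite (?W Z)" for Z using fin by (simp add: edges_within_def)
  have "card (?W X) + card (?W Y) = card (?W X \<union> ?W Y) + card (?W X \<inter> ?W Y)"
    by (rule card_Un_Int) (use finW in auto)
  moreover have "card (?W X \<inter> ?W Y) = card (?W (X \<inter> Y))"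
    by (rule arg_cong[of _ _ card]) (auto simp: edges_within_def)
  moreover have "card (?W X \<union> ?W Y) \<le> card (?W (X \<union> Y))"
    using finW by (intro card_mono) (auto simp: edges_within_def)
  moreover have "card (?W (X \<inter> Y)) + 2 \<le> 2 * card (X \<inter> Y)" using assms(3) ne by (intro sparse) auto
  moreover have "card X + card Y = card (X \<union> Y) + card (X \<inter> Y)"
    using assms(3,4) fin by (intro card_Un_Int) (auto intro: finite_subset)
  ultimately show ?thesis using X Y by linarith
qed

text \<open>
  Induction on the number of vertices, as in Henneberg's construction of rigid graphs.  The average
  degree is below 4, and sparsity of the rest excludes degrees below 2, so some \<open>v\<close> has degree 2 or 3.
  In degree 2, delete \<open>v\<close> and hang it onto either tree by one edge.  In degree 3, delete \<open>v\<close> but join two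
  of its neighbours by a new edge.  This is possible because if one pair of neighbours lies in a tight
  set and another pair too, then the union of the two sets is tight, and adding \<open>v\<close> with its three edges
  to it contradicts sparsity.
\<close>

theorem tight_packs_two_trees:
  assumes "tight ends E S"
  shows "packs_two_trees ends E S"
  using assms
proof (induction "card S" arbitrary: S E ends rule: less_induct)
  case less
  let ?W = "edges_within ends E"
  have mg: "multigraph S E ends" and cardE: "card E + 2 = 2 * card S"
    and sparse: "\<And>X. X \<subseteq> S \<Longrightarrow> X \<noteq> {} \<Longrightarrow> card (?W X) + 2 \<le> 2 * card X"
    using less.prems by (auto simp: tight_def)
  have fin: "finite S" "finite E" and ends: "\<And>e. e \<in> E \<Longrightarrow> ends e \<subseteq> S \<and> card (ends e) = 2"
    using mg by (auto simp: multigraph_def)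
  show ?case
  proof (cases "card S = 1")
    case True
    then obtain s where "S = {s}" by (auto simp: card_1_singleton_iff)
    then have "cut_connected ends {} S" by (auto simp: cut_connected_def psubset_eq subset_singleton_iff)
    then show ?thesis unfolding packs_two_trees_def by blast
  next
    case False
    then have S2: "card S \<ge> 2" using cardE by linarith
    have "\<exists>v\<in>S. edge_degree ends E v \<le> 3"
    proof (rule ccontr)
      assume "\<not> ?thesis"
      then have "(\<Sum>v\<in>S. 4) \<le> (\<Sum>v\<in>S. edge_degree ends E v)" by (intro sum_mono) force
      then show False using handshake[OF mg] cardE by simp
    qed
    then obtain v where v: "v \<in> S" and deg3: "edge_degree ends E v \<le> 3" by auto
    define D where "D = {e \<in> E. v \<in> ends e}"
    define E0 where "E0 = E - D"
    have D: "D \<subseteq> E" and finD: "finite D" using fin by (auto simp: D_def)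
    have E0_eq: "E0 = ?W (S - {v})" unfolding E0_def D_def edges_within_def using ends by auto
    have cardD: "card E0 + card D = card E"
      unfolding E0_def using D fin finD by (simp add: card_Diff_subset card_mono)
    have cardS: "card (S - {v}) + 1 = card S" using v fin S2 by simp
    have Sv_ne: "S - {v} \<noteq> {}" using cardS S2 by (metis card.empty One_nat_def add_0 not_less_eq_eq numeral_2_eq_2 order_refl)
    have "card E0 + 2 \<le> 2 * card (S - {v})" unfolding E0_eq by (rule sparse) (use Sv_ne in auto)
    then have "card D = 2 \<or> card D = 3"
      using cardD cardE cardS deg3 unfolding edge_degree_def D_def[symmetric] by linarith
    have other: "\<exists>x. x \<in> S - {v} \<and> ends e = {v, x}" if "e \<in> D" for e
    proof -
      have "v \<in> ends e" "card (ends e) = 2" "ends e \<subseteq> S" using that ends[of e] by (auto simp: D_def)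
      then show ?thesis by (auto simp: card_2_iff insert_commute)
    qed
    have ends0: "ends g \<subseteq> S - {v}" if "g \<in> E0" for g using that unfolding E0_eq by (simp add: edges_within_def)
    have ins: "insert v (S - {v}) = S" using v by auto
    have less_card: "card (S - {v}) < card S" using cardS by simp
    from \<open>card D = 2 \<or> card D = 3\<close> show ?thesis
    proof
      assume "card D = 2"
      then obtain e1 e2 where e12: "D = {e1, e2}" "e1 \<noteq> e2" by (auto simp: card_2_iff)
      have "tight ends E0 (S - {v})"
        unfolding tight_def
      proof (intro conjI allI impI)
        show "multigraph (S - {v}) E0 ends"
          using fin ends ends0 by (auto simp: multigraph_def E0_def)
        show "card E0 + 2 = 2 * card (S - {v})" using cardD cardE cardS \<open>card D = 2\<close> by linarith
        fix X assume X: "X \<subseteq> S - {v}" "X \<noteq> {}"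
        have "card (edges_within ends E0 X) \<le> card (?W X)"
          using fin by (intro card_mono) (auto simp: edges_within_def E0_def)
        then show "card (edges_within ends E0 X) + 2 \<le> 2 * card X" using sparse[of X] X by force
      qed
      from less.hyps[OF less_card this] obtain T1 T2
        where T: "T1 \<subseteq> E0" "T2 \<subseteq> E0" "T1 \<inter> T2 = {}"
          "cut_connected ends T1 (S - {v})" "cut_connected ends T2 (S - {v})"
        unfolding packs_two_trees_def by auto
      obtain x1 where x1: "x1 \<in> S - {v}" "ends e1 = {v, x1}" using other[of e1] e12 by auto
      obtain x2 where x2: "x2 \<in> S - {v}" "ends e2 = {v, x2}" using other[of e2] e12 by auto
      have "cut_connected ends (insert e1 T1) S"
        using cut_connected_insert_vertex[OF T(4) _ _ x1, unfolded ins] T(1) ends0 by auto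
      moreover have "cut_connected ends (insert e2 T2) S"
        using cut_connected_insert_vertex[OF T(5) _ _ x2, unfolded ins] T(2) ends0 by auto
      moreover have "insert e1 T1 \<subseteq> E" "insert e2 T2 \<subseteq> E" "insert e1 T1 \<inter> insert e2 T2 = {}"
        using T e12 D by (auto simp: E0_def)
      ultimately show ?thesis unfolding packs_two_trees_def by meson
    next
      assume D3: "card D = 3"
      have split: ?thesis
        if feg: "D = {f, e, g}" "f \<noteq> e" "f \<noteq> g" "e \<noteq> g"
          and x: "x \<in> S - {v}" "ends f = {v, x}" and y: "y \<in> S - {v}" "ends e = {v, y}"
          and unblocked: "\<And>X. X \<subseteq> S - {v} \<Longrightarrow> x \<in> X \<Longrightarrow> y \<in> X \<Longrightarrow> card (?W X) + 3 \<le> 2 * card X"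
        for f e g x y
      proof -
        \<comment> \<open>The new edge reuses the label \<open>f\<close>; the label \<open>g\<close> is kept for attaching \<open>v\<close> to the other tree.\<close>
        let ?ends = "ends(f := {x, y})"
        have xy: "x \<noteq> y" using unblocked[of "{x}"] x by auto
        have fD: "f \<in> D" "e \<in> D" "g \<in> D" using feg by auto
        then have f0: "f \<notin> E0" "e \<notin> E0" "g \<notin> E0" by (auto simp: E0_def)
        have "tight ?ends (insert f E0) (S - {v})"
          unfolding tight_def
        proof (intro conjI allI impI)
          show "multigraph (S - {v}) (insert f E0) ?ends"
            using fin ends ends0 x y xy f0 by (auto simp: multigraph_def E0_def)
          have "card (insert f E0) = card E0 + 1" using f0 fin by (simp add: E0_def)
          then show "card (insert f E0) + 2 = 2 * card (S - {v})" using cardD cardE cardS D3 by linarith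
          fix X assume X: "X \<subseteq> S - {v}" "X \<noteq> {}"
          have finW: "finite (?W X)" using fin by (simp add: edges_within_def)
          show "card (edges_within ?ends (insert f E0) X) + 2 \<le> 2 * card X"
          proof (cases "x \<in> X \<and> y \<in> X")
            case True
            have "card (edges_within ?ends (insert f E0) X) \<le> card (insert f (?W X))"
              using finW by (intro card_mono) (auto simp: edges_within_def E0_def)
            also have "\<dots> \<le> card (?W X) + 1" using finW by (simp add: card_insert_if)
            finally show ?thesis using unblocked[of X] X True by force
          next
            case False
            then have "card (edges_within ?ends (insert f E0) X) \<le> card (?W X)"
              using finW by (intro card_mono) (auto simp: edges_within_def E0_def split: if_splits)
            then show ?thesis using sparse[of X] X by force
          qed
        qed
        from less.hyps[OF less_card this] obtain U1 U2
          where U: "U1 \<subseteq> insert f E0" "U2 \<subseteq> insert f E0" "U1 \<inter> U2 = {}"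
            "cut_connected ?ends U1 (S - {v})" "cut_connected ?ends U2 (S - {v})"
          unfolding packs_two_trees_def by auto
        \<comment> \<open>The new edge lies in at most one of the trees, which is called \<open>T1\<close>.\<close>
        obtain T1 T2 where T: "T1 \<subseteq> insert f E0" "T2 \<subseteq> E0" "T1 \<inter> T2 = {}"
            "cut_connected ?ends T1 (S - {v})" "cut_connected ?ends T2 (S - {v})"
        proof (cases "f \<in> U2")
          case True
          then have "U1 \<subseteq> E0" using U by auto
          then show ?thesis using that[of U2 U1] U by auto
        next
          case False
          then have "U2 \<subseteq> E0" using U by auto
          then show ?thesis using that[of U1 U2] U by auto
        qed
        have T2: "cut_connected ends T2 (S - {v})"
        proof -
          have "f \<notin> T2" using T(2) f0 by auto
          then have "edge_cut ?ends T2 X = edge_cut ends T2 X" for X by (auto simp: edge_cut_def)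
          then show ?thesis using T(5) by (simp add: cut_connected_def)
        qed
        obtain z where z: "z \<in> S - {v}" "ends g = {v, z}" using other[of g] fD by auto
        have "cut_connected ends (insert e T1) S"
          using cut_connected_unsplit[OF T(4) _ _ x(1) y(1) x(2) y(2), unfolded ins] T(1) ends0 by auto
        moreover have "cut_connected ends (insert g T2) S"
          using cut_connected_insert_vertex[OF T2 _ _ z, unfolded ins] T(2) ends0 by auto
        moreover have "insert e T1 \<subseteq> E" "insert g T2 \<subseteq> E" "insert e T1 \<inter> insert g T2 = {}"
          using T feg fD f0 D by (auto simp: E0_def)
        ultimately show ?thesis unfolding packs_two_trees_def by meson
      qed
      obtain e1 e2 e3 where e: "D = {e1, e2, e3}" "e1 \<noteq> e2" "e1 \<noteq> e3" "e2 \<noteq> e3"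
        using D3 by (auto simp: card_3_iff)
      obtain x1 where x1: "x1 \<in> S - {v}" "ends e1 = {v, x1}" using other[of e1] e by auto
      obtain x2 where x2: "x2 \<in> S - {v}" "ends e2 = {v, x2}" using other[of e2] e by auto
      obtain x3 where x3: "x3 \<in> S - {v}" "ends e3 = {v, x3}" using other[of e3] e by auto
      show ?thesis
      proof (rule ccontr)
        assume no: "\<not> ?thesis"
        have D': "D = {e2, e3, e1}" using e(1) by auto
        \<comment> \<open>Equal neighbours need no separate treatment, a singleton being tight.\<close>
        have "\<exists>X\<subseteq>S - {v}. x1 \<in> X \<and> x2 \<in> X \<and> \<not> card (?W X) + 3 \<le> 2 * card X"
        proof (rule ccontr)
          assume "\<not> ?thesis"
          then have "card (?W X) + 3 \<le> 2 * card X" if "X \<subseteq> S - {v}" "x1 \<in> X" "x2 \<in> X" for X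
            using that by blast
          from split[OF e(1) e(2) e(3) e(4) x1 x2 this] no show False by simp
        qed
        then obtain X where X: "X \<subseteq> S - {v}" "x1 \<in> X" "x2 \<in> X"
          and "\<not> card (?W X) + 3 \<le> 2 * card X" by blast
        then have X_tight: "2 * card X \<le> card (?W X) + 2" by linarith
        have "\<exists>Y\<subseteq>S - {v}. x2 \<in> Y \<and> x3 \<in> Y \<and> \<not> card (?W Y) + 3 \<le> 2 * card Y"
        proof (rule ccontr)
          assume "\<not> ?thesis"
          then have "card (?W Y) + 3 \<le> 2 * card Y" if "Y \<subseteq> S - {v}" "x2 \<in> Y" "x3 \<in> Y" for Y
            using that by blast
          from split[OF D' e(4) e(2)[symmetric] e(3)[symmetric] x2 x3 this] no show False by simp
        qed
        then obtain Y where Y: "Y \<subseteq> S - {v}" "x2 \<in> Y" "x3 \<in> Y"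
          and "\<not> card (?W Y) + 3 \<le> 2 * card Y" by blast
        then have Y_tight: "2 * card Y \<le> card (?W Y) + 2" by linarith
        have XY: "2 * card (X \<union> Y) \<le> card (?W (X \<union> Y)) + 2"
          by (rule tight_union[OF fin _ _ _ sparse X_tight Y_tight]) (use X Y in blast)+
        have "D \<inter> ?W (X \<union> Y) = {}" using X(1) Y(1) by (auto simp: D_def edges_within_def)
        moreover have finW: "finite (?W Z)" for Z using fin by (simp add: edges_within_def)
        ultimately have "card (D \<union> ?W (X \<union> Y)) = card D + card (?W (X \<union> Y))"
          using finD by (intro card_Un_disjoint) auto
        moreover have "card (D \<union> ?W (X \<union> Y)) \<le> card (?W (insert v (X \<union> Y)))"
        proof (intro card_mono finW)
          have "ends d \<subseteq> insert v (X \<union> Y)" if "d \<in> D" for d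
            using that e x1 x2 x3 X Y by auto
          then show "D \<union> ?W (X \<union> Y) \<subseteq> ?W (insert v (X \<union> Y))" using D by (auto simp: edges_within_def)
        qed
        moreover have "card (?W (insert v (X \<union> Y))) + 2 \<le> 2 * card (insert v (X \<union> Y))"
          using X Y v by (intro sparse) auto
        moreover have "card (insert v (X \<union> Y)) = card (X \<union> Y) + 1"
        proof -
          have "finite (X \<union> Y)" using X(1) Y(1) fin by (meson finite_Diff finite_Un finite_subset)
          moreover have "v \<notin> X \<union> Y" using X(1) Y(1) by auto
          ultimately show ?thesis by simp
        qed
        ultimately show False using XY D3 by linarith
      qed
    qed
  qed
qed

text \<open>
  In an inclusion-minimal dense set of at least two vertices, all smaller sets are sparse; discarding
  surplus edges makes it tight.
\<close>

lemma dense_packs_two_trees: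
  assumes mg: "multigraph S E ends" and "card S \<ge> 2" and "2 * card S \<le> card E + 2"
  shows "\<exists>X\<subseteq>S. card X \<ge> 2 \<and> packs_two_trees ends (edges_within ends E X) X"
proof -
  let ?W = "edges_within ends E"
  define P where "P X \<longleftrightarrow> X \<subseteq> S \<and> card X \<ge> 2 \<and> 2 * card X \<le> card (?W X) + 2" for X
  have fin: "finite S" "finite E" using mg by (auto simp: multigraph_def)
  have "?W S = E" using mg by (auto simp: edges_within_def multigraph_def)
  then have "P S" using assms by (simp add: P_def)
  then obtain X where X: "P X" and least: "\<And>Y. P Y \<Longrightarrow> card X \<le> card Y"
    using ex_has_least_nat[of P S card] by auto
  have "2 * card X - 2 \<le> card (?W X)" using X by (auto simp: P_def)
  then obtain E0 where E0: "E0 \<subseteq> ?W X" "card E0 = 2 * card X - 2" by (meson obtain_subset_with_card_n)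
  have finX: "finite X" using X fin by (auto simp: P_def intro: finite_subset)
  have finW: "finite (?W Z)" for Z using fin by (simp add: edges_within_def)
  have E0': "e \<in> E0 \<Longrightarrow> e \<in> E \<and> ends e \<subseteq> X \<and> card (ends e) = 2" for e
    using E0(1) mg by (auto simp: edges_within_def multigraph_def)
  have "tight ends E0 X"
    unfolding tight_def
  proof (intro conjI allI impI)
    show "multigraph X E0 ends"
      using E0' finX finW E0(1) by (auto simp: multigraph_def intro: finite_subset)
    show "card E0 + 2 = 2 * card X" using E0 X by (auto simp: P_def)
    fix Y assume Y: "Y \<subseteq> X" "Y \<noteq> {}"
    have finY: "finite Y" using Y finX finite_subset by auto
    have le: "card (edges_within ends E0 Y) \<le> card (?W Y)"
      using E0' by (intro card_mono finW) (auto simp: edges_within_def)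
    have le0: "card (edges_within ends E0 Y) \<le> card E0"
      using E0(1) finW[of X] by (intro card_mono) (auto simp: edges_within_def intro: finite_subset)
    have "card Y > 0" using Y finY by (simp add: card_gt_0_iff)
    moreover have "card Y < card X" if "Y \<noteq> X" using that Y finX by (simp add: psubset_card_mono psubset_eq)
    ultimately consider "card Y = 1" | "Y = X" | "card Y \<ge> 2" "card Y < card X" by linarith
    then show "card (edges_within ends E0 Y) + 2 \<le> 2 * card Y"
    proof cases
      case 1
      have "edges_within ends E0 Y = {}"
      proof -
        have "\<not> ends e \<subseteq> Y" if "e \<in> E0" for e
          using card_mono[OF finY, of "ends e"] E0'[OF that] 1 by auto
        then show ?thesis by (auto simp: edges_within_def)
      qed
      then show ?thesis using 1 by simp
    next
      case 2
      then show ?thesis using le0 E0(2) X by (auto simp: P_def)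
    next
      case 3
      then have "\<not> P Y" using least[of Y] by auto
      then show ?thesis using 3 Y X le by (auto simp: P_def)
    qed
  qed
  then have "packs_two_trees ends E0 X" by (rule tight_packs_two_trees)
  then obtain T1 T2 where T: "T1 \<subseteq> E0" "T2 \<subseteq> E0" "T1 \<inter> T2 = {}"
      "cut_connected ends T1 X" "cut_connected ends T2 X"
    unfolding packs_two_trees_def by auto
  have "T1 \<subseteq> ?W X" "T2 \<subseteq> ?W X" using T(1,2) E0(1) by simp_all
  then have "packs_two_trees ends (?W X) X"
    unfolding packs_two_trees_def using T(3-5) by (intro exI[of _ T1] exI[of _ T2] conjI)
  then show ?thesis using X unfolding P_def by (intro exI[of _ X] conjI) simp_all
qed

section \<open>Collapsible vertex sets\<close>

text \<open>
  A simple graph is the multigraph whose edges are two-element sets of vertices and are their own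
  sets of ends.
\<close>

abbreviation (input) own_ends :: "'a set \<Rightarrow> 'a set" where "own_ends \<equiv> (\<lambda>e. e)"

text \<open>
  Catlin's notion, here for the subgraph induced by \<open>X\<close>.
\<close>

definition collapsible :: "'a set set \<Rightarrow> 'a set \<Rightarrow> bool" where
  "collapsible E X \<longleftrightarrow> (\<forall>R\<subseteq>X. even (card R) \<longrightarrow>
     (\<exists>F\<subseteq>edges_within own_ends E X. cut_connected own_ends F X \<and> is_join own_ends F X R))"

text \<open>
  The ends of \<open>e\<close> after contraction of all blocks of the partition \<open>P\<close>.
\<close>

definition blocks_of :: "'a set set \<Rightarrow> 'a set \<Rightarrow> 'a set set" where
  "blocks_of P e = {A \<in> P. A \<inter> e \<noteq> {}}"

definition crossing :: "'a set set \<Rightarrow> 'a set set \<Rightarrow> 'a set set" where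
  "crossing P E = {e \<in> E. card (blocks_of P e) = 2}"

lemma collapsible_singleton: "collapsible E {v}"
  unfolding collapsible_def
proof (intro allI impI)
  fix R assume "R \<subseteq> {v}" "even (card R)"
  then have "R = {}" by (auto simp: subset_singleton_iff)
  then have "is_join own_ends {} {v} R" by (simp add: is_join_def edge_degree_def)
  moreover have "cut_connected own_ends {} {v}"
    by (auto simp: cut_connected_def psubset_eq subset_singleton_iff)
  ultimately show "\<exists>F\<subseteq>edges_within own_ends E {v}. cut_connected own_ends F {v} \<and> is_join own_ends F {v} R"
    by (intro exI[of _ "{}"]) simp
qed

locale graph_partition =
  fixes V :: "'a set" and E :: "'a set set" and P :: "'a set set"
  assumes simple: "multigraph V E own_ends" and part: "partition_on V P"
begin

lemma finite_V: "finite V" and finite_E: "finite E"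
  and edge: "e \<in> E \<Longrightarrow> e \<subseteq> V \<and> card e = 2"
  using simple by (auto simp: multigraph_def)

lemma finite_P: "finite P" using finite_elements[OF finite_V part] .

lemma block_subset: "A \<in> P \<Longrightarrow> A \<subseteq> V" and block_nonempty: "A \<in> P \<Longrightarrow> A \<noteq> {}"
  using part by (auto simp: partition_on_def)

lemma block_unique: "A \<in> P \<Longrightarrow> B \<in> P \<Longrightarrow> v \<in> A \<Longrightarrow> v \<in> B \<Longrightarrow> A = B"
  using part by (auto simp: partition_on_def disjoint_def)

lemma finite_block: "A \<in> P \<Longrightarrow> finite A"
  using block_subset finite_V finite_subset by blast

lemma block_exists: "v \<in> V \<Longrightarrow> \<exists>A\<in>P. v \<in> A"
  using part by (auto simp: partition_on_def)

lemma multigraph_crossing: "multigraph P (crossing P E) (blocks_of P)"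
  using finite_P finite_E by (auto simp: multigraph_def crossing_def blocks_of_def)

lemma crossing_edge:
  assumes "e \<in> crossing P E"
  obtains a b A B where "e = {a, b}" "a \<noteq> b" "a \<in> A" "b \<in> B" "A \<in> P" "B \<in> P" "A \<noteq> B"
    "blocks_of P e = {A, B}"
proof -
  have e: "e \<in> E" "card (blocks_of P e) = 2" using assms by (auto simp: crossing_def)
  then obtain a b where ab: "e = {a, b}" "a \<noteq> b" using edge[of e] by (auto simp: card_2_iff)
  have "a \<in> V" "b \<in> V" using ab e edge by auto
  obtain A where A: "A \<in> P" "a \<in> A" using block_exists[OF \<open>a \<in> V\<close>] by auto
  obtain B where B: "B \<in> P" "b \<in> B" using block_exists[OF \<open>b \<in> V\<close>] by auto
  note AB = A B
  have "blocks_of P e = {A, B}"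
  proof -
    have "C = A \<or> C = B" if "C \<in> P" "C \<inter> e \<noteq> {}" for C
    proof -
      have "a \<in> C \<or> b \<in> C" using that(2) ab(1) by auto
      then show ?thesis using block_unique[of C A a] block_unique[of C B b] that(1) AB by metis
    qed
    moreover have "A \<inter> e \<noteq> {}" "B \<inter> e \<noteq> {}" using AB ab(1) by auto
    ultimately show ?thesis unfolding blocks_of_def using AB(1,3) by blast
  qed
  moreover from this have "A \<noteq> B" using e(2) by (cases "A = B") simp_all
  ultimately show ?thesis using that[OF ab AB(2,4,1,3)] by simp
qed

lemma not_crossing_edge:
  assumes "e \<in> E" "e \<notin> crossing P E"
  obtains A where "A \<in> P" "e \<subseteq> A"
proof -
  obtain a b where ab: "e = {a, b}" "a \<noteq> b" using edge[of e] assms by (auto simp: card_2_iff)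
  have "a \<in> V" "b \<in> V" using ab assms edge by auto
  obtain A where A: "A \<in> P" "a \<in> A" using block_exists[OF \<open>a \<in> V\<close>] by auto
  obtain B where B: "B \<in> P" "b \<in> B" using block_exists[OF \<open>b \<in> V\<close>] by auto
  note AB = A B
  have "blocks_of P e = {A, B}"
  proof -
    have "C = A \<or> C = B" if "C \<in> P" "C \<inter> e \<noteq> {}" for C
    proof -
      have "a \<in> C \<or> b \<in> C" using that(2) ab(1) by auto
      then show ?thesis using block_unique[of C A a] block_unique[of C B b] that(1) AB by metis
    qed
    moreover have "A \<inter> e \<noteq> {}" "B \<inter> e \<noteq> {}" using AB ab(1) by auto
    ultimately show ?thesis unfolding blocks_of_def using AB(1,3) by blast
  qed
  then have "card (blocks_of P e) = 2" if "A \<noteq> B" using that by simp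
  then have "A = B" using assms by (simp add: crossing_def) metis
  then have "e \<subseteq> A" using AB ab by simp
  then show ?thesis using that[OF A(1)] by simp
qed

lemma card_crossing_Int:
  assumes "e \<in> crossing P E" "A \<in> P"
  shows "card (e \<inter> A) = (if A \<in> blocks_of P e then 1 else 0)"
proof -
  obtain a b B C where e: "e = {a, b}" "a \<noteq> b" "a \<in> B" "b \<in> C" "B \<in> P" "C \<in> P" "B \<noteq> C"
    "blocks_of P e = {B, C}" using crossing_edge[OF assms(1)] .
  consider "A = B" | "A = C" | "A \<noteq> B" "A \<noteq> C" by blast
  then show ?thesis
  proof cases
    case 1
    have "b \<notin> A" using block_unique[OF e(5,6) _ e(4)] e(7) 1 by blast
    then have "e \<inter> A = {a}" using e(1,3) 1 by blast
    then show ?thesis using 1 e(8) by simp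
  next
    case 2
    have "a \<notin> A" using block_unique[OF e(5,6,3)] e(7) 2 by blast
    then have "e \<inter> A = {b}" using e(1,4) 2 by blast
    then show ?thesis using 2 e(8) by simp
  next
    case 3
    have "a \<notin> A" using block_unique[OF assms(2) e(5) _ e(3)] 3 by blast
    moreover have "b \<notin> A" using block_unique[OF assms(2) e(6) _ e(4)] 3 by blast
    ultimately have "e \<inter> A = {}" using e(1) by blast
    then show ?thesis using 3 e(8) by simp
  qed
qed

lemma sum_degree_block:
  assumes "F \<subseteq> crossing P E" "A \<in> P"
  shows "(\<Sum>v\<in>A. edge_degree own_ends F v) = edge_degree (blocks_of P) F A"
proof -
  have finF: "finite F" using assms(1) finite_E by (auto simp: crossing_def intro: finite_subset)
  have "(\<Sum>v\<in>A. edge_degree own_ends F v) = (\<Sum>e\<in>F. card (e \<inter> A))"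
    using sum_edge_degree[OF finite_block[OF assms(2)] finF] .
  also have "\<dots> = (\<Sum>e\<in>F. if A \<in> blocks_of P e then 1 else 0)"
    using assms by (intro sum.cong) (auto simp: card_crossing_Int)
  also have "\<dots> = edge_degree (blocks_of P) F A"
    using finF by (simp add: edge_degree_def sum.If_cases Int_def)
  finally show ?thesis .
qed

text \<open>
  A spanning connected subgraph of the quotient leaves some vertices of a block \<open>A\<close> with the wrong
  parity.  Their number is even, because the sum of the degrees over \<open>A\<close> is the degree of \<open>A\<close> in the
  quotient, whose parity was prescribed to be that of \<open>A \<inter> R\<close>.  Hence collapsibility of \<open>A\<close> provides a
  correction, and it also connects \<open>A\<close>.
\<close>

lemma lift_spanning_join:
  assumes S: "S \<subseteq> P" and coll: "\<And>A. A \<in> S \<Longrightarrow> collapsible E A"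
    and F: "F \<subseteq> edges_within (blocks_of P) (crossing P E) S"
    and conn: "cut_connected (blocks_of P) F S"
    and join: "is_join (blocks_of P) F S {A \<in> S. odd (card (A \<inter> R))}"
    and R: "R \<subseteq> \<Union>S"
  shows "\<exists>F'\<subseteq>edges_within own_ends E (\<Union>S).
           cut_connected own_ends F' (\<Union>S) \<and> is_join own_ends F' (\<Union>S) R"
proof -
  have Fc: "F \<subseteq> crossing P E" using F by (auto simp: edges_within_def)
  have finF: "finite F" using Fc finite_E by (auto simp: crossing_def intro: finite_subset)
  define RA where "RA A = sym_diff (A \<inter> R) {v \<in> A. odd (edge_degree own_ends F v)}" for A
  have "\<exists>FA\<subseteq>edges_within own_ends E A. cut_connected own_ends FA A \<and> is_join own_ends FA A (RA A)"
    if A: "A \<in> S" for A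
  proof -
    have AP: "A \<in> P" using A S by auto
    have fin: "finite A" using finite_block[OF AP] .
    have "odd (card {v \<in> A. odd (edge_degree own_ends F v)})
        \<longleftrightarrow> odd (\<Sum>v\<in>A. edge_degree own_ends F v)"
      using even_sum_iff[OF fin, of "edge_degree own_ends F"] by simp
    also have "\<dots> \<longleftrightarrow> odd (card (A \<inter> R))"
      unfolding sum_degree_block[OF Fc AP] using join A by (simp add: is_join_def)
    finally have "even (card (RA A))"
      unfolding RA_def using fin by (subst odd_card_sym_diff[THEN arg_cong[of _ _ Not], simplified]) auto
    moreover have "RA A \<subseteq> A" by (auto simp: RA_def)
    ultimately show ?thesis using coll[OF A] unfolding collapsible_def by simp
  qed
  then obtain FA where FA: "\<And>A. A \<in> S \<Longrightarrow> FA A \<subseteq> edges_within own_ends E A"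
    "\<And>A. A \<in> S \<Longrightarrow> cut_connected own_ends (FA A) A"
    "\<And>A. A \<in> S \<Longrightarrow> is_join own_ends (FA A) A (RA A)" by metis
  have FA_sub: "e \<subseteq> A \<and> e \<in> E" if "A \<in> S" "e \<in> FA A" for e A
    using FA(1) that by (auto simp: edges_within_def)
  define F' where "F' = F \<union> \<Union>(FA ` S)"
  have F_sub: "e \<subseteq> \<Union>S" if e: "e \<in> F" for e
  proof -
    obtain a b A B where *: "e = {a, b}" "a \<noteq> b" "a \<in> A" "b \<in> B" "A \<in> P" "B \<in> P" "A \<noteq> B"
      "blocks_of P e = {A, B}" using crossing_edge[OF subsetD[OF Fc e]] .
    have "blocks_of P e \<subseteq> S" using F e by (auto simp: edges_within_def)
    then have "A \<in> S" "B \<in> S" unfolding *(8) by auto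
    then show ?thesis using *(1,3,4) by blast
  qed
  have "F' \<subseteq> edges_within own_ends E (\<Union>S)"
  proof
    fix e assume "e \<in> F'"
    then consider "e \<in> F" | A where "A \<in> S" "e \<in> FA A" unfolding F'_def by blast
    then show "e \<in> edges_within own_ends E (\<Union>S)"
    proof cases
      case 1
      then have "e \<in> E" using Fc by (auto simp: crossing_def)
      then show ?thesis using F_sub[OF 1] by (simp add: edges_within_def)
    next
      case 2
      then show ?thesis using FA_sub[OF 2] by (auto simp: edges_within_def)
    qed
  qed
  moreover have "is_join own_ends F' (\<Union>S) R"
    unfolding is_join_def
  proof
    fix v assume "v \<in> \<Union>S"
    then obtain A where A: "A \<in> S" "v \<in> A" by auto
    have AP: "A \<in> P" using A S by auto
    have "{e \<in> F'. v \<in> e} = {e \<in> F. v \<in> e} \<union> {e \<in> FA A. v \<in> e}"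
    proof -
      have "B = A" if "B \<in> S" "e \<in> FA B" "v \<in> e" for B e
      proof -
        have "v \<in> B" using FA_sub[OF that(1,2)] that(3) by blast
        then show ?thesis using block_unique[OF subsetD[OF S that(1)] AP _ A(2)] by blast
      qed
      then show ?thesis using A(1) unfolding F'_def by blast
    qed
    moreover have "F \<inter> FA A = {}"
    proof -
      have "\<not> e \<subseteq> A" if "e \<in> F" for e
      proof -
        have "card (e \<inter> A) \<le> 1" using card_crossing_Int[of e A] that Fc AP by auto
        moreover have "card e = 2" using that Fc edge by (auto simp: crossing_def)
        ultimately show ?thesis by (auto simp: Int_absorb2)
      qed
      then show ?thesis using FA_sub[OF A(1)] by auto
    qed
    moreover have "finite (FA A)" using FA_sub[OF A(1)] finite_E by (meson finite_subset subsetI)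
    ultimately have "edge_degree own_ends F' v = edge_degree own_ends F v + edge_degree own_ends (FA A) v"
      unfolding edge_degree_def using finF by (simp add: card_Un_disjoint disjoint_iff)
    moreover have "odd (edge_degree own_ends (FA A) v) \<longleftrightarrow> v \<in> RA A"
      using FA(3)[OF A(1)] A(2) by (simp add: is_join_def)
    ultimately show "odd (edge_degree own_ends F' v) \<longleftrightarrow> v \<in> R"
      using A(2) by (auto simp: RA_def)
  qed
  moreover have "cut_connected own_ends F' (\<Union>S)"
    unfolding cut_connected_def
  proof (intro allI impI)
    fix X assume X: "X \<subset> \<Union>S" "X \<noteq> {}"
    show "edge_cut own_ends F' X \<noteq> {}"
    proof (cases "\<exists>A\<in>S. A \<inter> X \<noteq> {} \<and> A \<inter> X \<noteq> A")
      case True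
      then obtain A where A: "A \<in> S" "A \<inter> X \<subset> A" "A \<inter> X \<noteq> {}" by auto
      obtain e a b where e: "e \<in> FA A" "a \<in> e" "a \<in> A \<inter> X" "b \<in> e" "b \<notin> A \<inter> X"
        using cut_connectedD[OF FA(2)[OF A(1)] A(2,3)] .
      then have "b \<notin> X" using FA_sub[OF A(1) e(1)] by auto
      moreover have "e \<in> F'" using e A by (auto simp: F'_def)
      ultimately show ?thesis using e by (intro edge_cutI[of e _ a _ X b]) auto
    next
      case False
      then have whole: "A \<subseteq> X" if "A \<in> S" "A \<inter> X \<noteq> {}" for A using that by auto
      let ?X = "{A \<in> S. A \<inter> X \<noteq> {}}"
      have X_ne: "?X \<noteq> {}" using X by auto
      have "?X \<noteq> S"
      proof
        assume "?X = S"
        then have "\<Union>S \<subseteq> X" using whole by auto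
        then show False using X by auto
      qed
      then have "?X \<subset> S" by auto
      then obtain e A B where e: "e \<in> F" "A \<in> blocks_of P e" "A \<in> ?X" "B \<in> blocks_of P e" "B \<notin> ?X"
        by (rule cut_connectedD[OF conn _ X_ne])
      obtain a where a: "a \<in> A" "a \<in> e" using e(2) by (auto simp: blocks_of_def)
      obtain b where b: "b \<in> B" "b \<in> e" using e(4) by (auto simp: blocks_of_def)
      have "B \<in> S" using e(1,4) F by (auto simp: edges_within_def)
      then have "b \<notin> X" using e(5) b by auto
      moreover have "a \<in> X" using whole[of A] e(3) a by auto
      moreover have "e \<in> F'" using e by (auto simp: F'_def)
      ultimately show ?thesis using a b by (intro edge_cutI[of e _ a _ X b]) auto
    qed
  qed
  ultimately show ?thesis by (intro exI[of _ F'] conjI)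
qed

lemma collapsible_Union:
  assumes S: "S \<subseteq> P" and coll: "\<And>A. A \<in> S \<Longrightarrow> collapsible E A"
    and quot: "\<And>Q. Q \<subseteq> S \<Longrightarrow> even (card Q) \<Longrightarrow>
      \<exists>F\<subseteq>edges_within (blocks_of P) (crossing P E) S.
        cut_connected (blocks_of P) F S \<and> is_join (blocks_of P) F S Q"
  shows "collapsible E (\<Union>S)"
  unfolding collapsible_def
proof (intro allI impI)
  fix R assume R: "R \<subseteq> \<Union>S" "even (card R)"
  let ?Q = "{A \<in> S. odd (card (A \<inter> R))}"
  have finS: "finite S" using S finite_P finite_subset by auto
  have "card (\<Union>A\<in>S. A \<inter> R) = (\<Sum>A\<in>S. card (A \<inter> R))"
  proof (intro card_UN_disjoint finS ballI impI)
    show "finite (A \<inter> R)" if "A \<in> S" for A using that S finite_block by auto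
    show "(A \<inter> R) \<inter> (B \<inter> R) = {}" if "A \<in> S" "B \<in> S" "A \<noteq> B" for A B
      using block_unique[of A B] that S by blast
  qed
  moreover have "(\<Union>A\<in>S. A \<inter> R) = R" using R by auto
  ultimately have "even (\<Sum>A\<in>S. card (A \<inter> R))" using R by simp
  then have Q: "even (card ?Q)" unfolding even_sum_iff[OF finS] .
  have "?Q \<subseteq> S" by simp
  from quot[OF this Q] obtain F where F: "F \<subseteq> edges_within (blocks_of P) (crossing P E) S \<and>
    cut_connected (blocks_of P) F S \<and> is_join (blocks_of P) F S ?Q" ..
  from lift_spanning_join[OF S coll conjunct1[OF F] conjunct1[OF conjunct2[OF F]]
      conjunct2[OF conjunct2[OF F]] R(1)]
  show "\<exists>F\<subseteq>edges_within own_ends E (\<Union>S). cut_connected own_ends F (\<Union>S) \<and> is_join own_ends F (\<Union>S) R" .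
qed

lemma partition_on_merge:
  assumes "S \<subseteq> P" "S \<noteq> {}"
  shows "partition_on V (insert (\<Union>S) (P - S))"
proof (rule partition_onI)
  show "\<Union> (insert (\<Union>S) (P - S)) = V" using part assms by (auto simp: partition_on_def)
  obtain A where A: "A \<in> S" using assms(2) by auto
  then have "A \<noteq> {}" using assms(1) block_nonempty by auto
  then have "\<Union>S \<noteq> {}" using A by auto
  then show "{} \<notin> insert (\<Union>S) (P - S)" using block_nonempty by auto
  show "disjnt p p'" if "p \<in> insert (\<Union>S) (P - S)" "p' \<in> insert (\<Union>S) (P - S)" "p \<noteq> p'" for p p'
  proof -
    have "disjnt (\<Union>S) A" if "A \<in> P - S" for A
      unfolding disjnt_iff
    proof (intro allI notI)
      fix v assume "v \<in> \<Union>S \<and> v \<in> A"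
      then obtain B where "B \<in> S" "v \<in> B" "v \<in> A" by auto
      then show False using block_unique[of A B v] that assms(1) by auto
    qed
    moreover have "disjnt A B" if "A \<in> P" "B \<in> P" "A \<noteq> B" for A B
      using block_unique that by (auto simp: disjnt_iff)
    ultimately show ?thesis using that assms(1) by (metis DiffE disjnt_sym insertE)
  qed
qed

end

text \<open>
  A partition into the least number of collapsible blocks; it exists since singletons are collapsible.
\<close>

lemma maximal_collapsible_partition:
  assumes mg: "multigraph V E own_ends"
  shows "\<exists>P. partition_on V P \<and> (\<forall>A\<in>P. collapsible E A) \<and>
    (\<forall>S\<subseteq>P. card S \<ge> 2 \<longrightarrow> \<not> collapsible E (\<Union>S))"
proof -
  let ?ok = "\<lambda>P. partition_on V P \<and> (\<forall>A\<in>P. collapsible E A)"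
  have "?ok ((\<lambda>v. {v}) ` V)"
    using collapsible_singleton by (auto simp: partition_on_def disjoint_def)
  from ex_has_least_nat[of ?ok, OF this, of card]
  obtain P where P_least: "?ok P \<and> (\<forall>Q. ?ok Q \<longrightarrow> card P \<le> card Q)" ..
  note P = conjunct1[OF P_least] and least = mp[OF spec[OF conjunct2[OF P_least]]]
  interpret graph_partition V E P using mg P by (simp add: graph_partition_def)
  have "\<not> collapsible E (\<Union>S)" if S: "S \<subseteq> P" "card S \<ge> 2" for S
  proof
    assume coll: "collapsible E (\<Union>S)"
    have "S \<noteq> {}" using S by auto
    have finS: "finite S" using S finite_P finite_subset by auto
    have "?ok (insert (\<Union>S) (P - S))"
      using partition_on_merge[OF S(1) \<open>S \<noteq> {}\<close>] coll P by auto
    from least[OF this] have "card P \<le> card (insert (\<Union>S) (P - S))" .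
    also have "\<dots> \<le> card (P - S) + 1" using finite_P by (simp add: card_insert_if)
    also have "card (P - S) = card P - card S" using S finS by (simp add: card_Diff_subset)
    finally show False using S card_mono[OF finite_P S(1)] by linarith
  qed
  then show ?thesis using P by (intro exI[of _ P]) simp
qed

locale reduced_partition = graph_partition +
  assumes blocks_collapsible: "A \<in> P \<Longrightarrow> collapsible E A"
    and union_not_collapsible: "S \<subseteq> P \<Longrightarrow> card S \<ge> 2 \<Longrightarrow> \<not> collapsible E (\<Union>S)"
begin

text \<open>
  Otherwise some blocks span two disjoint trees in the quotient and could be merged.
\<close>

lemma quotient_sparse:
  assumes S: "S \<subseteq> P" "card S \<ge> 2"
  shows "card (edges_within (blocks_of P) (crossing P E) S) + 3 \<le> 2 * card S"
proof (rule ccontr)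
  let ?W = "edges_within (blocks_of P) (crossing P E)"
  assume "\<not> ?thesis"
  then have dense: "2 * card S \<le> card (?W S) + 2" by linarith
  have finS: "finite S" using S finite_P finite_subset by auto
  have mg: "multigraph X (?W X) (blocks_of P)" if "X \<subseteq> P" for X
    using multigraph_crossing that finite_P by (auto simp: multigraph_def edges_within_def intro: finite_subset)
  obtain X where X: "X \<subseteq> S" "card X \<ge> 2" "packs_two_trees (blocks_of P) (edges_within (blocks_of P) (?W S) X) X"
    using dense_packs_two_trees[OF mg[OF S(1)] S(2) dense] by auto
  have "edges_within (blocks_of P) (?W S) X = ?W X" using X(1) by (auto simp: edges_within_def)
  then obtain T1 T2 where T: "T1 \<subseteq> ?W X" "T2 \<subseteq> ?W X" "T1 \<inter> T2 = {}"
    "cut_connected (blocks_of P) T1 X" "cut_connected (blocks_of P) T2 X"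
    using X(3) unfolding packs_two_trees_def by auto
  have XP: "X \<subseteq> P" using X S by auto
  have "collapsible E (\<Union>X)"
    using XP blocks_collapsible spanning_join_exists[OF mg[OF XP] T]
    by (intro collapsible_Union) auto
  then show False using union_not_collapsible[OF XP X(2)] by simp
qed

text \<open>
  A triangle is collapsible although it does not have enough edges for two disjoint spanning trees:
  the even set is either empty, realized by all three edges, or a pair, realized by the path of length
  two between its members.
\<close>

lemma quotient_triangle_free:
  assumes ABC: "A \<noteq> B" "B \<noteq> C" "A \<noteq> C" "A \<in> P" "B \<in> P" "C \<in> P"
    and efg: "e \<in> crossing P E" "f \<in> crossing P E" "g \<in> crossing P E"
    and blocks: "blocks_of P e = {A, B}" "blocks_of P f = {B, C}" "blocks_of P g = {A, C}"
  shows False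
proof -
  let ?W = "edges_within (blocks_of P) (crossing P E)"
  have path: "\<exists>F\<subseteq>?W {X, Y, Z}. cut_connected (blocks_of P) F {X, Y, Z} \<and> is_join (blocks_of P) F {X, Y, Z} {X, Z}"
    if "X \<noteq> Y" "Y \<noteq> Z" "X \<noteq> Z" "x \<in> crossing P E" "y \<in> crossing P E"
      "blocks_of P x = {X, Y}" "blocks_of P y = {Y, Z}" for X Y Z x y
  proof (intro exI[of _ "{x, y}"] conjI)
    have xy: "x \<noteq> y" using that by (auto simp: doubleton_eq_iff)
    show "{x, y} \<subseteq> ?W {X, Y, Z}" using that by (auto simp: edges_within_def)
    have deg: "{e \<in> {x, y}. W \<in> blocks_of P e} = (if W = X then {x} else if W = Z then {y} else {x, y})"
      if "W \<in> {X, Y, Z}" for W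
      using that \<open>X \<noteq> Y\<close> \<open>Y \<noteq> Z\<close> \<open>X \<noteq> Z\<close> \<open>blocks_of P x = {X, Y}\<close> \<open>blocks_of P y = {Y, Z}\<close> by auto
    show "is_join (blocks_of P) {x, y} {X, Y, Z} {X, Z}"
      unfolding is_join_def edge_degree_def
    proof
      fix W assume W: "W \<in> {X, Y, Z}"
      show "odd (card {e \<in> {x, y}. W \<in> blocks_of P e}) \<longleftrightarrow> W \<in> {X, Z}"
        unfolding deg[OF W] using W that(1-3) xy by auto
    qed
    show "cut_connected (blocks_of P) {x, y} {X, Y, Z}"
    proof (rule cut_connectedI)
      fix W assume W: "W \<subseteq> {X, Y, Z}" "W \<noteq> {}"
        and cl: "\<And>e a b. e \<in> {x, y} \<Longrightarrow> a \<in> blocks_of P e \<Longrightarrow> b \<in> blocks_of P e \<Longrightarrow> a \<in> W \<Longrightarrow> b \<in> W"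
      have "X \<in> W \<longleftrightarrow> Y \<in> W"
        by (rule iffI; rule cl[of x]) (simp_all add: that(6))
      moreover have "Y \<in> W \<longleftrightarrow> Z \<in> W"
        by (rule iffI; rule cl[of y]) (simp_all add: that(7))
      ultimately have "X \<in> W \<and> Y \<in> W \<and> Z \<in> W" using W by auto
      then show "{X, Y, Z} \<subseteq> W" by simp
    qed
  qed
  have "collapsible E (\<Union>{A, B, C})"
  proof (rule collapsible_Union)
    fix Q assume Q: "Q \<subseteq> {A, B, C}" "even (card Q)"
    then have "card Q \<noteq> 1" "card Q \<noteq> 3" by auto
    moreover have "Q \<in> Pow {A, B, C}" using Q(1) by simp
    then have "Q = {} \<or> Q = {A} \<or> Q = {B} \<or> Q = {C} \<or> Q = {A, B} \<or> Q = {B, C} \<or> Q = {A, C}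
        \<or> Q = {A, B, C}"
      by (simp only: Pow_insert Pow_empty image_insert image_empty Un_insert_left Un_insert_right
          sup_bot_left sup_bot_right insert_iff empty_iff) argo
    moreover have "card {A} = 1" "card {B} = 1" "card {C} = 1" "card {A, B, C} = 3"
      using ABC(1-3) by simp_all
    ultimately have "Q = {} \<or> Q = {A, B} \<or> Q = {B, C} \<or> Q = {A, C}" by metis
    then consider "Q = {}" | "Q = {A, B}" | "Q = {B, C}" | "Q = {A, C}" by blast
    then show "\<exists>F\<subseteq>?W {A, B, C}. cut_connected (blocks_of P) F {A, B, C} \<and> is_join (blocks_of P) F {A, B, C} Q"
    proof cases
      case 1
      have dist: "e \<noteq> f" "f \<noteq> g" "e \<noteq> g" using blocks ABC by (auto simp: doubleton_eq_iff)
      show ?thesis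
      proof (intro exI[of _ "{e, f, g}"] conjI)
        show "{e, f, g} \<subseteq> ?W {A, B, C}" using efg blocks by (auto simp: edges_within_def)
        have deg: "{x \<in> {e, f, g}. W \<in> blocks_of P x} = (if W = A then {e, g} else if W = B then {e, f} else {f, g})"
          if "W \<in> {A, B, C}" for W
        proof -
          have "A \<in> blocks_of P e" "A \<notin> blocks_of P f" "A \<in> blocks_of P g"
            "B \<in> blocks_of P e" "B \<in> blocks_of P f" "B \<notin> blocks_of P g"
            "C \<notin> blocks_of P e" "C \<in> blocks_of P f" "C \<in> blocks_of P g"
            using ABC(1-3) blocks by auto
          then show ?thesis using that ABC(1-3) by auto
        qed
        show "is_join (blocks_of P) {e, f, g} {A, B, C} Q"
          unfolding is_join_def edge_degree_def
        proof
          fix W assume W: "W \<in> {A, B, C}"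
          show "odd (card {x \<in> {e, f, g}. W \<in> blocks_of P x}) \<longleftrightarrow> W \<in> Q"
            unfolding deg[OF W] using W 1 dist by auto
        qed
        show "cut_connected (blocks_of P) {e, f, g} {A, B, C}"
        proof (rule cut_connectedI)
          fix W assume W: "W \<subseteq> {A, B, C}" "W \<noteq> {}"
            and cl: "\<And>x a b. x \<in> {e, f, g} \<Longrightarrow> a \<in> blocks_of P x \<Longrightarrow> b \<in> blocks_of P x \<Longrightarrow> a \<in> W \<Longrightarrow> b \<in> W"
          have "A \<in> W \<longleftrightarrow> B \<in> W"
            by (rule iffI; rule cl[of e]) (simp_all add: blocks(1))
          moreover have "B \<in> W \<longleftrightarrow> C \<in> W"
            by (rule iffI; rule cl[of f]) (simp_all add: blocks(2))
          ultimately have "A \<in> W \<and> B \<in> W \<and> C \<in> W" using W by auto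
          then show "{A, B, C} \<subseteq> W" by simp
        qed
      qed
    next
      case 2
      have "{A, C, B} = {A, B, C}" by auto
      then show ?thesis using 2 path[of A C B g f] ABC efg blocks by (simp add: insert_commute)
    next
      case 3
      have "{B, A, C} = {A, B, C}" by auto
      then show ?thesis using 3 path[of B A C e g] ABC efg blocks by (simp add: insert_commute)
    next
      case 4
      then show ?thesis using path[of A B C e f] ABC efg blocks by simp
    qed
  qed (use ABC blocks_collapsible in auto)
  moreover have "card {A, B, C} \<ge> 2" using ABC by auto
  ultimately show False using union_not_collapsible[of "{A, B, C}"] ABC by blast
qed

text \<open>
  Two parallel edges are two disjoint spanning trees.
\<close>

lemma quotient_simple:
  assumes "A \<in> P" "B \<in> P" "A \<noteq> B" "e \<in> crossing P E" "f \<in> crossing P E"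
    "blocks_of P e = {A, B}" "blocks_of P f = {A, B}"
  shows "e = f"
proof (rule ccontr)
  let ?W = "edges_within (blocks_of P) (crossing P E) {A, B}"
  assume "e \<noteq> f"
  have "finite ?W" using finite_E by (simp add: edges_within_def crossing_def)
  moreover have "{e, f} \<subseteq> ?W" using assms by (auto simp: edges_within_def)
  ultimately have "card {e, f} \<le> card ?W" by (rule card_mono)
  then show False using quotient_sparse[of "{A, B}"] assms \<open>e \<noteq> f\<close> by simp
qed

end

section \<open>Spanning closed trails on eight vertices\<close>

definition supereulerian :: "'a set \<Rightarrow> 'a set set \<Rightarrow> bool" where
  "supereulerian V E \<longleftrightarrow> (\<exists>F\<subseteq>E. cut_connected own_ends F V \<and> is_join own_ends F V {})"

lemma edge_degree_insert:
  assumes "finite F" "e \<notin> F"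
  shows "edge_degree ends (insert e F) v = edge_degree ends F v + (if v \<in> ends e then 1 else 0)"
proof -
  have "{f \<in> insert e F. v \<in> ends f} = (if v \<in> ends e then insert e {f \<in> F. v \<in> ends f} else {f \<in> F. v \<in> ends f})"
    by auto
  then show ?thesis using assms by (simp add: edge_degree_def)
qed

lemma edge_degree_empty: "edge_degree ends {} v = 0"
  by (simp add: edge_degree_def)

lemma octagon_supereulerian:
  assumes V: "V = {v0, v1, v2, v3, v4, v5, v6, v7}" and dist: "distinct [v0, v1, v2, v3, v4, v5, v6, v7]"
    and E: "{v0, v1} \<in> E" "{v1, v2} \<in> E" "{v2, v3} \<in> E" "{v3, v4} \<in> E" "{v4, v5} \<in> E" "{v5, v6} \<in> E"
      "{v6, v7} \<in> E" "{v7, v0} \<in> E"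
  shows "supereulerian V E"
proof -
  let ?F = "{{v0, v1}, {v1, v2}, {v2, v3}, {v3, v4}, {v4, v5}, {v5, v6}, {v6, v7}, {v7, v0}}"
  \<comment> \<open>Rewriting with inequations needs both orientations.\<close>
  have dist': "distinct [v7, v6, v5, v4, v3, v2, v1, v0]" using dist by auto
  have deg: "edge_degree own_ends ?F v =
      (if v \<in> {v0, v1} then 1 else 0) + (if v \<in> {v1, v2} then 1 else 0) + (if v \<in> {v2, v3} then 1 else 0)
      + (if v \<in> {v3, v4} then 1 else 0) + (if v \<in> {v4, v5} then 1 else 0) + (if v \<in> {v5, v6} then 1 else 0)
      + (if v \<in> {v6, v7} then 1 else 0) + (if v \<in> {v7, v0} then 1 else 0)" for v
    using dist dist' by (subst edge_degree_insert, simp, simp add: doubleton_eq_iff)+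
      (simp add: edge_degree_empty)
  have "is_join own_ends ?F V {}"
    unfolding is_join_def deg V using dist dist' by simp
  moreover have "cut_connected own_ends ?F V"
  proof (rule cut_connectedI)
    fix X assume X: "X \<subseteq> V" "X \<noteq> {}"
      and cl: "\<And>e a b. e \<in> ?F \<Longrightarrow> a \<in> e \<Longrightarrow> b \<in> e \<Longrightarrow> a \<in> X \<Longrightarrow> b \<in> X"
    have "v0 \<in> X \<longleftrightarrow> v1 \<in> X" by (rule iffI; rule cl[of "{v0, v1}"]) simp_all
    moreover have "v1 \<in> X \<longleftrightarrow> v2 \<in> X" by (rule iffI; rule cl[of "{v1, v2}"]) simp_all
    moreover have "v2 \<in> X \<longleftrightarrow> v3 \<in> X" by (rule iffI; rule cl[of "{v2, v3}"]) simp_all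
    moreover have "v3 \<in> X \<longleftrightarrow> v4 \<in> X" by (rule iffI; rule cl[of "{v3, v4}"]) simp_all
    moreover have "v4 \<in> X \<longleftrightarrow> v5 \<in> X" by (rule iffI; rule cl[of "{v4, v5}"]) simp_all
    moreover have "v5 \<in> X \<longleftrightarrow> v6 \<in> X" by (rule iffI; rule cl[of "{v5, v6}"]) simp_all
    moreover have "v6 \<in> X \<longleftrightarrow> v7 \<in> X" by (rule iffI; rule cl[of "{v6, v7}"]) simp_all
    moreover have "v0 \<in> X \<or> v1 \<in> X \<or> v2 \<in> X \<or> v3 \<in> X \<or> v4 \<in> X \<or> v5 \<in> X \<or> v6 \<in> X \<or> v7 \<in> X"
      using X unfolding V by auto
    ultimately have "v0 \<in> X \<and> v1 \<in> X \<and> v2 \<in> X \<and> v3 \<in> X \<and> v4 \<in> X \<and> v5 \<in> X \<and> v6 \<in> X \<and> v7 \<in> X" by argo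
    then show "V \<subseteq> X" unfolding V by simp
  qed
  moreover have "?F \<subseteq> E" using E by simp
  ultimately show ?thesis unfolding supereulerian_def by (intro exI[of _ ?F] conjI)
qed

definition nbrs :: "'a set set \<Rightarrow> 'a \<Rightarrow> 'a set" where
  "nbrs E u = {w. {u, w} \<in> E}"

lemma nbrs_sym: "x \<in> nbrs E y \<longleftrightarrow> y \<in> nbrs E x"
  by (simp add: nbrs_def insert_commute)

lemma card_nbrs:
  assumes "multigraph V E own_ends"
  shows "card (nbrs E u) = edge_degree own_ends E u"
proof -
  have "bij_betw (\<lambda>w. {u, w}) (nbrs E u) {e \<in> E. u \<in> e}"
  proof (rule bij_betwI')
    show "({u, x} = {u, y}) = (x = y)" for x y by (auto simp: doubleton_eq_iff)
    show "{u, x} \<in> {e \<in> E. u \<in> e}" if "x \<in> nbrs E u" for x using that by (simp add: nbrs_def)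
    show "\<exists>x\<in>nbrs E u. e = {u, x}" if "e \<in> {e \<in> E. u \<in> e}" for e
    proof -
      have "card e = 2" "e \<in> E" "u \<in> e" using that assms by (auto simp: multigraph_def)
      then obtain x where "e = {u, x}" by (auto simp: card_2_iff insert_commute)
      then show ?thesis using \<open>e \<in> E\<close> by (auto simp: nbrs_def)
    qed
  qed
  then show ?thesis unfolding edge_degree_def by (rule bij_betw_same_card)
qed

lemma nbrs_subset:
  assumes "multigraph V E own_ends"
  shows "nbrs E u \<subseteq> V - {u}"
proof
  fix x assume "x \<in> nbrs E u"
  then have "{u, x} \<in> E" by (simp add: nbrs_def)
  then have "{u, x} \<subseteq> V" "card {u, x} = 2" using assms by (auto simp: multigraph_def)
  then show "x \<in> V - {u}" by (cases "x = u") simp_all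
qed

text \<open>
  A neighbourhood \<open>N\<close> of a vertex \<open>u\<close> of degree at least 4 is independent, so every edge has exactly one
  end in \<open>N\<close> or lies within the set \<open>W\<close> of vertices outside \<open>N\<close> and different from \<open>u\<close>.  As all
  degrees in \<open>N\<close> are at least 3, the 13 edges force 4 vertices in \<open>N\<close>, 3 vertices in \<open>W\<close> and at most one
  edge within \<open>W\<close>.  If there is none, the graph is the complete bipartite graph between \<open>N\<close> and
  \<open>insert u W\<close> without a matching of three edges.  If there is one, its ends have disjoint neighbourhoods of two vertices
  in \<open>N\<close>, and the third vertex of \<open>W\<close> is adjacent to all of \<open>N\<close>.  Either graph is Hamiltonian.
\<close>

lemma eight_vertices_supereulerian:
  assumes mg: "multigraph V E own_ends" and V: "card V = 8" and E: "card E = 13"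
    and deg: "\<And>v. v \<in> V \<Longrightarrow> 3 \<le> edge_degree own_ends E v"
    and tri: "\<And>x y z. {x, y} \<in> E \<Longrightarrow> {y, z} \<in> E \<Longrightarrow> {x, z} \<in> E \<Longrightarrow> False"
  shows "supereulerian V E"
proof -
  have fin: "finite V" "finite E" using mg by (auto simp: multigraph_def)
  have edge: "e \<subseteq> V" "card e = 2" if "e \<in> E" for e using mg that by (auto simp: multigraph_def)
  let ?N = "nbrs E"
  have cardN: "card (?N v) = edge_degree own_ends E v" for v by (rule card_nbrs[OF mg])
  have N_sub: "?N v \<subseteq> V - {v}" for v by (rule nbrs_subset[OF mg])
  have finN: "finite (?N v)" for v using N_sub[of v] fin finite_subset by blast
  have N_tri: "y \<notin> ?N z" if "y \<in> ?N x" "z \<in> ?N x" for x y z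
  proof
    assume "y \<in> ?N z"
    then have "{x, y} \<in> E" "{y, z} \<in> E" "{x, z} \<in> E" using that by (simp_all add: nbrs_def insert_commute)
    then show False by (rule tri)
  qed
  have "\<exists>u\<in>V. 4 \<le> card (?N u)"
  proof (rule ccontr)
    assume "\<not> ?thesis"
    then have "(\<Sum>v\<in>V. edge_degree own_ends E v) \<le> (\<Sum>v\<in>V. 3)"
      by (intro sum_mono) (force simp: cardN)
    then show False using handshake[OF mg] E V by simp
  qed
  then obtain u where u: "u \<in> V" "4 \<le> card (?N u)" by auto
  define N where "N = ?N u"
  define W where "W = V - insert u N"
  have NV: "N \<subseteq> V" "u \<notin> N" "finite N" "finite W" using N_sub[of u] fin finN by (auto simp: N_def W_def)
  have cardV: "card N + card W = 7"
  proof -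
    have "card (insert u N) = card N + 1" using NV by simp
    moreover have "card W = card V - card (insert u N)"
      unfolding W_def using NV u by (intro card_Diff_subset) auto
    moreover have "card (insert u N) \<le> card V" using NV u fin by (intro card_mono) auto
    ultimately show ?thesis using V by linarith
  qed
  have nbr_N: "?N x = insert u (?N x \<inter> W)" if "x \<in> N" for x
  proof -
    have "u \<in> ?N x" using that nbrs_sym unfolding N_def by fast
    moreover have "?N x \<inter> N = {}" using N_tri[of _ u x] that nbrs_sym[of _ E x] unfolding N_def by auto
    ultimately show ?thesis using N_sub[of x] unfolding W_def by auto
  qed
  have card_nbr_N: "card (?N x) = card (?N x \<inter> W) + 1" if "x \<in> N" for x
  proof -
    have "card (insert u (?N x \<inter> W)) = card (?N x \<inter> W) + 1" using NV by (simp add: W_def)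
    then show ?thesis using nbr_N[OF that] by simp
  qed
  have two_W: "2 \<le> card (?N x \<inter> W)" if "x \<in> N" for x
    using card_nbr_N[OF that] deg[of x] that NV cardN[of x] by auto
  have le_W: "card (?N x \<inter> W) \<le> card W" for x using NV by (intro card_mono) auto
  have nbr_W: "?N w \<subseteq> N \<union> W" if "w \<in> W" for w
  proof -
    have "u \<notin> ?N w" using that nbrs_sym[of u E w] unfolding W_def N_def by auto
    then show ?thesis using N_sub[of w] unfolding W_def by auto
  qed
  define EW where "EW = {e \<in> E. e \<subseteq> W}"
  have edge_N: "card (e \<inter> N) = (if e \<subseteq> W then 0 else 1)" if e: "e \<in> E" for e
  proof (cases "e \<inter> N = {}")
    case True
    have "e \<subseteq> W"
    proof (rule ccontr)
      assume "\<not> e \<subseteq> W"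
      then have "u \<in> e" using edge(1)[OF e] True unfolding W_def by auto
      then obtain x where "e = {u, x}" using edge(2)[OF e] by (auto simp: card_2_iff insert_commute)
      then have "x \<in> e \<inter> N" using e by (simp add: N_def nbrs_def)
      then show False using True by simp
    qed
    then show ?thesis using True by simp
  next
    case False
    then obtain x where x: "x \<in> e" "x \<in> N" by auto
    then obtain y where y: "e = {x, y}" using edge(2)[OF e] by (auto simp: card_2_iff insert_commute)
    then have "y \<in> ?N x" using e by (simp add: nbrs_def)
    then have "y \<notin> N" using nbr_N[OF x(2)] NV(2) unfolding W_def by auto
    then have "e \<inter> N = {x}" using x y by auto
    moreover have "\<not> e \<subseteq> W" using x unfolding W_def by auto
    ultimately show ?thesis by simp
  qed
  have finEW: "finite EW" "EW \<subseteq> E" using fin by (auto simp: EW_def)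
  have sumN: "(\<Sum>x\<in>N. card (?N x)) + card EW = 13"
  proof -
    have "(\<Sum>x\<in>N. card (?N x)) = (\<Sum>e\<in>E. card (e \<inter> N))"
      unfolding cardN by (rule sum_edge_degree) (use NV fin in auto)
    also have "\<dots> = (\<Sum>e\<in>E. if e \<subseteq> W then 0 else 1)" using edge_N by (intro sum.cong) auto
    also have "\<dots> = card {e \<in> E. \<not> e \<subseteq> W}"
      using fin by (simp add: sum.If_cases Int_def)
    also have "{e \<in> E. \<not> e \<subseteq> W} = E - EW" by (auto simp: EW_def)
    also have "card (E - EW) = card E - card EW" using finEW by (intro card_Diff_subset)
    finally show ?thesis using card_mono[OF fin(2) finEW(2)] E by simp
  qed
  have N3: "3 \<le> card (?N v)" if "v \<in> V" for v using deg[OF that] cardN by simp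
  have "(\<Sum>x\<in>N. 3) \<le> (\<Sum>x\<in>N. card (?N x))" using NV N3 by (intro sum_mono) auto
  then have N_le: "3 * card N + card EW \<le> 13" using sumN by simp
  then have N4: "card N = 4" "card W = 3" and EW1: "card EW \<le> 1" using u(2) cardV unfolding N_def by linarith+
  have u_nbr: "{u, x} \<in> E" "{x, u} \<in> E" if "x \<in> N" for x
    using that by (simp_all add: N_def nbrs_def insert_commute)
  have VNW: "V = insert u (N \<union> W)" using NV(1) u(1) unfolding W_def by auto
  have disj: "u \<notin> N" "u \<notin> W" "N \<inter> W = {}" using NV by (auto simp: W_def)
  obtain p q r where pqr: "W = {p, q, r}" "p \<noteq> q" "p \<noteq> r" "q \<noteq> r" using N4(2) by (auto simp: card_3_iff)
  show ?thesis
  proof (cases "EW = {}")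
    case True
    have indep: "?N w \<subseteq> N" if "w \<in> W" for w
    proof -
      have "{w, x} \<notin> E" if "x \<in> W" for x using True that \<open>w \<in> W\<close> unfolding EW_def by auto
      then have "?N w \<inter> W = {}" by (auto simp: nbrs_def)
      then show ?thesis using nbr_W[OF that] by auto
    qed
    have miss: "card (N - ?N w) \<le> 1" if "w \<in> W" for w
    proof -
      have "card (N - ?N w) = card N - card (?N w)" using indep[OF that] finN by (intro card_Diff_subset) auto
      moreover have "w \<in> V" using that by (simp add: W_def)
      ultimately show ?thesis using N3[of w] N4 by simp
    qed
    have no_common: "False" if "w \<in> W" "w' \<in> W" "w \<noteq> w'" "x \<in> N" "x \<notin> ?N w" "x \<notin> ?N w'" for w w' x
    proof -
      have "?N x \<inter> W \<subseteq> W - {w, w'}" using that(5,6) nbrs_sym[of x E] by auto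
      then have "card (?N x \<inter> W) \<le> card (W - {w, w'})" using NV by (intro card_mono) auto
      also have "\<dots> = 1" using that(1-3) N4 NV by (subst card_Diff_subset) auto
      finally show False using two_W[OF that(4)] by simp
    qed
    \<comment> \<open>Count the three missing pairs between \<open>N\<close> and \<open>W\<close> from both sides.\<close>
    have total: "(\<Sum>x\<in>N. card (W - ?N x)) = 3"
    proof -
      have "card (W - ?N x) + card (?N x) = 4" if "x \<in> N" for x
      proof -
        have "card (W - ?N x) + card (?N x \<inter> W) = card W"
          using NV by (metis Int_commute card_Diff_subset_Int card_Int_Diff add.commute)
        then show ?thesis using card_nbr_N[OF that] N4 by linarith
      qed
      then have "(\<Sum>x\<in>N. card (W - ?N x) + card (?N x)) = (\<Sum>x\<in>N. 4)" by (intro sum.cong) auto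
      then show ?thesis using sumN True N4 by (simp add: sum.distrib)
    qed
    have "(\<Sum>w\<in>W. card (N - ?N w)) = 3"
    proof -
      have "(\<Sum>w\<in>W. card {x \<in> N. x \<notin> ?N w}) = (\<Sum>x\<in>N. card {w \<in> W. x \<notin> ?N w})"
        by (rule sum_multicount_gen) (use NV in auto)
      moreover have "{x \<in> N. x \<notin> ?N w} = N - ?N w" for w by auto
      moreover have "{w \<in> W. x \<notin> ?N w} = W - ?N x" for x using nbrs_sym[of x E] by auto
      ultimately show ?thesis using total by simp
    qed
    then have "card (N - ?N p) + card (N - ?N q) + card (N - ?N r) = 3" using pqr by simp
    then have "card (N - ?N p) = 1" "card (N - ?N q) = 1" "card (N - ?N r) = 1"
      using miss[of p] miss[of q] miss[of r] pqr(1) by auto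
    then obtain a b c where abc: "N - ?N p = {a}" "N - ?N q = {b}" "N - ?N r = {c}"
      by (auto simp: card_1_singleton_iff)
    have inN: "a \<in> N" "b \<in> N" "c \<in> N" using abc by auto
    have notN: "a \<notin> ?N p" "b \<notin> ?N q" "c \<notin> ?N r" using abc by auto
    have W3: "p \<in> W" "q \<in> W" "r \<in> W" using pqr(1) by simp_all
    have abc_distinct: "a \<noteq> b" "a \<noteq> c" "b \<noteq> c"
      using no_common[OF W3(1,2) pqr(2) inN(1)] no_common[OF W3(1,3) pqr(3) inN(1)]
        no_common[OF W3(2,3) pqr(4) inN(2)] notN by metis+
    have "card (N - {a, b, c}) = 1"
      using N4 NV inN abc_distinct by (subst card_Diff_subset) auto
    then obtain d where "N - {a, b, c} = {d}" by (auto simp: card_1_singleton_iff)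
    then have Nabcd: "N = {a, b, c, d}" and d: "d \<noteq> a" "d \<noteq> b" "d \<noteq> c" using inN by auto
    have adj: "{x, p} \<in> E" "{p, x} \<in> E" if "x \<in> N" "x \<noteq> a" for x
    proof -
      have "x \<in> ?N p" using abc(1) that by blast
      then show "{x, p} \<in> E" "{p, x} \<in> E" by (simp_all add: nbrs_def insert_commute)
    qed
    have adj_q: "{x, q} \<in> E" "{q, x} \<in> E" if "x \<in> N" "x \<noteq> b" for x
    proof -
      have "x \<in> ?N q" using abc(2) that by blast
      then show "{x, q} \<in> E" "{q, x} \<in> E" by (simp_all add: nbrs_def insert_commute)
    qed
    have adj_r: "{x, r} \<in> E" "{r, x} \<in> E" if "x \<in> N" "x \<noteq> c" for x
    proof -
      have "x \<in> ?N r" using abc(3) that by blast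
      then show "{x, r} \<in> E" "{r, x} \<in> E" by (simp_all add: nbrs_def insert_commute)
    qed
    have "d \<in> N" using Nabcd by simp
    have "V = {u, a, q, c, p, b, r, d}" unfolding VNW Nabcd pqr(1) by auto
    moreover have "distinct [u, a, q, c, p, b, r, d]"
      using disj pqr(2-4) d abc_distinct unfolding Nabcd pqr(1) by simp blast
    ultimately show ?thesis
      by (rule octagon_supereulerian) (use inN d abc_distinct \<open>d \<in> N\<close> in \<open>simp_all add: u_nbr adj adj_q adj_r\<close>)
  next
    case False
    then have "card EW = 1" using EW1 finEW by (metis card_0_eq le_SucE le_zero_eq One_nat_def)
    then have sum12: "(\<Sum>x\<in>N. card (?N x)) = 12" using sumN by simp
    obtain e where "e \<in> EW" using False by auto
    then have e: "e \<in> E" "e \<subseteq> W" by (auto simp: EW_def)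
    then obtain s t where st: "e = {s, t}" "s \<noteq> t" using edge(2)[OF e(1)] by (auto simp: card_2_iff)
    then have "card (W - {s, t}) = 1" using e N4 NV by (subst card_Diff_subset) auto
    then obtain y where "W - {s, t} = {y}" by (auto simp: card_1_singleton_iff)
    then have W_sty: "W = {s, t, y}" "y \<noteq> s" "y \<noteq> t" using e st by auto
    have EW_only: "f = e" if "f \<in> E" "f \<subseteq> W" for f
    proof -
      obtain x where "EW = {x}" using \<open>card EW = 1\<close> by (rule card_1_singletonE)
      moreover have "f \<in> EW" using that by (simp add: EW_def)
      ultimately show ?thesis using \<open>e \<in> EW\<close> by simp
    qed
    have not_both: "\<not> (x \<in> ?N s \<and> x \<in> ?N t)" for x
    proof
      assume "x \<in> ?N s \<and> x \<in> ?N t"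
      moreover have "t \<in> ?N s" using e st by (simp add: nbrs_def)
      ultimately show False using N_tri[of x s t] by simp
    qed
    have y_adj: "x \<in> ?N y" if "x \<in> N" for x
    proof (rule ccontr)
      assume "x \<notin> ?N y"
      then have "y \<notin> ?N x" by (simp add: nbrs_sym[of y])
      then have "?N x \<inter> W \<subseteq> {s, t}" using W_sty by auto
      moreover have "\<not> (s \<in> ?N x \<and> t \<in> ?N x)" using not_both[of x] by (simp add: nbrs_sym[of _ E x])
      ultimately have "?N x \<inter> W \<subseteq> {s} \<or> ?N x \<inter> W \<subseteq> {t}" by auto
      then have "card (?N x \<inter> W) \<le> 1" using card_mono[of "{s}"] card_mono[of "{t}"] by fastforce
      then show False using two_W[OF that] by simp
    qed
    have two: "2 \<le> card (?N w \<inter> N)" if w: "w \<in> {s, t}" for w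
    proof -
      have "w \<in> W" "w \<in> V" using w e st by (auto simp: W_def)
      have "?N w \<inter> W \<subseteq> {s, t} - {w}"
      proof
        fix z assume z: "z \<in> ?N w \<inter> W"
        then have "{w, z} = e" using EW_only[of "{w, z}"] \<open>w \<in> W\<close> by (simp add: nbrs_def)
        moreover have "z \<noteq> w" using N_sub[of w] z by auto
        ultimately show "z \<in> {s, t} - {w}" using st by auto
      qed
      then have "card (?N w \<inter> W) \<le> card ({s, t} - {w})" by (intro card_mono) auto
      also have "\<dots> = 1" using w st by auto
      finally have "card (?N w \<inter> W) \<le> 1" .
      moreover have "?N w = (?N w \<inter> N) \<union> (?N w \<inter> W)" using nbr_W[OF \<open>w \<in> W\<close>] by auto
      then have "card (?N w) \<le> card (?N w \<inter> N) + card (?N w \<inter> W)" by (metis card_Un_le)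
      ultimately show ?thesis using N3[OF \<open>w \<in> V\<close>] by linarith
    qed
    obtain A where "A \<subseteq> ?N s \<inter> N" "card A = 2" using two[of s] by (meson insertI1 obtain_subset_with_card_n)
    then obtain a b where ab: "a \<noteq> b" "a \<in> ?N s" "b \<in> ?N s" "a \<in> N" "b \<in> N" by (auto simp: card_2_iff)
    obtain B where "B \<subseteq> ?N t \<inter> N" "card B = 2" using two[of t] by (meson insertI1 insertI2 obtain_subset_with_card_n)
    then obtain c d where cd: "c \<noteq> d" "c \<in> ?N t" "d \<in> ?N t" "c \<in> N" "d \<in> N" by (auto simp: card_2_iff)
    have diff: "a \<noteq> c" "a \<noteq> d" "b \<noteq> c" "b \<noteq> d" using not_both ab cd by auto
    have "card {a, b, c, d} = card N" using diff ab(1) cd(1) N4 by simp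
    then have Nabcd: "N = {a, b, c, d}" using NV ab cd by (intro card_subset_eq[symmetric]) auto
    have edges: "{a, s} \<in> E" "{s, b} \<in> E" "{c, t} \<in> E" "{t, d} \<in> E" "{b, y} \<in> E" "{y, c} \<in> E"
      using ab cd y_adj[of b] y_adj[of c] by (simp_all add: nbrs_def insert_commute)
    have "V = {u, a, s, b, y, c, t, d}" unfolding VNW Nabcd W_sty(1) by auto
    moreover have "distinct [u, a, s, b, y, c, t, d]"
      using disj W_sty(2,3) st(2) diff ab(1) cd(1) unfolding Nabcd W_sty(1) by simp blast
    ultimately show ?thesis
      by (rule octagon_supereulerian) (use ab cd edges in \<open>simp_all add: u_nbr\<close>)
  qed
qed

section \<open>Dense graphs without cut edges\<close>

lemma card_edges_within_le:
  assumes "\<And>e. e \<in> E \<Longrightarrow> card e = 2" "finite A"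
  shows "2 * card (edges_within own_ends E A) \<le> card A * (card A - 1)"
proof -
  have "card (edges_within own_ends E A) \<le> card {B. B \<subseteq> A \<and> card B = 2}"
    using assms by (intro card_mono) (auto simp: edges_within_def)
  also have "\<dots> = card A choose 2" using assms(2) by (rule n_subsets)
  finally have "2 * card (edges_within own_ends E A) \<le> 2 * (card A choose 2)" by simp
  also have "\<dots> = card A * (card A - 1)"
  proof -
    have "even (card A * (card A - 1))" by (cases "card A") auto
    then show ?thesis by (simp add: choose_two)
  qed
  finally show ?thesis .
qed

text \<open>
  With only \<open>x \<le> d\<close> vertices in \<open>X\<close>, each of them has at least \<open>d - (x - 1)\<close> edges leaving \<open>X\<close>, and
  \<open>x (d - x + 1) \<ge> d\<close>.
\<close>

lemma small_cut_imp_large_side: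
  assumes mg: "multigraph V E own_ends" and X: "X \<subseteq> V" "X \<noteq> {}"
    and deg: "\<And>v. v \<in> X \<Longrightarrow> d \<le> edge_degree own_ends E v"
    and cut: "card (edge_cut own_ends E X) < d"
  shows "d + 1 \<le> card X"
proof (rule ccontr)
  assume "\<not> ?thesis"
  then have le: "card X \<le> d" by simp
  have fin: "finite V" "finite E" "finite X" using mg X finite_subset by (auto simp: multigraph_def)
  have card2: "card e = 2" if "e \<in> E" for e using mg that by (auto simp: multigraph_def)
  have e_card: "card (e \<inter> X) = (if e \<subseteq> X then 2 else 0) + (if e \<in> edge_cut own_ends E X then 1 else 0)"
    if e: "e \<in> E" for e
  proof -
    obtain a b where ab: "e = {a, b}" "a \<noteq> b" using card2[OF e] by (auto simp: card_2_iff)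
    show ?thesis using ab e by (cases "a \<in> X"; cases "b \<in> X") (simp_all add: edge_cut_def)
  qed
  have "d * card X = (\<Sum>v\<in>X. d)" by simp
  also have "\<dots> \<le> (\<Sum>v\<in>X. edge_degree own_ends E v)" using deg by (intro sum_mono) auto
  also have "\<dots> = (\<Sum>e\<in>E. card (e \<inter> X))" using fin by (intro sum_edge_degree)
  also have "\<dots> = (\<Sum>e\<in>E. (if e \<subseteq> X then 2 else 0) + (if e \<in> edge_cut own_ends E X then 1 else 0))"
    using e_card by (intro sum.cong) auto
  also have "\<dots> = 2 * card (edges_within own_ends E X) + card (edge_cut own_ends E X)"
  proof -
    have "E \<inter> edge_cut own_ends E X = edge_cut own_ends E X" by (auto simp: edge_cut_def)
    moreover have "E \<inter> {e. e \<subseteq> X} = edges_within own_ends E X" by (auto simp: edges_within_def)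
    ultimately show ?thesis using fin by (simp add: sum.distrib sum.If_cases)
  qed
  also have "\<dots> < card X * (card X - 1) + d"
  proof -
    have "2 * card (edges_within own_ends E X) \<le> card X * (card X - 1)"
      by (rule card_edges_within_le[OF card2 fin(3)])
    then show ?thesis using cut by linarith
  qed
  finally have less: "d * card X < card X * (card X - 1) + d" .
  have "card X \<noteq> 0" using X fin by auto
  then obtain j where j: "card X = Suc j" by (cases "card X") auto
  have "Suc j * j \<le> d * j" using le j by (intro mult_le_mono1) simp
  then show False using less unfolding j by simp
qed

lemma sum_mult_Suc_le:
  fixes b :: "'i \<Rightarrow> nat"
  assumes "finite I"
  shows "(\<Sum>i\<in>I. b i * (b i + 1)) \<le> (\<Sum>i\<in>I. b i) * ((\<Sum>i\<in>I. b i) + 1)"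
  using assms
proof (induction I)
  case (insert i I)
  let ?s = "\<Sum>i\<in>I. b i"
  have "(\<Sum>i\<in>insert i I. b i * (b i + 1)) \<le> b i * (b i + 1) + ?s * (?s + 1)"
    using insert by simp
  also have "\<dots> \<le> (b i + ?s) * (b i + ?s + 1)" by (simp add: algebra_simps)
  finally show ?case using insert by simp
qed simp

text \<open>
  By convexity, moving two numbers with a given sum apart as far as the lower bound \<open>d\<close> allows increases
  the sum of their values under \<open>z (z + 1)\<close>.
\<close>

lemma mult_Suc_spread:
  fixes d x y :: nat
  assumes "d \<le> x" "d \<le> y"
  shows "x * (x + 1) + y * (y + 1) \<le> d * (d + 1) + (x + y - d) * (x + y - d + 1)"
proof -
  obtain i j where ij: "x = d + i" "y = d + j" using assms by (metis le_add_diff_inverse)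
  have "x + y - d = d + i + j" using ij by simp
  then show ?thesis unfolding ij by (simp add: algebra_simps)
qed

context graph_partition
begin

lemma quotient_degree:
  assumes A: "A \<in> P"
  shows "edge_degree (blocks_of P) (crossing P E) A = card (edge_cut own_ends E A)"
proof -
  have "{e \<in> crossing P E. A \<in> blocks_of P e} = edge_cut own_ends E A"
  proof (intro subset_antisym subsetI)
    fix e assume "e \<in> {e \<in> crossing P E. A \<in> blocks_of P e}"
    then have e: "e \<in> crossing P E" "A \<in> blocks_of P e" by auto
    have eE: "e \<in> E" using e(1) by (simp add: crossing_def)
    have "card (e \<inter> A) = 1" using card_crossing_Int[OF e(1) A] e(2) by simp
    moreover have "e \<inter> A = e" if "e \<subseteq> A" using that by (rule Int_absorb2)
    ultimately have "\<not> e \<subseteq> A" "e \<inter> A \<noteq> {}" using edge[OF eE] by auto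
    then show "e \<in> edge_cut own_ends E A" using eE by (simp add: edge_cut_def)
  next
    fix e assume "e \<in> edge_cut own_ends E A"
    then have e: "e \<in> E" "e \<inter> A \<noteq> {}" "\<not> e \<subseteq> A" by (auto simp: edge_cut_def)
    have "e \<in> crossing P E"
    proof (rule ccontr)
      assume "e \<notin> crossing P E"
      then obtain B where B: "B \<in> P" "e \<subseteq> B" using not_crossing_edge[OF e(1)] by auto
      obtain v where v: "v \<in> e" "v \<in> A" using e(2) by auto
      then have "A = B" using block_unique[OF A B(1)] B(2) by blast
      then show False using e(3) B(2) by simp
    qed
    moreover have "A \<in> blocks_of P e" using A e(2) by (auto simp: blocks_of_def)
    ultimately show "e \<in> {e \<in> crossing P E. A \<in> blocks_of P e}" by simp
  qed
  then show ?thesis by (simp add: edge_degree_def)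
qed

lemma card_edges_partition:
  "card E = card (crossing P E) + (\<Sum>A\<in>P. card (edges_within own_ends E A))"
proof -
  have "E - crossing P E = (\<Union>A\<in>P. edges_within own_ends E A)"
  proof (intro subset_antisym subsetI)
    fix e assume "e \<in> E - crossing P E"
    then have e: "e \<in> E" "e \<notin> crossing P E" by auto
    obtain A where "A \<in> P" "e \<subseteq> A" using not_crossing_edge[OF e] .
    then show "e \<in> (\<Union>A\<in>P. edges_within own_ends E A)" using e by (auto simp: edges_within_def)
  next
    fix e assume "e \<in> (\<Union>A\<in>P. edges_within own_ends E A)"
    then obtain A where A: "A \<in> P" "e \<in> E" "e \<subseteq> A" by (auto simp: edges_within_def)
    have "e \<notin> crossing P E"
    proof
      assume "e \<in> crossing P E"
      then have "card (e \<inter> A) \<le> 1" using card_crossing_Int A(1) by simp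
      then show False using A(3) edge[OF A(2)] by (simp add: Int_absorb2)
    qed
    then show "e \<in> E - crossing P E" using A(2) by simp
  qed
  moreover have "card (\<Union>A\<in>P. edges_within own_ends E A) = (\<Sum>A\<in>P. card (edges_within own_ends E A))"
  proof (intro card_UN_disjoint finite_P ballI impI)
    show "finite (edges_within own_ends E A)" for A using finite_E by (simp add: edges_within_def)
    show "edges_within own_ends E A \<inter> edges_within own_ends E B = {}" if "A \<in> P" "B \<in> P" "A \<noteq> B" for A B
    proof (rule ccontr)
      assume "\<not> ?thesis"
      then obtain e where e: "e \<in> E" "e \<subseteq> A" "e \<subseteq> B" by (auto simp: edges_within_def)
      then obtain v where "v \<in> e" using edge[of e] by fastforce
      then show False using block_unique[OF that(1,2)] that(3) e by blast
    qed
  qed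
  moreover have "crossing P E \<subseteq> E" by (auto simp: crossing_def)
  then have "card (E - crossing P E) = card E - card (crossing P E)" "card (crossing P E) \<le> card E"
    using finite_E finite_subset by (auto intro: card_Diff_subset card_mono)
  ultimately show ?thesis by simp
qed

text \<open>
  With \<open>b = excess A\<close>, twice the number of pairs in a block \<open>A\<close> is \<open>b (b + 1)\<close>, which is superadditive in
  \<open>b\<close>; the excesses of all blocks add up to the number of vertices minus the number of blocks.
\<close>

definition excess :: "'a set \<Rightarrow> nat" where "excess A = card A - 1"

lemma card_block: "A \<in> P \<Longrightarrow> card A = excess A + 1"
  using block_nonempty finite_block by (simp add: excess_def card_gt_0_iff Suc_leI)

lemma card_V_excess: "card V = card P + (\<Sum>A\<in>P. excess A)"
proof -
  have "V = (\<Union>A\<in>P. A)" using part by (auto simp: partition_on_def)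
  then have "card V = (\<Sum>A\<in>P. card A)"
    using finite_P finite_block block_unique by (simp only:) (rule card_UN_disjoint, auto)
  also have "\<dots> = (\<Sum>A\<in>P. excess A + 1)" using card_block by (intro sum.cong) auto
  finally show ?thesis by (simp only: sum.distrib) simp
qed

lemma card_E_excess: "2 * card E \<le> 2 * card (crossing P E) + (\<Sum>A\<in>P. excess A * (excess A + 1))"
proof -
  have "(\<Sum>A\<in>P. 2 * card (edges_within own_ends E A)) \<le> (\<Sum>A\<in>P. excess A * (excess A + 1))"
  proof (intro sum_mono)
    fix A assume A: "A \<in> P"
    have "2 * card (edges_within own_ends E A) \<le> card A * (card A - 1)"
      using edge finite_block[OF A] by (intro card_edges_within_le) auto
    then show "2 * card (edges_within own_ends E A) \<le> excess A * (excess A + 1)"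
      using card_block[OF A] by (simp add: mult.commute)
  qed
  then show ?thesis unfolding card_edges_partition by (simp add: sum_distrib_left)
qed

lemma quotient_cut_connected:
  assumes conn: "cut_connected own_ends E V"
  shows "cut_connected (blocks_of P) (crossing P E) P"
proof (rule cut_connectedI)
  fix Q assume Q: "Q \<subseteq> P" "Q \<noteq> {}"
    and closed: "\<And>e A B. e \<in> crossing P E \<Longrightarrow> A \<in> blocks_of P e \<Longrightarrow> B \<in> blocks_of P e \<Longrightarrow> A \<in> Q \<Longrightarrow> B \<in> Q"
  have V: "V = \<Union>P" using part by (simp add: partition_on_def)
  have "\<Union>Q = V"
  proof (rule ccontr)
    assume "\<Union>Q \<noteq> V"
    then have "\<Union>Q \<subset> V" unfolding V using Q by auto
    moreover have "\<Union>Q \<noteq> {}" using Q block_nonempty by blast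
    ultimately obtain e a b where e: "e \<in> E" "a \<in> e" "a \<in> \<Union>Q" "b \<in> e" "b \<notin> \<Union>Q"
      using cut_connectedD[OF conn] by metis
    obtain A where A: "A \<in> Q" "a \<in> A" using e(3) by auto
    have "b \<in> V" using e(1,4) edge by auto
    then obtain B where B: "B \<in> P" "b \<in> B" using block_exists by auto
    have "e \<in> crossing P E"
    proof (rule ccontr)
      assume "e \<notin> crossing P E"
      then obtain C where C: "C \<in> P" "e \<subseteq> C" using not_crossing_edge[OF e(1)] by auto
      then have "C = A" using block_unique[OF C(1) subsetD[OF Q(1) A(1)], of a] e(2) A(2) by blast
      then show False using C(2) e(4,5) A(1) by blast
    qed
    moreover have "A \<in> blocks_of P e" "B \<in> blocks_of P e"
      using A B Q(1) e(2,4) by (auto simp: blocks_of_def)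
    ultimately have "B \<in> Q" using closed A(1) by blast
    then show False using B(2) e(5) by blast
  qed
  show "P \<subseteq> Q"
  proof
    fix A assume A: "A \<in> P"
    then obtain v where v: "v \<in> A" using block_nonempty by auto
    then have "v \<in> \<Union>Q" using \<open>\<Union>Q = V\<close> block_subset[OF A] by auto
    then obtain B where "B \<in> Q" "v \<in> B" by auto
    then show "A \<in> Q" using block_unique[OF A, of B v] Q(1) v by auto
  qed
qed

end

context reduced_partition
begin

text \<open>
  Mantel's argument: the neighbourhood \<open>N\<close> of a block of maximal degree \<open>D\<close> is independent, so every edge
  has an end among the \<open>card P - D\<close> other blocks, each of degree at most \<open>D\<close>.
\<close>

lemma quotient_mantel: "\<exists>D\<le>card P. card (crossing P E) \<le> D * (card P - D)"
proof (cases "P = {}")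
  case True
  have "crossing P E = {}"
  proof (rule ccontr)
    assume "crossing P E \<noteq> {}"
    then obtain e where "e \<in> crossing P E" by auto
    then show False using True by (auto simp: crossing_def blocks_of_def)
  qed
  then show ?thesis by (intro exI[of _ 0]) simp
next
  case False
  let ?Q = "crossing P E"
  let ?deg = "edge_degree (blocks_of P) ?Q"
  obtain A where A: "A \<in> P" and max: "\<And>B. B \<in> P \<Longrightarrow> ?deg B \<le> ?deg A"
  proof -
    have "Max (?deg ` P) \<in> ?deg ` P" using finite_P False by (intro Max_in) auto
    then obtain A where "A \<in> P" "?deg A = Max (?deg ` P)" by auto
    then show ?thesis using that[of A] finite_P by simp
  qed
  define N where "N = {B \<in> P. B \<noteq> A \<and> (\<exists>e\<in>?Q. blocks_of P e = {A, B})}"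
  have finQ: "finite ?Q" using finite_E by (simp add: crossing_def)
  have "?deg A \<le> card N"
  proof -
    have "\<exists>B. B \<in> N \<and> blocks_of P e = {A, B}" if e: "e \<in> {e \<in> ?Q. A \<in> blocks_of P e}" for e
    proof -
      have eQ: "e \<in> ?Q" and "A \<in> blocks_of P e" using e by auto
      obtain a b C D where CD: "e = {a, b}" "a \<noteq> b" "a \<in> C" "b \<in> D" "C \<in> P" "D \<in> P" "C \<noteq> D"
        "blocks_of P e = {C, D}" using crossing_edge[OF eQ] .
      have "A = C \<or> A = D" using CD(8) \<open>A \<in> blocks_of P e\<close> by simp
      then show ?thesis
      proof
        assume "A = C"
        then show ?thesis using CD(6-8) eQ by (intro exI[of _ D]) (auto simp: N_def)
      next
        assume "A = D"
        moreover have "{C, D} = {D, C}" by (rule insert_commute)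
        ultimately show ?thesis using CD(5,7,8) eQ by (intro exI[of _ C]) (auto simp: N_def)
      qed
    qed
    then obtain h where h: "\<And>e. e \<in> {e \<in> ?Q. A \<in> blocks_of P e} \<Longrightarrow> h e \<in> N \<and> blocks_of P e = {A, h e}"
      by metis
    have "inj_on h {e \<in> ?Q. A \<in> blocks_of P e}"
    proof (rule inj_onI)
      fix e f assume e: "e \<in> {e \<in> ?Q. A \<in> blocks_of P e}" and f: "f \<in> {e \<in> ?Q. A \<in> blocks_of P e}"
        and "h e = h f"
      then have "blocks_of P e = {A, h e}" "blocks_of P f = {A, h e}" "h e \<in> P" "A \<noteq> h e"
        using h[OF e] h[OF f] by (auto simp: N_def)
      then show "e = f" using quotient_simple[OF A] e f by simp
    qed
    moreover have "h ` {e \<in> ?Q. A \<in> blocks_of P e} \<subseteq> N" using h by auto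
    moreover have "finite N" using finite_P by (simp add: N_def)
    ultimately show ?thesis unfolding edge_degree_def by (rule card_inj_on_le)
  qed
  have NP: "N \<subseteq> P" by (auto simp: N_def)
  have "card ?Q = (\<Sum>e\<in>?Q. 1)" by simp
  also have "\<dots> \<le> (\<Sum>e\<in>?Q. card (blocks_of P e \<inter> (P - N)))"
  proof (intro sum_mono)
    fix e assume eQ: "e \<in> ?Q"
    obtain a b C D where CD: "e = {a, b}" "a \<noteq> b" "a \<in> C" "b \<in> D" "C \<in> P" "D \<in> P" "C \<noteq> D"
      "blocks_of P e = {C, D}" using crossing_edge[OF eQ] .
    have "\<not> (C \<in> N \<and> D \<in> N)"
    proof
      assume CDN: "C \<in> N \<and> D \<in> N"
      then obtain f g where fg: "f \<in> ?Q" "blocks_of P f = {A, C}" "g \<in> ?Q" "blocks_of P g = {A, D}"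
        by (auto simp: N_def)
      have "A \<noteq> C" "A \<noteq> D" using CDN by (auto simp: N_def)
      from quotient_triangle_free[OF this(1) CD(7) this(2) A CD(5,6) fg(1) eQ fg(3,2) CD(8) fg(4)]
      show False .
    qed
    then have "blocks_of P e \<inter> (P - N) \<noteq> {}" using CD(5,6,8) by auto
    moreover have "finite (blocks_of P e)" using CD(8) by simp
    ultimately show "1 \<le> card (blocks_of P e \<inter> (P - N))" by (simp add: Suc_le_eq card_gt_0_iff)
  qed
  also have "\<dots> = (\<Sum>B\<in>P - N. ?deg B)"
    using finite_P finQ by (intro sum_edge_degree[symmetric]) auto
  also have "\<dots> \<le> (\<Sum>B\<in>P - N. card N)"
    using max \<open>?deg A \<le> card N\<close> by (intro sum_mono) (force intro: order_trans)
  also have "\<dots> = card N * (card P - card N)"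
    using NP finite_P by (simp add: card_Diff_subset finite_subset mult.commute)
  finally show ?thesis using card_mono[OF finite_P NP] by (intro exI[of _ "card N"]) simp
qed

text \<open>
  All crossing edges together form a closed trail through the quotient, and it lifts.
\<close>

lemma supereulerian_even_quotient:
  assumes conn: "cut_connected own_ends E V"
    and even: "\<And>A. A \<in> P \<Longrightarrow> even (edge_degree (blocks_of P) (crossing P E) A)"
  shows "supereulerian V E"
proof -
  have V: "\<Union>P = V" using part by (simp add: partition_on_def)
  have "crossing P E \<subseteq> edges_within (blocks_of P) (crossing P E) P"
    by (auto simp: edges_within_def blocks_of_def)
  moreover have "is_join (blocks_of P) (crossing P E) P {A \<in> P. odd (card (A \<inter> {}))}"
    using even by (simp add: is_join_def)
  ultimately have "\<exists>F\<subseteq>edges_within own_ends E (\<Union>P). cut_connected own_ends F (\<Union>P) \<and> is_join own_ends F (\<Union>P) {}"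
    by (intro lift_spanning_join[OF order_refl blocks_collapsible _ quotient_cut_connected[OF conn]]) auto
  then obtain F where F: "F \<subseteq> edges_within own_ends E V \<and> cut_connected own_ends F V \<and> is_join own_ends F V {}"
    unfolding V ..
  have "F \<subseteq> E" using conjunct1[OF F] by (auto simp: edges_within_def)
  then show ?thesis unfolding supereulerian_def using F by (intro exI[of _ F]) simp
qed

end

text \<open>
  In the three counting lemmas \<open>k\<close> is the number of blocks, \<open>s\<close> the sum of their excesses and \<open>q\<close> the
  number of crossing edges; \<open>k + s\<close> is the number of vertices.  For minimum degree 2 and 3, all
  excess may sit in one block.
\<close>

lemma count_min_degree_two:
  fixes k s q :: nat
  assumes "5 \<le> k" "8 \<le> k + s" "q + 3 \<le> 2 * k"
    and le: "8 + (k + s - 3) * (k + s - 4) \<le> 2 * q + s * (s + 1)"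
  shows False
proof -
  obtain j where j: "k = 5 + j" using assms(1) le_Suc_ex by blast
  have "k + s - 3 = s + j + 2" "k + s - 4 = s + j + 1" using j by simp_all
  then have "8 + (s + j + 2) * (s + j + 1) \<le> 2 * q + s * (s + 1)" using le by simp
  then have "8 + (s + j + 2) * (s + j + 1) \<le> 14 + 4 * j + s * (s + 1)" using assms(3) j by simp
  then have main: "2 * (s * j) + j * j + 2 * s \<le> 4 + j" by (simp add: algebra_simps)
  have sj: "3 \<le> s + j" using assms(2) j by simp
  consider "s = 0" | "s = 1" | "s = 2" | "3 \<le> s" by linarith
  then show False
  proof cases
    case 1
    then have "3 * j \<le> j * j" using sj by (intro mult_le_mono1) simp
    moreover have "j * j \<le> 4 + j" "3 \<le> j" using main sj 1 by simp_all
    ultimately show False by linarith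
  next
    case 2
    then have "2 * j \<le> j * j" using sj by (intro mult_le_mono1) simp
    moreover have "2 * j + j * j + 2 \<le> 4 + j" "2 \<le> j" using main sj 2 by simp_all
    ultimately show False by linarith
  next
    case 3
    then have "1 * j \<le> j * j" using sj by (intro mult_le_mono1) simp
    moreover have "4 * j + j * j + 4 \<le> 4 + j" "1 \<le> j" using main sj 3 by simp_all
    ultimately show False by linarith
  next
    case 4
    then have "3 * j \<le> s * j" by (intro mult_le_mono1)
    then show False using main 4 by linarith
  qed
qed

lemma count_min_degree_three:
  fixes k s q :: nat
  assumes "6 \<le> k" "8 \<le> k + s" "q + 3 \<le> 2 * k"
    and le: "14 + (k + s - 4) * (k + s - 5) \<le> 2 * q + s * (s + 1)"
  shows "k = 8 \<and> s = 0 \<and> q = 13"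
proof -
  obtain j where j: "k = 6 + j" using assms(1) le_Suc_ex by blast
  have "k + s - 4 = s + j + 2" "k + s - 5 = s + j + 1" using j by simp_all
  then have le': "14 + (s + j + 2) * (s + j + 1) \<le> 2 * q + s * (s + 1)" using le by simp
  then have "14 + (s + j + 2) * (s + j + 1) \<le> 18 + 4 * j + s * (s + 1)" using assms(3) j by simp
  then have main: "2 * (s * j) + j * j + 2 * s \<le> 2 + j" by (simp add: algebra_simps)
  have sj: "2 \<le> s + j" using assms(2) j by simp
  have "s = 0"
  proof (rule ccontr)
    assume "s \<noteq> 0"
    then have "1 * j \<le> s * j" by (intro mult_le_mono1) simp
    then have "s + j < 2 \<or> (s = 1 \<and> j = 0)" using main \<open>s \<noteq> 0\<close> by linarith
    then show False using sj by simp
  qed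
  moreover have "j = 2"
  proof (rule ccontr)
    assume "j \<noteq> 2"
    then have "3 \<le> j" using sj \<open>s = 0\<close> by simp
    then have "3 * j \<le> j * j" by (intro mult_le_mono1)
    moreover have "j * j \<le> 2 + j" using main \<open>s = 0\<close> by simp
    ultimately show False using \<open>3 \<le> j\<close> by linarith
  qed
  ultimately show ?thesis using le' j assms(3) by simp
qed

text \<open>
  For minimum degree \<open>d \<ge> 4\<close>, two blocks have excess at least \<open>d\<close>, and the number of pairs within
  blocks is largest if one block has excess exactly \<open>d\<close> and all remaining excess is in the other.
\<close>

lemma count_two_large_parts:
  fixes k s q d :: nat
  assumes "2 \<le> d" "3 \<le> k" "q + 3 \<le> 2 * k" "2 * d \<le> s"
    and le: "(k + s - d - 1) * (k + s - d - 2) + 2 \<le> 2 * q + (s - d) * (s - d + 1)"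
  shows False
proof -
  obtain j where j: "k = 3 + j" using assms(2) le_Suc_ex by blast
  obtain y where y: "s = d + y" using assms(4) by (metis le_add_diff_inverse le_add1 mult_2 order_trans)
  have y2: "2 \<le> y" using assms(1,4) y by simp
  have "k + s - d - 1 = y + j + 2" "k + s - d - 2 = y + j + 1" "s - d = y" using j y by simp_all
  then have "(y + j + 2) * (y + j + 1) + 2 \<le> 2 * q + y * (y + 1)" using le by simp
  then have "(y + j + 2) * (y + j + 1) + 2 \<le> 6 + 4 * j + y * (y + 1)" using assms(3) j by simp
  then have main: "2 * (y * j) + j * j + 2 * y \<le> 2 + j" by (simp add: algebra_simps)
  have "2 * j \<le> y * j" using y2 by (intro mult_le_mono1)
  then show False using main y2 by linarith
qed

text \<open>
  Catlin's reduction.  Sparsity and triangle-freeness exclude quotients with 2 or 3 blocks, and leave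
  only the 4-cycle, which is its own closed trail, for 4 blocks.  With more blocks the number of edges is
  too small.  For \<open>d \<le> 3\<close> this follows from sparsity alone, apart from one borderline case with five
  blocks, in which the Mantel bound saves the missing edge, and one with eight singleton blocks.  For
  \<open>d \<ge> 4\<close> at least two blocks have degree at most 3 and are therefore large.
\<close>

theorem dense_supereulerian:
  fixes V :: "'a set" and d n :: nat
  assumes mg: "multigraph V E own_ends" and n: "card V = n" and d: "2 \<le> d" "2 * d + 2 \<le> n" "8 \<le> n"
    and deg: "\<And>v. v \<in> V \<Longrightarrow> d \<le> edge_degree own_ends E v"
    and cut: "\<And>X. X \<subset> V \<Longrightarrow> X \<noteq> {} \<Longrightarrow> 2 \<le> card (edge_cut own_ends E X)"
    and edges: "d * (d + 1) + (n - d - 1) * (n - d - 2) + 2 \<le> 2 * card E"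
  shows "supereulerian V E"
proof -
  have conn: "cut_connected own_ends E V"
    unfolding cut_connected_def using cut by (metis card.empty not_numeral_le_zero)
  obtain P where P: "partition_on V P \<and> (\<forall>A\<in>P. collapsible E A) \<and>
    (\<forall>S\<subseteq>P. card S \<ge> 2 \<longrightarrow> \<not> collapsible E (\<Union>S))"
    using maximal_collapsible_partition[OF mg] ..
  interpret reduced_partition V E P
    using mg P by unfold_locales auto
  let ?Q = "crossing P E"
  let ?deg = "edge_degree (blocks_of P) ?Q"
  define k where "k = card P"
  define q where "q = card ?Q"
  define s where "s = (\<Sum>A\<in>P. excess A)"
  have n_eq: "n = k + s" using card_V_excess n by (simp add: k_def s_def)
  have E_le: "2 * card E \<le> 2 * q + s * (s + 1)"
    using card_E_excess sum_mult_Suc_le[OF finite_P, of excess] unfolding q_def s_def by linarith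
  have V_eq: "\<Union>P = V" using part by (simp add: partition_on_def)
  have "V \<noteq> {}" using n d by auto
  then have "P \<noteq> {}" using V_eq by auto
  then have "k \<noteq> 0" using finite_P by (simp add: k_def)
  then consider "k = 1" | "2 \<le> k" by linarith
  then show ?thesis
  proof cases
    case 1
    then obtain A where "P = {A}" unfolding k_def by (rule card_1_singletonE)
    then have "collapsible E V" using blocks_collapsible[of A] V_eq by simp
    then have "\<exists>F\<subseteq>edges_within own_ends E V. cut_connected own_ends F V \<and> is_join own_ends F V {}"
      unfolding collapsible_def by (elim allE[of _ "{}"]) simp
    then obtain F where F: "F \<subseteq> edges_within own_ends E V \<and> cut_connected own_ends F V \<and> is_join own_ends F V {}" ..
    have "F \<subseteq> E" using conjunct1[OF F] by (auto simp: edges_within_def)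
    then show ?thesis unfolding supereulerian_def using F by (intro exI[of _ F]) simp
  next
    case 2
    have handshakeP: "(\<Sum>A\<in>P. ?deg A) = 2 * q"
      unfolding q_def by (rule handshake[OF multigraph_crossing])
    have deg2: "2 \<le> ?deg A" if A: "A \<in> P" for A
    proof -
      have "A \<noteq> V"
      proof
        assume "A = V"
        have "P \<subseteq> {A}"
        proof
          fix B assume B: "B \<in> P"
          obtain v where "v \<in> B" using block_nonempty[OF B] by auto
          moreover from this have "v \<in> A" using block_subset[OF B] \<open>A = V\<close> by auto
          ultimately show "B \<in> {A}" using block_unique[OF B A] by simp
        qed
        then have "card P \<le> card {A}" by (intro card_mono) auto
        then show False using 2 by (simp add: k_def)
      qed
      then have "A \<subset> V" using block_subset[OF A] by auto
      then show ?thesis unfolding quotient_degree[OF A] using cut block_nonempty[OF A] by simp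
    qed
    have "(\<Sum>A\<in>P. 2) \<le> (\<Sum>A\<in>P. ?deg A)" using deg2 by (intro sum_mono)
    then have k_le: "k \<le> q" using handshakeP by (simp add: k_def)
    have sparse: "q + 3 \<le> 2 * k"
    proof -
      have "edges_within (blocks_of P) ?Q P = ?Q" by (auto simp: edges_within_def blocks_of_def)
      then show ?thesis using quotient_sparse[OF order_refl] 2 unfolding k_def q_def by simp
    qed
    obtain D where D: "D \<le> k" "q \<le> D * (k - D)"
      using quotient_mantel unfolding k_def q_def by auto
    have q_small: "q \<le> 2 \<or> k \<noteq> 3" "q \<le> 4 \<or> k \<noteq> 4" "q \<le> 6 \<or> k \<noteq> 5"
    proof -
      have "D = 0 \<or> D = 1 \<or> D = 2 \<or> D = 3 \<or> D = 4 \<or> D = 5" if "k \<le> 5" using D(1) that by linarith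
      then show "q \<le> 2 \<or> k \<noteq> 3" "q \<le> 4 \<or> k \<noteq> 4" "q \<le> 6 \<or> k \<noteq> 5"
        using D by (cases "k \<le> 5"; auto)+
    qed
    have k4: "4 \<le> k" using 2 k_le sparse q_small(1) by linarith
    show ?thesis
    proof (cases "k = 4")
      case True
      then have "q = 4" using q_small(2) k_le by simp
      have "?deg A = 2" if A: "A \<in> P" for A
      proof (rule ccontr)
        assume "?deg A \<noteq> 2"
        then have "(\<Sum>A\<in>P. 2) < (\<Sum>A\<in>P. ?deg A)"
          using deg2 A finite_P by (intro sum_strict_mono_ex1) (auto simp: le_neq_implies_less intro!: bexI[of _ A])
        then show False using handshakeP \<open>q = 4\<close> True by (simp add: k_def)
      qed
      then show ?thesis by (intro supereulerian_even_quotient[OF conn]) simp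
    next
      case False
      then have k5: "5 \<le> k" using k4 by simp
      consider "d = 2" | "d = 3" | "4 \<le> d" using d by linarith
      then show ?thesis
      proof cases
        case 1
        have "8 + (k + s - 3) * (k + s - 4) \<le> 2 * q + s * (s + 1)"
          using edges E_le unfolding n_eq 1 by simp
        then have False using count_min_degree_two[OF k5 _ sparse] d n_eq by simp
        then show ?thesis ..
      next
        case 2
        have le: "14 + (k + s - 4) * (k + s - 5) \<le> 2 * q + s * (s + 1)"
          using edges E_le unfolding n_eq 2 by simp
        have "k \<noteq> 5"
        proof
          assume "k = 5"
          then show False using le q_small(3) by (simp add: algebra_simps)
        qed
        then have ex: "k = 8" "s = 0" "q = 13"
          using count_min_degree_three[OF _ _ sparse le] k5 d n_eq by auto
        have single: "A = {v}" if "A \<in> P" "v \<in> A" for A v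
        proof -
          have "excess A = 0" using ex(2) that(1) finite_P by (simp add: s_def)
          then have "card A = 1" using card_block[OF that(1)] by simp
          then show ?thesis using that(2) by (auto simp: card_1_singleton_iff)
        qed
        have single_P: "{v} \<in> P" if "v \<in> V" for v
          using block_exists[OF that] single by auto
        have cross: "e \<in> ?Q" "blocks_of P e = (\<lambda>v. {v}) ` e" if "e \<in> E" for e
        proof -
          show blocks: "blocks_of P e = (\<lambda>v. {v}) ` e"
          proof (intro subset_antisym subsetI)
            fix A assume "A \<in> blocks_of P e"
            then obtain v where "A \<in> P" "v \<in> A" "v \<in> e" by (auto simp: blocks_of_def)
            then show "A \<in> (\<lambda>v. {v}) ` e" using single by auto
          next
            fix A assume "A \<in> (\<lambda>v. {v}) ` e"
            then show "A \<in> blocks_of P e" using single_P edge[OF that] by (auto simp: blocks_of_def)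
          qed
          then show "e \<in> ?Q" using that edge[OF that] by (simp add: crossing_def card_image)
        qed
        have "E = ?Q" using cross(1) by (auto simp: crossing_def)
        then have cardE: "card E = 13" using ex(3) by (simp add: q_def)
        show ?thesis
        proof (rule eight_vertices_supereulerian[OF mg _ cardE])
          show "card V = 8" using n n_eq ex by simp
          show "3 \<le> edge_degree own_ends E v" if "v \<in> V" for v using deg[OF that] 2 by simp
          fix x y z assume xyz: "{x, y} \<in> E" "{y, z} \<in> E" "{x, z} \<in> E"
          have ne: "{x} \<noteq> {y}" "{y} \<noteq> {z}" "{x} \<noteq> {z}"
            using edge[OF xyz(1)] edge[OF xyz(2)] edge[OF xyz(3)] by auto
          have inP: "{x} \<in> P" "{y} \<in> P" "{z} \<in> P" using single_P edge[OF xyz(1)] edge[OF xyz(2)] by auto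
          have "blocks_of P {x, y} = {{x}, {y}}" "blocks_of P {y, z} = {{y}, {z}}"
            "blocks_of P {x, z} = {{x}, {z}}"
            using cross(2)[OF xyz(1)] cross(2)[OF xyz(2)] cross(2)[OF xyz(3)] by simp_all
          from quotient_triangle_free[OF ne inP cross(1)[OF xyz(1)] cross(1)[OF xyz(2)] cross(1)[OF xyz(3)] this]
          show False .
        qed
      next
        case 3
        \<comment> \<open>Degrees are at least 2 and average below 4, so many are at most 3.\<close>
        define L where "L = {A \<in> P. ?deg A \<le> 3}"
        have L: "L \<subseteq> P" "finite L" using finite_P by (auto simp: L_def)
        have "(\<Sum>A\<in>P. if A \<in> L then 2 else 4) \<le> (\<Sum>A\<in>P. ?deg A)"
          using deg2 by (intro sum_mono) (auto simp: L_def)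
        moreover have "(\<Sum>A\<in>P. if A \<in> L then 2 else 4) = 2 * card L + 4 * (k - card L)"
        proof -
          have "P \<inter> {A. A \<in> L} = L" "P \<inter> - {A. A \<in> L} = P - L" using L by auto
          then show ?thesis using finite_P L by (simp add: sum.If_cases card_Diff_subset k_def)
        qed
        moreover have "card L \<le> k" using card_mono[OF finite_P L(1)] by (simp add: k_def)
        ultimately have "2 \<le> card L" using handshakeP sparse by linarith
        then obtain T where "T \<subseteq> L" "card T = 2" by (meson obtain_subset_with_card_n)
        then obtain A B where AB: "A \<in> L" "B \<in> L" "A \<noteq> B" by (auto simp: card_2_iff)
        have large: "d \<le> excess C" if C: "C \<in> L" for C
        proof -
          have CP: "C \<in> P" "card (edge_cut own_ends E C) \<le> 3"
            using C quotient_degree by (auto simp: L_def)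
          have "d + 1 \<le> card C"
          proof (rule small_cut_imp_large_side[OF mg block_subset[OF CP(1)] block_nonempty[OF CP(1)]])
            show "d \<le> edge_degree own_ends E v" if "v \<in> C" for v
              using deg that block_subset[OF CP(1)] by auto
            show "card (edge_cut own_ends E C) < d" using CP(2) 3 by simp
          qed
          then show ?thesis using card_block[OF CP(1)] by simp
        qed
        have AP: "A \<in> P" using AB L by auto
        define y where "y = (\<Sum>C\<in>P - {A}. excess C)"
        have s_split: "s = excess A + y" unfolding s_def y_def using finite_P AP by (rule sum.remove)
        have "excess B \<le> y" unfolding y_def using finite_P AB L by (intro member_le_sum) auto
        then have y: "d \<le> y" using large[OF AB(2)] by simp
        have "(\<Sum>C\<in>P. excess C * (excess C + 1))
            = excess A * (excess A + 1) + (\<Sum>C\<in>P - {A}. excess C * (excess C + 1))"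
          using finite_P AP by (rule sum.remove)
        also have "\<dots> \<le> excess A * (excess A + 1) + y * (y + 1)"
          unfolding y_def using finite_P by (intro add_left_mono sum_mult_Suc_le) simp
        also have "\<dots> \<le> d * (d + 1) + (s - d) * (s - d + 1)"
          unfolding s_split by (rule mult_Suc_spread[OF large[OF AB(1)] y])
        finally have "2 * card E \<le> 2 * q + (d * (d + 1) + (s - d) * (s - d + 1))"
          using card_E_excess unfolding q_def by linarith
        then have "(k + s - d - 1) * (k + s - d - 2) + 2 \<le> 2 * q + (s - d) * (s - d + 1)"
          using edges unfolding n_eq by linarith
        moreover have "2 * d \<le> s" using s_split large[OF AB(1)] y by simp
        ultimately have False using count_two_large_parts[OF d(1) _ sparse] k5 by simp
        then show ?thesis ..
      qed
    qed
  qed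
qed

section \<open>Dense graphs with a cut edge\<close>

text \<open>
  Both sides of the cut edge have at least \<open>d + 1\<close> vertices.  Unless the smaller one has exactly this
  size, convexity of \<open>z (z - 1)\<close> bounds the number of edges strictly below the assumed one; if it has
  this size, the assumed number is attained only if both sides are complete.
\<close>

theorem dense_cut_edge_structure:
  fixes V :: "'a set" and d n :: nat
  assumes mg: "multigraph V E own_ends" and n: "card V = n" and d: "2 \<le> d"
    and deg: "\<And>v. v \<in> V \<Longrightarrow> d \<le> edge_degree own_ends E v"
    and X: "X \<subset> V" "X \<noteq> {}" and cut: "card (edge_cut own_ends E X) = 1"
    and edges: "d * (d + 1) + (n - d - 1) * (n - d - 2) + 2 \<le> 2 * card E"
  shows "\<exists>A x y. A \<subseteq> V \<and> card A = d + 1 \<and> x \<in> A \<and> y \<in> V - A \<and>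
    E = {e. e \<subseteq> A \<and> card e = 2} \<union> {e. e \<subseteq> V - A \<and> card e = 2} \<union> {{x, y}}"
proof -
  have fin: "finite V" "finite E" and edge: "\<And>e. e \<in> E \<Longrightarrow> e \<subseteq> V \<and> card e = 2"
    using mg by (auto simp: multigraph_def)
  let ?W = "edges_within own_ends E"
  have cut_compl: "edge_cut own_ends E (V - X) = edge_cut own_ends E X"
    using edge X(1) by (auto simp: edge_cut_def)
  have "\<exists>A. A \<subset> V \<and> A \<noteq> {} \<and> card (edge_cut own_ends E A) = 1 \<and>
    card (edge_cut own_ends E (V - A)) = 1 \<and> card A \<le> card (V - A)"
  proof (cases "card X \<le> card (V - X)")
    case True
    then show ?thesis using X cut cut_compl by (intro exI[of _ X]) simp
  next
    case False
    have "V - (V - X) = X" using X by auto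
    then show ?thesis using X cut cut_compl False by (intro exI[of _ "V - X"]) auto
  qed
  then obtain A where A: "A \<subset> V \<and> A \<noteq> {} \<and> card (edge_cut own_ends E A) = 1 \<and>
    card (edge_cut own_ends E (V - A)) = 1 \<and> card A \<le> card (V - A)" ..
  let ?B = "V - A"
  have sub: "A \<subseteq> V" "A \<noteq> {}" "?B \<subseteq> V" "?B \<noteq> {}" and finA: "finite A" "finite ?B"
    using A fin finite_subset by auto
  have cardA: "d + 1 \<le> card A" and "d + 1 \<le> card ?B"
    using small_cut_imp_large_side[OF mg sub(1,2), of d] small_cut_imp_large_side[OF mg sub(3,4), of d]
      deg sub A d by auto
  have n_eq: "n = card A + card ?B"
    using card_Diff_subset[OF finA(1) sub(1)] card_mono[OF fin(1) sub(1)] n by simp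
  obtain e0 where e0: "edge_cut own_ends E A = {e0}" using A by (auto simp: card_1_singleton_iff)
  have e0E: "e0 \<in> E" "e0 \<inter> A \<noteq> {}" "\<not> e0 \<subseteq> A" using e0 by (auto simp: edge_cut_def set_eq_iff)
  have E_split: "E = ?W A \<union> ?W ?B \<union> {e0}"
    unfolding e0[symmetric] using edge by (auto simp: edges_within_def edge_cut_def)
  have finW: "finite (?W Y)" for Y using fin by (simp add: edges_within_def)
  have "card E \<le> card (?W A) + card (?W ?B) + 1"
  proof -
    have "card E \<le> card (?W A \<union> ?W ?B) + card {e0}" by (subst E_split) (rule card_Un_le)
    also have "card (?W A \<union> ?W ?B) \<le> card (?W A) + card (?W ?B)" by (rule card_Un_le)
    finally show ?thesis by simp
  qed
  moreover have WA: "2 * card (?W A) \<le> card A * (card A - 1)"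
    using edge finA by (intro card_edges_within_le) auto
  moreover have WB: "2 * card (?W ?B) \<le> card ?B * (card ?B - 1)"
    using edge finA by (intro card_edges_within_le) auto
  ultimately have E_le: "2 * card E \<le> card A * (card A - 1) + card ?B * (card ?B - 1) + 2" by linarith
  have card_eq: "card A = d + 1"
  proof (rule ccontr)
    assume "card A \<noteq> d + 1"
    then obtain p where p: "card A = d + 2 + p" using cardA by (metis Suc_leI add_2_eq_Suc' add_Suc_right Suc_eq_plus1 le_Suc_ex le_neq_implies_less add_Suc)
    obtain j where j: "card ?B = d + 2 + p + j" using A p by (metis le_Suc_ex)
    have "n - d - 1 = d + 3 + 2 * p + j" "n - d - 2 = d + 2 + 2 * p + j" using n_eq p j by simp_all
    then have "d * (d + 1) + (d + 3 + 2 * p + j) * (d + 2 + 2 * p + j)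
        \<le> (d + 2 + p) * (d + 1 + p) + (d + 2 + p + j) * (d + 1 + p + j)"
      using edges E_le p j by simp
    then show False by (simp add: algebra_simps)
  qed
  have B_eq: "card ?B = n - d - 1" using n_eq card_eq by simp
  have full: "card A * (card A - 1) + card ?B * (card ?B - 1) + 2 \<le> 2 * card E"
  proof -
    have "n - d - 2 = card ?B - 1" using B_eq by simp
    then show ?thesis using edges unfolding card_eq B_eq by (simp add: mult.commute)
  qed
  have complete: "?W Y = {e. e \<subseteq> Y \<and> card e = 2}"
    if "finite Y" "card Y * (card Y - 1) \<le> 2 * card (?W Y)" for Y
  proof (rule card_subset_eq)
    show fin2: "finite {e. e \<subseteq> Y \<and> card e = 2}" using that(1) by simp
    show sub2: "?W Y \<subseteq> {e. e \<subseteq> Y \<and> card e = 2}" using edge by (auto simp: edges_within_def)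
    have "card {e. e \<subseteq> Y \<and> card e = 2} = card Y choose 2" using that(1) by (rule n_subsets)
    then have "card {e. e \<subseteq> Y \<and> card e = 2} \<le> card (?W Y)"
      using that(2) by (simp add: choose_two)
    then show "card (?W Y) = card {e. e \<subseteq> Y \<and> card e = 2}"
      using card_mono[OF fin2 sub2] by simp
  qed
  have "?W A = {e. e \<subseteq> A \<and> card e = 2}"
    using full WA WB \<open>card E \<le> card (?W A) + card (?W ?B) + 1\<close> by (intro complete finA) linarith
  moreover have "?W ?B = {e. e \<subseteq> ?B \<and> card e = 2}"
    using full WA WB \<open>card E \<le> card (?W A) + card (?W ?B) + 1\<close> by (intro complete finA) linarith
  moreover obtain x where x: "x \<in> e0" "x \<in> A" using e0E by auto
  moreover obtain y where y: "y \<in> e0" "y \<notin> A" using e0E by auto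
  moreover have "e0 = {x, y}"
    using edge[OF e0E(1)] x y by (auto simp: card_2_iff)
  moreover have "y \<in> ?B" using edge[OF e0E(1)] y by auto
  ultimately show ?thesis
    using E_split card_eq sub(1) by (intro exI[of _ A] exI[of _ x] exI[of _ y] conjI) auto
qed

section \<open>The spectral radius and the number of edges\<close>

text \<open>
  First-order condition at a minimum: the quadratic polynomial vanishes at \<open>t = 0\<close>, so a nonzero linear
  term would make it negative nearby.
\<close>

lemma linear_term_zero:
  fixes b c :: real
  assumes "\<And>t. 0 \<le> 2 * t * b + t\<^sup>2 * c"
  shows "b = 0"
proof (rule ccontr)
  assume "b \<noteq> 0"
  define s where "s = \<bar>c\<bar> + 1"
  have s: "s > 0" "c < s" by (auto simp: s_def)
  \<comment> \<open>The step \<open>- b / s\<close> is short enough for any sign of \<open>c\<close>.\<close>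
  have "0 \<le> 2 * (- b / s) * b + (- b / s)\<^sup>2 * c" by (rule assms)
  also have "\<dots> = b\<^sup>2 / s * (c / s - 2)" using s by (simp add: field_simps power2_eq_square)
  also have "\<dots> < 0" using s \<open>b \<noteq> 0\<close> by (intro mult_pos_neg) (auto simp: field_simps)
  finally show False by simp
qed

definition quad :: "'a set \<Rightarrow> ('a \<Rightarrow> 'a \<Rightarrow> real) \<Rightarrow> ('a \<Rightarrow> real) \<Rightarrow> real" where
  "quad V m f = (\<Sum>u\<in>V. \<Sum>v\<in>V. m u v * f u * f v)"

lemma quad_scale: "quad V m (\<lambda>v. c * f v) = c\<^sup>2 * quad V m f"
  by (simp add: quad_def sum_distrib_left power2_eq_square mult_ac)

lemma quad_perturb:
  assumes sym: "\<And>u v. m u v = m v u"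
  shows "quad V m (\<lambda>v. x v + t * h v) =
    quad V m x + 2 * t * (\<Sum>u\<in>V. \<Sum>v\<in>V. m u v * x v * h u) + t\<^sup>2 * quad V m h"
proof -
  have "quad V m (\<lambda>v. x v + t * h v) = (\<Sum>u\<in>V. \<Sum>v\<in>V.
      m u v * x u * x v + t * (m u v * x v * h u) + t * (m u v * x u * h v) + t\<^sup>2 * (m u v * h u * h v))"
    unfolding quad_def by (intro sum.cong refl) (simp add: algebra_simps power2_eq_square)
  also have "\<dots> = quad V m x + t * (\<Sum>u\<in>V. \<Sum>v\<in>V. m u v * x v * h u)
      + t * (\<Sum>u\<in>V. \<Sum>v\<in>V. m u v * x u * h v) + t\<^sup>2 * quad V m h"
    by (simp add: sum.distrib sum_distrib_left quad_def)
  also have "(\<Sum>u\<in>V. \<Sum>v\<in>V. m u v * x u * h v) = (\<Sum>u\<in>V. \<Sum>v\<in>V. m u v * x v * h u)"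
    by (subst sum.swap) (simp add: sym)
  finally show ?thesis by simp
qed

text \<open>
  A maximizer of the quadratic form on the nonnegative part of the unit sphere, which exists by
  compactness.  It maximizes over the whole sphere too, since replacing a vector by its absolute values
  does not decrease the form; being a maximizer of the Rayleigh quotient, it is an eigenvector.
\<close>

lemma perron_vector_exists:
  fixes m :: "'a \<Rightarrow> 'a \<Rightarrow> real"
  assumes fin: "finite V" and ne: "V \<noteq> {}" and sym: "\<And>u v. m u v = m v u"
    and nonneg: "\<And>u v. 0 \<le> m u v"
  shows "\<exists>r x. (\<forall>v\<in>V. 0 \<le> x v) \<and> (\<exists>v\<in>V. x v \<noteq> 0) \<and> (\<forall>v\<in>V. (\<Sum>w\<in>V. m v w * x w) = r * x v) \<and>
    (\<forall>f. quad V m f \<le> r * (\<Sum>v\<in>V. (f v)\<^sup>2))"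
proof -
  define K where "K = {x::'a \<Rightarrow> real. (\<forall>v. x v \<in> (if v \<in> V then {0..1} else {0})) \<and> (\<Sum>v\<in>V. (x v)\<^sup>2) = 1}"
  have cont_coord: "continuous_on UNIV (\<lambda>x::'a \<Rightarrow> real. x v)" for v
    by (rule continuous_on_product_coordinates)
  have "compact K"
  proof -
    have "compactin (product_topology (\<lambda>_. euclidean) UNIV)
        (PiE UNIV (\<lambda>v. if v \<in> V then {0..1::real} else {0}))"
      by (subst compactin_PiE) auto
    then have c: "compact (PiE UNIV (\<lambda>v. if v \<in> V then {0..1::real} else {0}))"
      by (simp only: euclidean_product_topology compactin_euclidean_iff)
    have "closed {x::'a \<Rightarrow> real. (\<Sum>v\<in>V. (x v)\<^sup>2) = 1}"
      by (intro closed_Collect_eq continuous_intros cont_coord)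
    from compact_Int_closed[OF c this] show ?thesis
      unfolding K_def by (simp add: PiE_def Pi_def Int_def)
  qed
  moreover obtain v0 where v0: "v0 \<in> V" using ne by auto
  have "(\<lambda>v. if v = v0 then 1 else 0) \<in> K"
    unfolding K_def using fin v0 by (auto simp: if_distrib[of "\<lambda>z. z\<^sup>2"] cong: if_cong)
  then have "K \<noteq> {}" by auto
  moreover have "continuous_on K (quad V m)"
  proof -
    have "continuous_on UNIV (\<lambda>f. quad V m f)"
      unfolding quad_def by (intro continuous_intros cont_coord)
    then show ?thesis using continuous_on_subset by blast
  qed
  ultimately obtain x where xK: "x \<in> K" and max: "\<forall>y\<in>K. quad V m y \<le> quad V m x"
    using continuous_attains_sup by blast
  define r where "r = quad V m x"
  have x_nonneg: "0 \<le> x v" for v using xK unfolding K_def by (auto split: if_splits dest: spec[of _ v])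
  have x_norm: "(\<Sum>v\<in>V. (x v)\<^sup>2) = 1" using xK unfolding K_def by auto
  have rayleigh: "quad V m f \<le> r * (\<Sum>v\<in>V. (f v)\<^sup>2)" for f
  proof (cases "(\<Sum>v\<in>V. (f v)\<^sup>2) = 0")
    case True
    then have "\<forall>v\<in>V. f v = 0" using fin by (simp add: sum_nonneg_eq_0_iff)
    then show ?thesis using True by (simp add: quad_def)
  next
    case False
    define s where "s = (\<Sum>v\<in>V. (f v)\<^sup>2)"
    have "s \<ge> 0" unfolding s_def by (intro sum_nonneg) simp
    then have s: "s > 0" using False by (simp add: s_def)
    define g where "g v = (if v \<in> V then \<bar>f v\<bar> / sqrt s else 0)" for v
    have sum_g: "(\<Sum>v\<in>V. (g v)\<^sup>2) = 1"
    proof -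
      have "(\<Sum>v\<in>V. (g v)\<^sup>2) = (\<Sum>v\<in>V. (f v)\<^sup>2 / s)"
        using s by (intro sum.cong) (auto simp: g_def power_divide)
      also have "\<dots> = (\<Sum>v\<in>V. (f v)\<^sup>2) / s" by (rule sum_divide_distrib[symmetric])
      finally show ?thesis using s unfolding s_def[symmetric] by simp
    qed
    have "g v \<le> 1" if "v \<in> V" for v
    proof -
      have "(g v)\<^sup>2 \<le> (\<Sum>v\<in>V. (g v)\<^sup>2)" using fin that by (intro member_le_sum) auto
      then have "(g v)\<^sup>2 \<le> 1\<^sup>2" using sum_g by simp
      then show ?thesis by (rule power2_le_imp_le) simp
    qed
    moreover have "g v \<ge> 0" for v using s by (simp add: g_def)
    moreover have "g v = 0" if "v \<notin> V" for v using that by (simp add: g_def)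
    ultimately have "g \<in> K" unfolding K_def using sum_g by auto
    then have "quad V m g \<le> r" using max by (simp add: r_def)
    then have "s * quad V m g \<le> r * s" using s by simp
    moreover have "quad V m f \<le> s * quad V m g"
    proof -
      have "s * quad V m g = quad V m (\<lambda>v. sqrt s * g v)" using s by (simp add: quad_scale)
      also have "\<dots> = quad V m (\<lambda>v. \<bar>f v\<bar>)"
        unfolding quad_def using s by (intro sum.cong refl) (simp add: g_def)
      also have "\<dots> \<ge> quad V m f"
        unfolding quad_def
      proof (intro sum_mono)
        fix u v
        have "m u v * (f u * f v) \<le> m u v * (\<bar>f u\<bar> * \<bar>f v\<bar>)"
          by (intro mult_left_mono nonneg) (metis abs_ge_self abs_mult)
        then show "m u v * f u * f v \<le> m u v * \<bar>f u\<bar> * \<bar>f v\<bar>" by (simp add: mult.assoc)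
      qed
      finally show ?thesis .
    qed
    ultimately show ?thesis by (simp add: s_def)
  qed
  have "(\<Sum>w\<in>V. m v w * x w) = r * x v" if v: "v \<in> V" for v
  proof -
    \<comment> \<open>\<open>M = r I - m\<close> is positive semidefinite and its form vanishes at \<open>x\<close>.\<close>
    define M where "M u w = (if u = w then r else 0) - m u w" for u w
    have symM: "M u w = M w u" for u w using sym by (simp add: M_def)
    have quadM: "quad V M f = r * (\<Sum>v\<in>V. (f v)\<^sup>2) - quad V m f" for f
    proof -
      have "quad V M f = (\<Sum>u\<in>V. \<Sum>v\<in>V. (if u = v then r * (f u)\<^sup>2 else 0) - m u v * f u * f v)"
        unfolding quad_def M_def by (intro sum.cong refl) (simp add: algebra_simps power2_eq_square)
      also have "\<dots> = (\<Sum>u\<in>V. r * (f u)\<^sup>2) - quad V m f"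
        using fin by (simp add: sum_subtractf quad_def)
      finally show ?thesis by (simp add: sum_distrib_left)
    qed
    let ?h = "\<lambda>u. if u = v then 1 else 0 :: real"
    let ?b = "\<Sum>u\<in>V. \<Sum>w\<in>V. M u w * x w * ?h u"
    have "?b = 0"
    proof (rule linear_term_zero)
      fix t
      have "0 \<le> quad V M (\<lambda>u. x u + t * ?h u)" unfolding quadM using rayleigh by simp
      also have "\<dots> = quad V M x + 2 * t * ?b + t\<^sup>2 * quad V M ?h"
        by (rule quad_perturb[OF symM])
      also have "quad V M x = 0" unfolding quadM using x_norm by (simp add: r_def)
      finally show "0 \<le> 2 * t * ?b + t\<^sup>2 * quad V M ?h" by simp
    qed
    moreover have "?b = (\<Sum>w\<in>V. M v w * x w)"
    proof -
      have "?b = (\<Sum>u\<in>V. if u = v then \<Sum>w\<in>V. M u w * x w else 0)" by (intro sum.cong refl) simp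
      then show ?thesis using fin v by simp
    qed
    moreover have "(\<Sum>w\<in>V. M v w * x w) = r * x v - (\<Sum>w\<in>V. m v w * x w)"
    proof -
      have "(\<Sum>w\<in>V. M v w * x w) = (\<Sum>w\<in>V. (if v = w then r * x w else 0) - m v w * x w)"
        unfolding M_def by (intro sum.cong refl) (simp add: algebra_simps)
      then show ?thesis using fin v by (simp add: sum_subtractf)
    qed
    ultimately show ?thesis by simp
  qed
  moreover have "\<exists>v\<in>V. x v \<noteq> 0" using x_norm by (rule contrapos_pp) simp
  ultimately show ?thesis using x_nonneg rayleigh by (intro exI[of _ r] exI[of _ x]) simp
qed

abbreviation (input) arc_weight :: "'a pair_pre_digraph \<Rightarrow> 'a \<Rightarrow> 'a \<Rightarrow> real" where
  "arc_weight G u v \<equiv> (if (u, v) \<in> parcs G then 1 else 0)"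

text \<open>
  The Rayleigh inequality bounds every real eigenvalue by the one of the nonnegative eigenvector, which
  is thus the largest.
\<close>

lemma graph_spectral_radius_perron:
  assumes G: "pair_graph G" and ne: "pverts G \<noteq> {}"
  shows "\<exists>x. (\<forall>v\<in>pverts G. 0 \<le> x v) \<and> (\<exists>v\<in>pverts G. x v \<noteq> 0) \<and>
      (\<forall>v\<in>pverts G. (\<Sum>w\<in>pverts G. arc_weight G v w * x w) = graph_spectral_radius G * x v) \<and>
      (\<forall>f. quad (pverts G) (arc_weight G) f \<le> graph_spectral_radius G * (\<Sum>v\<in>pverts G. (f v)\<^sup>2))"
proof -
  interpret pair_graph G by (rule G)
  let ?V = "pverts G"
  have fin: "finite ?V" by simp
  have "(u, v) \<in> parcs G \<longleftrightarrow> (v, u) \<in> parcs G" for u v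
    using pair_sym_arcs by (auto simp: symmetric_def arcs_ends_conv dest: symD)
  then have sym: "arc_weight G u v = arc_weight G v u" and nonneg: "0 \<le> arc_weight G u v" for u v
    by auto
  let ?P = "\<lambda>r x. (\<forall>v\<in>?V. 0 \<le> x v) \<and> (\<exists>v\<in>?V. x v \<noteq> 0) \<and>
    (\<forall>v\<in>?V. (\<Sum>w\<in>?V. arc_weight G v w * x w) = r * x v) \<and>
    (\<forall>f. quad ?V (arc_weight G) f \<le> r * (\<Sum>v\<in>?V. (f v)\<^sup>2))"
  have "\<exists>r x. ?P r x" by (rule perron_vector_exists[OF fin ne sym nonneg])
  then obtain r where "\<exists>x. ?P r x" ..
  then obtain x where P: "?P r x" ..
  note x = conjunct1[OF P] conjunct1[OF conjunct2[OF P]] conjunct1[OF conjunct2[OF conjunct2[OF P]]]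
    and rayleigh = conjunct2[OF conjunct2[OF conjunct2[OF P]]]
  obtain vs where vs: "distinct vs" "set vs = ?V" using finite_distinct_list[OF fin] by auto
  let ?A = "adjacency_matrix vs G"
  have A: "?A \<in> carrier_mat (length vs) (length vs)" by (simp add: adjacency_matrix_def)
  have "graph_spectral_radius G = Max (spectrum ?A)" by (rule graph_spectral_radius_eq[OF vs])
  also have "\<dots> = r"
  proof (rule Max_eqI)
    show "finite (spectrum ?A)" by (rule card_finite_spectrum[OF A])
    have "\<forall>v\<in>?V. (\<Sum>w\<in>?V. if (v, w) \<in> parcs G then x w else 0) = r * x v"
      using x(3) by (simp add: if_distrib[of "\<lambda>z. z * _"] cong: if_cong)
    then show "r \<in> spectrum ?A"
      using x(2) unfolding spectrum_def eigenvalue_adjacency_matrix[OF vs, of G, THEN ext] by auto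
    fix k assume "k \<in> spectrum ?A"
    then obtain f where f: "\<exists>v\<in>?V. f v \<noteq> 0"
      "\<forall>v\<in>?V. (\<Sum>w\<in>?V. if (v, w) \<in> parcs G then f w else 0) = k * f v"
      unfolding spectrum_def using eigenvalue_adjacency_matrix[OF vs, of G] by auto
    have "quad ?V (arc_weight G) f = (\<Sum>u\<in>?V. f u * (\<Sum>v\<in>?V. if (u, v) \<in> parcs G then f v else 0))"
      unfolding quad_def sum_distrib_left by (intro sum.cong refl) simp
    also have "\<dots> = (\<Sum>u\<in>?V. f u * (k * f u))" using f(2) by (intro sum.cong refl) simp
    also have "\<dots> = k * (\<Sum>v\<in>?V. (f v)\<^sup>2)"
      by (simp add: sum_distrib_left power2_eq_square mult.left_commute)
    finally have "k * (\<Sum>v\<in>?V. (f v)\<^sup>2) \<le> r * (\<Sum>v\<in>?V. (f v)\<^sup>2)" using rayleigh by metis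
    moreover have "(\<Sum>v\<in>?V. (f v)\<^sup>2) > 0"
    proof -
      obtain v where "v \<in> ?V" "f v \<noteq> 0" using f(1) by auto
      then show ?thesis using fin by (intro sum_pos2[of _ v]) auto
    qed
    ultimately show "k \<le> r" by simp
  qed
  finally show ?thesis using x rayleigh by (intro exI[of _ x]) simp
qed

text \<open>
  The inequality of Hong, Shu and Fang.  Let \<open>D\<close> be the degrees and \<open>T\<close> their sum.  The sum of the
  degrees of the neighbours of \<open>u\<close> is \<open>T - D u\<close> minus the sum over the \<open>card V - 1 - D u\<close> other vertices, whose degrees
  are at least \<open>d\<close>.  Hence \<open>T - d (card V - 1) + (d - 1) D u\<close> bounds it from above.  Averaging with
  the eigenvector \<open>x\<close> turns sums of degrees of neighbours into \<open>r\<^sup>2\<close> and degrees into \<open>r\<close>.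
\<close>

lemma perron_edge_bound:
  fixes a :: "'a \<Rightarrow> 'a \<Rightarrow> real" and d r :: real
  assumes fin: "finite V" and sym: "\<And>u v. a u v = a v u" and irr: "\<And>u. a u u = 0"
    and a: "\<And>u v. a u v \<le> 1"
    and deg: "\<And>v. v \<in> V \<Longrightarrow> d \<le> (\<Sum>w\<in>V. a v w)"
    and x: "\<And>v. v \<in> V \<Longrightarrow> 0 \<le> x v" "\<exists>v\<in>V. x v \<noteq> 0"
    and eig: "\<And>v. v \<in> V \<Longrightarrow> (\<Sum>w\<in>V. a v w * x w) = r * x v"
  shows "r\<^sup>2 - (d - 1) * r \<le> (\<Sum>v\<in>V. \<Sum>w\<in>V. a v w) - d * (real (card V) - 1)"
proof -
  define D where "D v = (\<Sum>w\<in>V. a v w)" for v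
  define T where "T = (\<Sum>v\<in>V. D v)"
  define s where "s = (\<Sum>v\<in>V. x v)"
  have s: "s > 0"
  proof -
    obtain v where "v \<in> V" "x v \<noteq> 0" using x(2) by auto
    then show ?thesis unfolding s_def using fin x(1) by (intro sum_pos2[of _ v]) (auto simp: less_le)
  qed
  have "(\<Sum>v\<in>V. r * x v) = (\<Sum>v\<in>V. \<Sum>w\<in>V. a v w * x w)" using eig by (intro sum.cong) auto
  also have "\<dots> = (\<Sum>w\<in>V. D w * x w)"
    by (subst sum.swap) (simp add: D_def sum_distrib_right sym)
  finally have r1: "r * s = (\<Sum>w\<in>V. D w * x w)" by (simp add: s_def sum_distrib_left)
  have "r * (r * s) = (\<Sum>w\<in>V. D w * (r * x w))"
    unfolding r1 by (simp add: sum_distrib_left mult.left_commute)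
  also have "\<dots> = (\<Sum>w\<in>V. D w * (\<Sum>u\<in>V. a w u * x u))" using eig by (intro sum.cong) auto
  also have "\<dots> = (\<Sum>w\<in>V. \<Sum>u\<in>V. D w * a w u * x u)" by (simp add: sum_distrib_left mult.assoc)
  also have "\<dots> = (\<Sum>u\<in>V. (\<Sum>w\<in>V. D w * a w u) * x u)"
    by (subst sum.swap) (simp add: sum_distrib_right)
  also have "\<dots> \<le> (\<Sum>u\<in>V. (T - d * (real (card V) - 1) + (d - 1) * D u) * x u)"
  proof (intro sum_mono mult_right_mono x(1))
    fix u assume u: "u \<in> V"
    have "d * (\<Sum>w\<in>V - {u}. 1 - a w u) \<le> (\<Sum>w\<in>V - {u}. D w * (1 - a w u))"
      unfolding sum_distrib_left using deg a by (intro sum_mono mult_right_mono) (auto simp: D_def)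
    moreover have "(\<Sum>w\<in>V - {u}. 1 - a w u) = real (card V) - 1 - D u"
    proof -
      have "(\<Sum>w\<in>V. 1 - a w u) = (1 - a u u) + (\<Sum>w\<in>V - {u}. 1 - a w u)"
        using fin u by (rule sum.remove)
      moreover have "(\<Sum>w\<in>V. 1 - a w u) = real (card V) - D u"
        by (simp add: sum_subtractf D_def sym)
      ultimately show ?thesis by (simp add: irr)
    qed
    moreover have "(\<Sum>w\<in>V - {u}. D w * (1 - a w u)) = T - (\<Sum>w\<in>V. D w * a w u) - D u"
    proof -
      have "(\<Sum>w\<in>V. D w * (1 - a w u)) = D u * (1 - a u u) + (\<Sum>w\<in>V - {u}. D w * (1 - a w u))"
        using fin u by (rule sum.remove)
      moreover have "(\<Sum>w\<in>V. D w * (1 - a w u)) = T - (\<Sum>w\<in>V. D w * a w u)"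
        by (simp add: right_diff_distrib sum_subtractf T_def)
      ultimately show ?thesis by (simp add: irr)
    qed
    ultimately show "(\<Sum>w\<in>V. D w * a w u) \<le> T - d * (real (card V) - 1) + (d - 1) * D u"
      by (simp add: algebra_simps)
  qed
  also have "\<dots> = (T - d * (real (card V) - 1)) * s + (d - 1) * (r * s)"
  proof -
    have "(\<Sum>u\<in>V. (c + (d - 1) * D u) * x u) = c * s + (d - 1) * (\<Sum>u\<in>V. D u * x u)" for c
      by (simp add: s_def sum_distrib_left distrib_right sum.distrib mult.assoc)
    then show ?thesis unfolding r1 .
  qed
  finally have "(r\<^sup>2 - (d - 1) * r) * s \<le> (T - d * (real (card V) - 1)) * s"
    by (simp add: algebra_simps power2_eq_square)
  then show ?thesis using s by (simp add: T_def D_def)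
qed

text \<open>
  The indicator of the large clique has Rayleigh quotient exactly \<open>n - d - 2\<close>; a small positive weight
  at the other end of the joining edge increases it.
\<close>

lemma spectral_radius_bridged_cliques:
  assumes "d + 2 \<le> n"
  shows "real n - real d - 2 < graph_spectral_radius (bridged_cliques n d)"
proof -
  let ?G = "bridged_cliques n d"
  let ?B = "{d + 1..<n}"
  define N where "N = real n - real d - 1"
  have N: "N \<ge> 1" using assms by (simp add: N_def)
  have cardB: "real (card ?B) = N" using assms by (simp add: N_def of_nat_diff)
  have V: "pverts ?G = {0..<n}" by (simp add: bridged_cliques_def)
  \<comment> \<open>Scaled by \<open>N\<close>: the gain from the weight at \<open>d\<close> is linear in it, the cost quadratic, and \<open>1 / N\<close> is small enough.\<close>
  define f where "f v = (if v \<in> ?B then N else if v = d then 1 else 0)" for v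
  define g where "g = (\<lambda>(u, v). arc_weight ?G u v * f u * f v)"
  define S where "S = clique_arcs ?B"
  have "S = ?B \<times> ?B - (\<lambda>v. (v, v)) ` ?B" by (auto simp: S_def clique_arcs_def)
  then have "card S = card (?B \<times> ?B) - card ((\<lambda>v. (v, v)) ` ?B)"
    by (simp only:) (rule card_Diff_subset, auto)
  also have "card ((\<lambda>v. (v, v)) ` ?B) = card ?B" by (intro card_image) (auto simp: inj_on_def)
  finally have "card S = card ?B * card ?B - card ?B" by (simp add: card_cartesian_product)
  then have cardS: "real (card S) = N * N - N"
    using cardB by (metis le_square of_nat_diff of_nat_mult)
  have finS: "finite S" unfolding S_def clique_arcs_def
    by (rule finite_subset[of _ "?B \<times> ?B"]) auto
  have f_nonneg: "0 \<le> f v" for v using N by (simp add: f_def)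
  have "(N * N - N) * (N * N) + 2 * N = (\<Sum>p\<in>S. g p) + (\<Sum>p\<in>{(d, d + 1), (d + 1, d)}. g p)"
  proof -
    have "(\<Sum>p\<in>S. g p) = (\<Sum>p\<in>S. N * N)"
      by (intro sum.cong refl) (auto simp: g_def f_def S_def clique_arcs_def bridged_cliques_def)
    moreover have "(\<Sum>p\<in>{(d, d + 1), (d + 1, d)}. g p) = 2 * N"
      using assms by (simp add: g_def f_def bridged_cliques_def)
    ultimately show ?thesis using cardS by simp
  qed
  also have "\<dots> = (\<Sum>p\<in>S \<union> {(d, d + 1), (d + 1, d)}. g p)"
    using finS by (intro sum.union_disjoint[symmetric]) (auto simp: S_def clique_arcs_def)
  also have "\<dots> \<le> (\<Sum>p\<in>{0..<n} \<times> {0..<n}. g p)"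
    using assms f_nonneg by (intro sum_mono2) (auto simp: S_def clique_arcs_def g_def)
  also have "\<dots> = quad (pverts ?G) (arc_weight ?G) f"
    unfolding quad_def V by (simp add: g_def sum.cartesian_product)
  also have "\<dots> \<le> graph_spectral_radius ?G * (\<Sum>v\<in>pverts ?G. (f v)\<^sup>2)"
    using graph_spectral_radius_perron[OF pair_graph_bridged_cliques[OF assms]] assms V by auto
  also have "(\<Sum>v\<in>pverts ?G. (f v)\<^sup>2) = N * (N * N) + 1"
  proof -
    have "(\<Sum>v\<in>pverts ?G. (f v)\<^sup>2) = (\<Sum>v\<in>insert d ?B. (f v)\<^sup>2)"
      unfolding V using assms by (intro sum.mono_neutral_right) (auto simp: f_def)
    also have "\<dots> = (f d)\<^sup>2 + (\<Sum>v\<in>?B. (f v)\<^sup>2)" by simp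
    also have "(\<Sum>v\<in>?B. (f v)\<^sup>2) = (\<Sum>v\<in>?B. N * N)"
      by (intro sum.cong refl) (simp add: f_def power2_eq_square)
    also have "\<dots> = N * (N * N)" using cardB by (simp del: card_atLeastLessThan)
    finally show ?thesis by (simp add: f_def)
  qed
  finally have ray: "(N * N - N) * (N * N) + 2 * N \<le> graph_spectral_radius ?G * (N * (N * N) + 1)" .
  have "(N - 1) * (N * (N * N) + 1) < (N * N - N) * (N * N) + 2 * N"
    using N by (simp add: algebra_simps)
  then have "(N - 1) * (N * (N * N) + 1) < graph_spectral_radius ?G * (N * (N * N) + 1)"
    using ray by linarith
  moreover have "N * (N * N) + 1 > 0" using N by (simp add: add_pos_pos)
  ultimately have "N - 1 < graph_spectral_radius ?G" by (simp only: mult_less_cancel_right_pos)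
  then show ?thesis by (simp add: N_def)
qed

text \<open>
  The bound \<open>d (d + 1) + (n - d - 1) (n - d - 2)\<close> is the value of \<open>r\<^sup>2 - (d - 1) r + d (n - 1)\<close> at
  \<open>r = n - d - 2\<close>, and twice the number of edges of two disjoint cliques on \<open>d + 1\<close> and \<open>n - d - 1\<close>
  vertices.
\<close>

lemma spectral_radius_edge_count:
  fixes G :: "'a pair_pre_digraph" and d n :: nat
  assumes G: "pair_graph G" and n: "card (pverts G) = n" and d: "2 \<le> d" "2 * d + 2 \<le> n"
    and deg: "\<And>v. v \<in> pverts G \<Longrightarrow> d \<le> out_degree (with_proj G) v"
    and rho: "graph_spectral_radius (bridged_cliques n d) \<le> graph_spectral_radius G"
  shows "d * (d + 1) + (n - d - 1) * (n - d - 2) < (\<Sum>v\<in>pverts G. out_degree (with_proj G) v)"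
proof -
  interpret pair_graph G by (rule G)
  let ?V = "pverts G" and ?r = "graph_spectral_radius G"
  have fin: "finite ?V" by simp
  have ne: "?V \<noteq> {}" using n d by auto
  have "(u, v) \<in> parcs G \<longleftrightarrow> (v, u) \<in> parcs G" for u v
    using pair_sym_arcs by (auto simp: symmetric_def arcs_ends_conv dest: symD)
  then have sym: "arc_weight G u v = arc_weight G v u" for u v by auto
  have irr: "arc_weight G u u = 0" for u using pair_no_loops[of "(u, u)"] by auto
  have degree: "(\<Sum>w\<in>?V. arc_weight G v w) = real (out_degree (with_proj G) v)" for v
  proof -
    have "out_arcs (with_proj G) v = Pair v ` {w \<in> ?V. (v, w) \<in> parcs G}"
      using in_arcsD2 by (auto simp: out_arcs_def image_iff)
    then have "out_degree (with_proj G) v = card {w \<in> ?V. (v, w) \<in> parcs G}"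
      unfolding out_degree_def by (simp add: card_image inj_on_def)
    moreover have "(\<Sum>w\<in>?V. arc_weight G v w) = real (card {w \<in> ?V. (v, w) \<in> parcs G})"
      using fin by (simp add: sum.If_cases Int_def)
    ultimately show ?thesis by simp
  qed
  obtain x where x: "(\<forall>v\<in>?V. 0 \<le> x v) \<and> (\<exists>v\<in>?V. x v \<noteq> 0) \<and>
      (\<forall>v\<in>?V. (\<Sum>w\<in>?V. arc_weight G v w * x w) = ?r * x v) \<and>
      (\<forall>f. quad ?V (arc_weight G) f \<le> ?r * (\<Sum>v\<in>?V. (f v)\<^sup>2))"
    using graph_spectral_radius_perron[OF G ne] ..
  have "?r\<^sup>2 - (real d - 1) * ?r \<le> (\<Sum>v\<in>?V. \<Sum>w\<in>?V. arc_weight G v w) - real d * (real (card ?V) - 1)"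
  proof (rule perron_edge_bound[where x = x, OF fin sym irr])
    show "real d \<le> (\<Sum>w\<in>?V. arc_weight G v w)" if "v \<in> ?V" for v
      unfolding degree using deg[OF that] by simp
  qed (use x in auto)
  then have bound: "?r\<^sup>2 - (real d - 1) * ?r \<le>
      real (\<Sum>v\<in>?V. out_degree (with_proj G) v) - real d * (real n - 1)"
    unfolding degree n by simp
  define s where "s = real n - real d - 2"
  have "s < ?r" unfolding s_def using spectral_radius_bridged_cliques[of d n] d rho by linarith
  moreover have "s \<ge> real d" unfolding s_def using d by simp
  ultimately have "0 < (?r - s) * (?r + s - (real d - 1))" by (intro mult_pos_pos) auto
  then have "s\<^sup>2 - (real d - 1) * s < ?r\<^sup>2 - (real d - 1) * ?r"
    by (simp add: algebra_simps power2_eq_square)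
  then have "s\<^sup>2 - (real d - 1) * s + real d * (real n - 1) < real (\<Sum>v\<in>?V. out_degree (with_proj G) v)"
    using bound by linarith
  moreover have "s\<^sup>2 - (real d - 1) * s + real d * (real n - 1) = real (d * (d + 1) + (n - d - 1) * (n - d - 2))"
  proof -
    have "real (n - d - 1) = real n - real d - 1" "real (n - d - 2) = real n - real d - 2"
      using d by (simp_all add: of_nat_diff)
    then show ?thesis unfolding of_nat_add of_nat_mult s_def by (simp add: algebra_simps power2_eq_square)
  qed
  ultimately show ?thesis by (simp only: of_nat_less_iff)
qed

section \<open>Undirected edges of symmetric digraphs\<close>

definition undirected_edges :: "'a pair_pre_digraph \<Rightarrow> 'a set set" where
  "undirected_edges G = (\<lambda>(u, v). {u, v}) ` parcs G"

lemma pair_graph_sym: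
  assumes "pair_graph G"
  shows "(u, v) \<in> parcs G \<longleftrightarrow> (v, u) \<in> parcs G"
proof -
  interpret pair_graph G by (rule assms)
  show ?thesis using pair_sym_arcs by (auto simp: symmetric_def arcs_ends_conv dest: symD)
qed

lemma doubleton_in_undirected_edges:
  assumes "pair_graph G"
  shows "{u, v} \<in> undirected_edges G \<longleftrightarrow> (u, v) \<in> parcs G"
proof
  assume "{u, v} \<in> undirected_edges G"
  then obtain x y where "(x, y) \<in> parcs G" "{u, v} = {x, y}" by (auto simp: undirected_edges_def)
  then show "(u, v) \<in> parcs G" using pair_graph_sym[OF assms] by (auto simp: doubleton_eq_iff)
qed (force simp: undirected_edges_def)

lemma undirected_edgeE:
  assumes "e \<in> undirected_edges G"
  obtains u v where "e = {u, v}" "(u, v) \<in> parcs G"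
  using assms by (auto simp: undirected_edges_def)

lemma multigraph_undirected_edges:
  assumes "pair_graph G"
  shows "multigraph (pverts G) (undirected_edges G) own_ends"
proof -
  interpret pair_graph G by (rule assms)
  have "e \<subseteq> pverts G \<and> card e = 2" if e: "e \<in> undirected_edges G" for e
  proof -
    obtain u v where uv: "e = {u, v}" "(u, v) \<in> parcs G" using undirected_edgeE[OF e] .
    then have "u \<in> pverts G" "v \<in> pverts G" "u \<noteq> v"
      using in_arcsD1 in_arcsD2 pair_no_loops[of "(u, v)"] by auto
    then show ?thesis using uv(1) by simp
  qed
  then show ?thesis by (simp add: multigraph_def undirected_edges_def)
qed

lemma out_degree_undirected_edges:
  assumes "pair_graph G"
  shows "out_degree (with_proj G) v = edge_degree own_ends (undirected_edges G) v"
proof -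
  have "out_arcs (with_proj G) v = Pair v ` nbrs (undirected_edges G) v"
    by (auto simp: out_arcs_def nbrs_def doubleton_in_undirected_edges[OF assms])
  then have "out_degree (with_proj G) v = card (nbrs (undirected_edges G) v)"
    unfolding out_degree_def by (simp add: card_image inj_on_def)
  then show ?thesis using card_nbrs[OF multigraph_undirected_edges[OF assms]] by simp
qed

text \<open>
  A set of vertices closed under adjacency contains everything reachable from it, and the set of vertices
  reachable from a given one is closed under adjacency.
\<close>

lemma connected_iff_cut_connected:
  assumes G: "pair_graph G"
  shows "Digraph_Component.connected (with_proj G) \<longleftrightarrow>
    pverts G \<noteq> {} \<and> cut_connected own_ends (undirected_edges G) (pverts G)"
proof -
  interpret pair_graph G by (rule G)
  have "mk_symmetric (with_proj G) = G"
  proof -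
    have "(\<Union>e\<in>parcs G. {(fst e, snd e), (snd e, fst e)}) = parcs G"
      using pair_graph_sym[OF G] by auto
    then show ?thesis by (simp add: mk_symmetric_def)
  qed
  then have conn: "Digraph_Component.connected (with_proj G) \<longleftrightarrow> strongly_connected (with_proj G)"
    by (simp add: connected_def)
  show ?thesis
  proof
    assume "Digraph_Component.connected (with_proj G)"
    then have ne: "pverts G \<noteq> {}"
      and reach: "\<And>u v. u \<in> pverts G \<Longrightarrow> v \<in> pverts G \<Longrightarrow> u \<rightarrow>\<^sup>*\<^bsub>with_proj G\<^esub> v"
      unfolding conn strongly_connected_def by auto
    have "cut_connected own_ends (undirected_edges G) (pverts G)"
    proof (rule cut_connectedI)
      fix X assume X: "X \<subseteq> pverts G" "X \<noteq> {}"
        and closed: "\<And>e a b. e \<in> undirected_edges G \<Longrightarrow> a \<in> e \<Longrightarrow> b \<in> e \<Longrightarrow> a \<in> X \<Longrightarrow> b \<in> X"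
      obtain x where x: "x \<in> X" using X by auto
      show "pverts G \<subseteq> X"
      proof
        fix v assume "v \<in> pverts G"
        then have "x \<rightarrow>\<^sup>*\<^bsub>with_proj G\<^esub> v" using x X by (intro reach) auto
        then have "(x, v) \<in> (parcs G)\<^sup>*" using reachable_rtranclI by fastforce
        then show "v \<in> X"
        proof (induction rule: rtrancl_induct)
          case (step y z)
          then have "{y, z} \<in> undirected_edges G" using doubleton_in_undirected_edges[OF G] by simp
          then show ?case using closed[of "{y, z}" y z] step by simp
        qed (rule x)
      qed
    qed
    then show "pverts G \<noteq> {} \<and> cut_connected own_ends (undirected_edges G) (pverts G)" using ne by simp
  next
    assume asm: "pverts G \<noteq> {} \<and> cut_connected own_ends (undirected_edges G) (pverts G)"
    have "u \<rightarrow>\<^sup>*\<^bsub>with_proj G\<^esub> v" if uv: "u \<in> pverts G" "v \<in> pverts G" for u v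
    proof -
      define X where "X = {w \<in> pverts G. u \<rightarrow>\<^sup>*\<^bsub>with_proj G\<^esub> w}"
      have "X = pverts G"
      proof (rule ccontr)
        assume "X \<noteq> pverts G"
        then have psub: "X \<subset> pverts G" by (auto simp: X_def)
        have "u \<in> X" using uv by (simp add: X_def)
        then have "X \<noteq> {}" by auto
        obtain e a b where e: "e \<in> undirected_edges G" "a \<in> e" "a \<in> X" "b \<in> e" "b \<notin> X"
          using cut_connectedD[OF conjunct2[OF asm] psub \<open>X \<noteq> {}\<close>] .
        obtain y z where yz: "e = {y, z}" "(y, z) \<in> parcs G" using undirected_edgeE[OF e(1)] .
        have "a \<noteq> b" using e by auto
        then have b: "(a, b) \<in> parcs G" using yz e(2,4) pair_graph_sym[OF G] by auto
        have "u \<rightarrow>\<^sup>*\<^bsub>with_proj G\<^esub> a" using e(3) by (simp add: X_def)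
        from reachable_trans[OF this reachable_adjI[OF b]] have "b \<in> X"
          using in_arcsD2[OF b] by (simp add: X_def)
        then show False using e(5) by simp
      qed
      then show ?thesis using uv by (auto simp: X_def)
    qed
    then show "Digraph_Component.connected (with_proj G)"
      unfolding conn strongly_connected_def using asm by simp
  qed
qed

lemma supereulerian_imp_connected_even_factor:
  assumes G: "pair_graph G" and ne: "pverts G \<noteq> {}"
    and se: "supereulerian (pverts G) (undirected_edges G)"
  shows "\<exists>H. connected_even_factor H G"
proof -
  interpret pair_graph G by (rule G)
  obtain F where F: "F \<subseteq> undirected_edges G" "cut_connected own_ends F (pverts G)"
    "is_join own_ends F (pverts G) {}"
    using se unfolding supereulerian_def by auto
  define H where "H = \<lparr> pverts = pverts G, parcs = {(u, v) \<in> parcs G. {u, v} \<in> F} \<rparr>"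
  have H_sub: "parcs H \<subseteq> parcs G" "pverts H = pverts G" by (auto simp: H_def)
  have H_sym: "(v, u) \<in> parcs H" if "(u, v) \<in> parcs H" for u v
    using that pair_graph_sym[OF G] by (auto simp: H_def insert_commute)
  have H: "pair_graph H"
  proof
    show "finite (pverts H)" using H_sub by simp
    show "finite (parcs H)" using H_sub(1) pair_finite_arcs by (rule finite_subset)
    show "fst e \<in> pverts H" if "e \<in> parcs H" for e
      using that H_sub arc_fst_in_verts[of e] by auto
    show "snd e \<in> pverts H" if "e \<in> parcs H" for e
      using that H_sub arc_snd_in_verts[of e] by auto
    show "fst e \<noteq> snd e" if "e \<in> parcs H" for e
      using that H_sub pair_no_loops[of e] by auto
    show "symmetric (with_proj H)"
      using H_sym by (auto simp: symmetric_def intro: symI)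
  qed
  have edges_H: "undirected_edges H = F"
  proof (intro subset_antisym subsetI)
    fix e assume "e \<in> undirected_edges H"
    then show "e \<in> F" by (auto simp: undirected_edges_def H_def)
  next
    fix e assume e: "e \<in> F"
    then obtain u v where uv: "e = {u, v}" "(u, v) \<in> parcs G" using F(1) undirected_edgeE by blast
    then have "(u, v) \<in> parcs H" using e by (simp add: H_def)
    then show "e \<in> undirected_edges H" using uv(1) doubleton_in_undirected_edges[OF H] by simp
  qed
  have "connected_even_factor H G"
    unfolding connected_even_factor_def
  proof (intro conjI H ballI)
    interpret H: pair_graph H by (rule H)
    show "spanning (with_proj H) (with_proj G)"
      using H_sub H.wf_digraph wf_digraph by (auto simp: spanning_def subgraph_def compatible_def)
    show "Digraph_Component.connected (with_proj H)"
      unfolding connected_iff_cut_connected[OF H] edges_H H_sub(2) using ne F(2) by simp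
    show "even (out_degree (with_proj H) v)" if "v \<in> pverts H" for v
      unfolding out_degree_undirected_edges[OF H] edges_H
      using F(3) that H_sub(2) by (simp add: is_join_def)
  qed
  then show ?thesis by (rule exI)
qed

lemma digraph_isoI:
  assumes G: "pair_graph G" and f: "bij_betw f (pverts G) (pverts H)"
    and arcs: "\<And>u v. u \<in> pverts G \<Longrightarrow> v \<in> pverts G \<Longrightarrow> (u, v) \<in> parcs G \<longleftrightarrow> (f u, f v) \<in> parcs H"
    and H: "parcs H \<subseteq> pverts H \<times> pverts H"
  shows "digraph_iso (with_proj G) (with_proj H)"
proof -
  interpret pair_graph G by (rule G)
  let ?h = "\<lparr> iso_verts = f, iso_arcs = map_prod f f, iso_head = snd, iso_tail = fst \<rparr>"
  have inj: "inj_on f (pverts G)" and im: "f ` pverts G = pverts H"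
    using f by (auto simp: bij_betw_def)
  have sub: "parcs G \<subseteq> pverts G \<times> pverts G" using in_arcsD1 in_arcsD2 by auto
  have "inj_on (map_prod f f) (parcs G)"
    using map_prod_inj_on[OF inj inj] sub by (rule inj_on_subset)
  then have "digraph_isomorphism ?h"
    unfolding digraph_isomorphism_def using inj wf_digraph by simp
  moreover have "map_prod f f ` parcs G = parcs H"
  proof (intro subset_antisym subsetI)
    fix p assume "p \<in> map_prod f f ` parcs G"
    then obtain u v where "(u, v) \<in> parcs G" "p = (f u, f v)" by auto
    then show "p \<in> parcs H" using arcs sub by auto
  next
    fix p assume p: "p \<in> parcs H"
    then have "p \<in> (f ` pverts G) \<times> (f ` pverts G)" using H unfolding im by (rule subsetD[rotated])
    then obtain u v where uv: "p = (f u, f v)" "u \<in> pverts G" "v \<in> pverts G" by (elim SigmaE imageE) simp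
    then have "(u, v) \<in> parcs G" using arcs p by simp
    then show "p \<in> map_prod f f ` parcs G" using uv(1) by force
  qed
  then have "with_proj H = app_iso ?h (with_proj G)"
    by (simp add: with_proj_def app_iso_def im)
  ultimately show ?thesis unfolding digraph_iso_def by (intro exI[of _ ?h]) simp
qed

lemma ex_bij_betw_pointed:
  assumes "finite A" "finite B" "card A = card B" "a \<in> A" "b \<in> B"
  shows "\<exists>f. bij_betw f A B \<and> f a = b"
proof -
  have "card (A - {a}) = card (B - {b})" using assms by simp
  then obtain g where g: "bij_betw g (A - {a}) (B - {b})"
    using assms finite_same_card_bij by (metis finite_Diff)
  have "bij_betw (g(a := b)) (A - {a}) (B - {b})"
    using g by (subst bij_betw_cong[where g = g]) auto
  moreover have "bij_betw (g(a := b)) {a} {b}" by simp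
  ultimately have "bij_betw (g(a := b)) ((A - {a}) \<union> {a}) ((B - {b}) \<union> {b})"
    by (rule bij_betw_combine) auto
  moreover have "(A - {a}) \<union> {a} = A" "(B - {b}) \<union> {b} = B" using assms by auto
  ultimately show ?thesis by (intro exI[of _ "g(a := b)"]) simp
qed

text \<open>
  Any bijection that maps \<open>A\<close> to the small clique and matches the ends of the joining edges is an
  isomorphism.
\<close>

lemma digraph_iso_bridged_cliques:
  assumes G: "pair_graph G" and n: "card (pverts G) = n" and dn: "d + 2 \<le> n"
    and A: "A \<subseteq> pverts G" "card A = d + 1" and x: "x \<in> A" and y: "y \<in> pverts G - A"
    and E: "undirected_edges G =
      {e. e \<subseteq> A \<and> card e = 2} \<union> {e. e \<subseteq> pverts G - A \<and> card e = 2} \<union> {{x, y}}"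
  shows "digraph_iso (with_proj G) (with_proj (bridged_cliques n d))"
proof -
  interpret pair_graph G by (rule G)
  let ?V = "pverts G" and ?B = "pverts G - A"
  have fin: "finite ?V" "finite A" using finite_subset[OF A(1)] by simp_all
  have cardB: "card ?B = n - d - 1" using card_Diff_subset[OF fin(2) A(1)] A(2) n by simp
  obtain f where f: "bij_betw f A {0..d} \<and> f x = d"
    using ex_bij_betw_pointed[OF fin(2), of "{0..d}" x d] A(2) x by auto
  obtain g where g: "bij_betw g ?B {d + 1..<n} \<and> g y = d + 1"
    using ex_bij_betw_pointed[of ?B "{d + 1..<n}" y "d + 1"] cardB y fin dn by auto
  define h where "h v = (if v \<in> A then f v else g v)" for v
  have hA: "bij_betw h A {0..d}"
    using f by (subst bij_betw_cong[where g = f]) (auto simp: h_def)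
  have hB: "bij_betw h ?B {d + 1..<n}"
    using g by (subst bij_betw_cong[where g = g]) (auto simp: h_def)
  have hx: "h x = d" and hy: "h y = d + 1" using f g x y by (auto simp: h_def)
  have hV: "bij_betw h ?V {0..<n}"
  proof -
    have "bij_betw h (A \<union> ?B) ({0..d} \<union> {d + 1..<n})" using hA hB by (rule bij_betw_combine) auto
    moreover have "A \<union> ?B = ?V" "{0..d} \<union> {d + 1..<n} = {0..<n}" using A(1) dn by auto
    ultimately show ?thesis by simp
  qed
  have inj: "h u = h v \<longleftrightarrow> u = v" if "u \<in> ?V" "v \<in> ?V" for u v
    using hV that by (auto simp: bij_betw_def inj_on_eq_iff)
  have mem_A: "h v \<in> {0..d} \<longleftrightarrow> v \<in> A" and mem_B: "h v \<in> {d + 1..<n} \<longleftrightarrow> v \<notin> A" if "v \<in> ?V" for v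
  proof -
    have "v \<in> A \<Longrightarrow> h v \<in> {0..d}" "v \<notin> A \<Longrightarrow> h v \<in> {d + 1..<n}"
      using bij_betwE[OF hA] bij_betwE[OF hB] that by blast+
    then show "h v \<in> {0..d} \<longleftrightarrow> v \<in> A" "h v \<in> {d + 1..<n} \<longleftrightarrow> v \<notin> A"
      by (cases "v \<in> A"; simp)+
  qed
  have xV: "x \<in> ?V" "y \<in> ?V" using A x y by auto
  have h_x: "h v = d \<longleftrightarrow> v = x" and h_y: "h v = d + 1 \<longleftrightarrow> v = y" if "v \<in> ?V" for v
    using inj[OF that xV(1)] inj[OF that xV(2)] hx hy by simp_all
  have arcs: "(u, v) \<in> parcs G \<longleftrightarrow> (h u, h v) \<in> parcs (bridged_cliques n d)" if uv: "u \<in> ?V" "v \<in> ?V" for u v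
  proof -
    have "(u, v) \<in> parcs G \<longleftrightarrow> {u, v} \<in> undirected_edges G"
      using doubleton_in_undirected_edges[OF G] by simp
    also have "\<dots> \<longleftrightarrow> (u \<in> A \<and> v \<in> A \<and> u \<noteq> v) \<or> (u \<notin> A \<and> v \<notin> A \<and> u \<noteq> v) \<or>
        (u = x \<and> v = y) \<or> (u = y \<and> v = x)"
    proof -
      have "card {u, v} = 2 \<longleftrightarrow> u \<noteq> v" by (cases "u = v") simp_all
      then show ?thesis unfolding E using uv by (simp add: doubleton_eq_iff) argo
    qed
    also have "\<dots> \<longleftrightarrow> (h u \<in> {0..d} \<and> h v \<in> {0..d} \<and> h u \<noteq> h v) \<or>
        (h u \<in> {d + 1..<n} \<and> h v \<in> {d + 1..<n} \<and> h u \<noteq> h v) \<or>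
        (h u = d \<and> h v = d + 1) \<or> (h u = d + 1 \<and> h v = d)"
      unfolding mem_A[OF uv(1)] mem_A[OF uv(2)] mem_B[OF uv(1)] mem_B[OF uv(2)] inj[OF uv]
        h_x[OF uv(1)] h_x[OF uv(2)] h_y[OF uv(1)] h_y[OF uv(2)] ..
    also have "\<dots> \<longleftrightarrow> (h u, h v) \<in> parcs (bridged_cliques n d)"
      by (simp add: bridged_cliques_def clique_arcs_def) argo
    finally show ?thesis .
  qed
  have sub: "parcs (bridged_cliques n d) \<subseteq> pverts (bridged_cliques n d) \<times> pverts (bridged_cliques n d)"
    using dn by (auto simp: bridged_cliques_def clique_arcs_def)
  have "bij_betw h ?V (pverts (bridged_cliques n d))" using hV by (simp add: bridged_cliques_def)
  from digraph_isoI[OF G this arcs sub] show ?thesis .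
qed

section \<open>Spectral condition for connected even factors\<close>

theorem theorem1p3:
  fixes G :: "'a pair_pre_digraph" and n \<delta> :: nat
  assumes "\<delta> \<ge> 2"
    and "pair_graph G" and "Digraph_Component.connected (with_proj G)"
    and "card (pverts G) = n"
    and "min_degree G \<ge> \<delta>"
    and "\<delta> \<in> {2, 3} \<longrightarrow> n \<ge> 8"
    and "\<delta> \<ge> 4 \<longrightarrow> n \<ge> 2 * \<delta> + 2"
    and "graph_spectral_radius G \<ge> graph_spectral_radius (bridged_cliques n \<delta>)"
  shows "(\<exists>H. connected_even_factor H G) \<or>
         digraph_iso (with_proj G) (with_proj (bridged_cliques n \<delta>))"
proof -
  interpret pair_graph G by (rule assms(2))
  let ?E = "undirected_edges G" and ?V = "pverts G"
  have n: "2 * \<delta> + 2 \<le> n" "8 \<le> n" using assms(1,6,7) by (cases "\<delta> \<le> 3"; auto)+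
  have ne: "?V \<noteq> {}" and conn: "cut_connected own_ends ?E ?V"
    using assms(3) unfolding connected_iff_cut_connected[OF assms(2)] by auto
  have mg: "multigraph ?V ?E own_ends" by (rule multigraph_undirected_edges[OF assms(2)])
  have out_deg: "\<delta> \<le> out_degree (with_proj G) v" if "v \<in> ?V" for v
  proof -
    have "min_degree G \<le> out_degree (with_proj G) v"
      unfolding min_degree_def using that by (intro Min_le) auto
    then show ?thesis using assms(5) by simp
  qed
  have deg: "\<delta> \<le> edge_degree own_ends ?E v" if "v \<in> ?V" for v
    using out_deg[OF that] unfolding out_degree_undirected_edges[OF assms(2)] .
  have "\<delta> * (\<delta> + 1) + (n - \<delta> - 1) * (n - \<delta> - 2) < (\<Sum>v\<in>?V. out_degree (with_proj G) v)"
    by (rule spectral_radius_edge_count[OF assms(2,4,1) n(1) out_deg assms(8)])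
  then have less: "\<delta> * (\<delta> + 1) + (n - \<delta> - 1) * (n - \<delta> - 2) < 2 * card ?E"
    unfolding out_degree_undirected_edges[OF assms(2)] handshake[OF mg] .
  \<comment> \<open>Both sides of the strict inequality are even.\<close>
  have edges: "\<delta> * (\<delta> + 1) + (n - \<delta> - 1) * (n - \<delta> - 2) + 2 \<le> 2 * card ?E"
  proof -
    obtain r where "n - \<delta> - 2 = r" "n - \<delta> - 1 = r + 1" using n by simp
    then have "even (\<delta> * (\<delta> + 1) + (n - \<delta> - 1) * (n - \<delta> - 2))" by (simp del: diff_diff_left)
    then obtain m where "\<delta> * (\<delta> + 1) + (n - \<delta> - 1) * (n - \<delta> - 2) = 2 * m" by (rule evenE)
    then show ?thesis using less by simp
  qed
  show ?thesis
  proof (cases "\<exists>X. X \<subset> ?V \<and> X \<noteq> {} \<and> card (edge_cut own_ends ?E X) < 2")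
    case True
    then obtain X where X: "X \<subset> ?V" "X \<noteq> {}" "card (edge_cut own_ends ?E X) < 2" by auto
    have "edge_cut own_ends ?E X \<noteq> {}" using conn X(1,2) by (simp add: cut_connected_def)
    moreover have "finite (edge_cut own_ends ?E X)" using mg by (simp add: edge_cut_def multigraph_def)
    ultimately have "card (edge_cut own_ends ?E X) \<noteq> 0" by simp
    then have one: "card (edge_cut own_ends ?E X) = 1" using X(3) by linarith
    have "\<exists>A x y. A \<subseteq> ?V \<and> card A = \<delta> + 1 \<and> x \<in> A \<and> y \<in> ?V - A \<and>
      ?E = {e. e \<subseteq> A \<and> card e = 2} \<union> {e. e \<subseteq> ?V - A \<and> card e = 2} \<union> {{x, y}}"
      by (rule dense_cut_edge_structure[OF mg assms(4,1) deg X(1,2) one edges])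
    then obtain A x y where A: "A \<subseteq> ?V" "card A = \<delta> + 1" "x \<in> A" "y \<in> ?V - A"
      "?E = {e. e \<subseteq> A \<and> card e = 2} \<union> {e. e \<subseteq> ?V - A \<and> card e = 2} \<union> {{x, y}}"
      by (elim exE conjE)
    have "\<delta> + 2 \<le> n" using n by simp
    from digraph_iso_bridged_cliques[OF assms(2,4) this A] show ?thesis ..
  next
    case False
    have "supereulerian ?V ?E"
    proof (rule dense_supereulerian[OF mg assms(4,1) n deg _ edges])
      show "2 \<le> card (edge_cut own_ends ?E X)" if "X \<subset> ?V" "X \<noteq> {}" for X
        using False that by (auto simp: not_less)
    qed
    then show ?thesis using supereulerian_imp_connected_even_factor[OF assms(2) ne] by simp
  qed
qed

end
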